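(* Let $n\ge1$ and let $(\nu,\mu)\in\mathbb{R}^2$ with $\mu>0$. For fixed $l\in\{0,1,2,\dots\}$, let $P_l$ be the orthogonal projection operator from $L^2(\mathbb{C}^n,dm)$ onto the eigenspace $A^2_l(\Delta_{\nu,\mu})$ of $\Delta_{\nu,\mu}$ with eigenvalue $-2\mu(2l+n)$. Then the Schwartz kernel $P^{\nu,\mu}_l(z,w)$ of the operator $P_l$ is given by $$P^{\nu,\mu}_l(z,w)=\left(\frac{\mu}{\pi}\right)^n\frac{(n-1+l)!}{(n-1)!\,l!}\,j^{\nu,\mu}(z,w)\,e^{-\frac{\mu}{2}|z-w|^2}\,{}_1F_1(-l;n;\mu|z-w|^2),$$ where, for $z,w\in\mathbb{C}^n$, $$j^{\nu,\mu}(z,w)=e^{-\frac{i\nu}{2}(|z|^2-|w|^2)+\frac{\mu}{2}\left(\langle z,w\rangle-\overline{\langle z,w\rangle}\right)}.$$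
   Context: $\langle z,w\rangle=\sum_{j=1}^n z_j\overline{w_j}$. The operator $\Delta_{\nu,\mu}$ on $\mathbb{C}^n=\mathbb{R}^{2n}$ is $$\Delta_{\nu,\mu}=4\sum_{j=1}^n\frac{\partial^2}{\partial z_j\partial\bar z_j}+2i\nu(E+\overline{E}+n)+2\mu(E-\overline{E})-(\nu^2+\mu^2)|z|^2,$$ with $E=\sum_{j=1}^n z_j\frac{\partial}{\partial z_j}$ and $\overline{E}=\sum_{j=1}^n\bar z_j\frac{\partial}{\partial\bar z_j}$. $L^2(\mathbb{C}^n,dm)$ is the Hilbert space of complex-valued square integrable functions with respect to Lebesgue measure $dm$ on $\mathbb{C}^n=\mathbb{R}^{2n}$, and $$A^2_l(\Delta_{\nu,\mu})=\{F\in L^2(\mathbb{C}^n,dm)\cap\mathcal{C}^\infty(\mathbb{C}^n):\ \Delta_{\nu,\mu}F=-2\mu(2l+n)F\}.$$ The Schwartz kernel of $P_l$ is the kernel for which $P_lf(z)=\int_{\mathbb{C}^n}P^{\nu,\mu}_l(z,w)f(w)\,dm(w)$. ${}_1F_1(a;c;x)=1+\frac{a}{c}\frac{x}{1!}+\frac{a(a+1)}{c(c+1)}\frac{x^2}{2!}+\cdots$ is the confluent hypergeometric function. *)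

theory Defs
  imports "HOL-Analysis.Analysis"
begin

text \<open>The space $\mathbb{C}^n$ is \<open>complex ^ 'n\<close> with $n = $ \<open>CARD('n)\<close>; its norm is the Euclidean
  norm of $\mathbb{R}^{2n}$ and \<open>lebesgue\<close> is Lebesgue measure on $\mathbb{R}^{2n}$.\<close>

definition hermitian :: "complex ^ 'n \<Rightarrow> complex ^ 'n \<Rightarrow> complex" where
  "hermitian z w = (\<Sum>j\<in>UNIV. z $ j * cnj (w $ j))"

text \<open>Elements of $L^2$ are represented by functions; functions that agree almost everywhere are
  not identified.\<close>

definition L2 :: "('a::euclidean_space \<Rightarrow> complex) set" where
  "L2 = {f \<in> borel_measurable lebesgue. integrable lebesgue (\<lambda>x. (norm (f x))\<^sup>2)}"

definition L2_inner :: "('a::euclidean_space \<Rightarrow> complex) \<Rightarrow> ('a \<Rightarrow> complex) \<Rightarrow> complex" where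
  "L2_inner f g = (\<integral>x. f x * cnj (g x) \<partial>lebesgue)"

text \<open>\<open>P\<close> sends each $f \in L^2$ to the element \<open>P f\<close> of \<open>A\<close> with $f - Pf \perp A$. Only the
  values of \<open>P\<close> on \<open>L2\<close> matter. If \<open>A\<close> consists of continuous functions, \<open>P f\<close> is determined
  as a function, not only up to null sets.\<close>

definition orthogonal_projection_onto ::
    "('a::euclidean_space \<Rightarrow> complex) set \<Rightarrow> (('a \<Rightarrow> complex) \<Rightarrow> ('a \<Rightarrow> complex)) \<Rightarrow> bool" where
  "orthogonal_projection_onto A P \<longleftrightarrow>
     (\<forall>f\<in>L2. P f \<in> A \<and> (\<forall>g\<in>A. L2_inner (\<lambda>x. f x - P f x) g = 0))"

text \<open>The integral formula is required at every point \<open>z\<close>, which is meaningful for operators whose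
  values are continuous functions. Integrability is explicit because the Bochner integral of a
  non-integrable function is 0.\<close>

definition schwartz_kernel ::
    "(('a::euclidean_space \<Rightarrow> complex) \<Rightarrow> ('a \<Rightarrow> complex)) \<Rightarrow> ('a \<Rightarrow> 'a \<Rightarrow> complex) \<Rightarrow> bool" where
  "schwartz_kernel P K \<longleftrightarrow>
     (\<forall>f\<in>L2. \<forall>z. integrable lebesgue (\<lambda>w. K z w * f w) \<and>
                 P f z = (\<integral>w. K z w * f w \<partial>lebesgue))"

text \<open>Real differentiability of class $\mathcal{C}^k$, by recursion on the partial derivatives.\<close>

primrec C_diff :: "nat \<Rightarrow> ('a::euclidean_space \<Rightarrow> complex) \<Rightarrow> bool" where
  "C_diff 0 f \<longleftrightarrow> continuous_on UNIV f"
| "C_diff (Suc k) f \<longleftrightarrow> (\<forall>x. f differentiable at x) \<and>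
     (\<forall>b\<in>Basis. C_diff k (\<lambda>x. frechet_derivative f (at x) b))"

definition C_infinity :: "('a::euclidean_space \<Rightarrow> complex) \<Rightarrow> bool" where
  "C_infinity f \<longleftrightarrow> (\<forall>k. C_diff k f)"

text \<open>The Wirtinger derivatives $\frac12(\partial_{x_j} \mp i\,\partial_{y_j})$ for
  $z_j = x_j + i y_j$.\<close>

definition d_z :: "'n \<Rightarrow> (complex ^ 'n \<Rightarrow> complex) \<Rightarrow> complex ^ 'n \<Rightarrow> complex" where
  "d_z j f z = (frechet_derivative f (at z) (axis j 1)
                - \<i> * frechet_derivative f (at z) (axis j \<i>)) / 2"

definition d_zbar :: "'n \<Rightarrow> (complex ^ 'n \<Rightarrow> complex) \<Rightarrow> complex ^ 'n \<Rightarrow> complex" where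
  "d_zbar j f z = (frechet_derivative f (at z) (axis j 1)
                   + \<i> * frechet_derivative f (at z) (axis j \<i>)) / 2"

definition Euler :: "(complex ^ 'n \<Rightarrow> complex) \<Rightarrow> complex ^ 'n \<Rightarrow> complex" where
  "Euler f z = (\<Sum>j\<in>UNIV. z $ j * d_z j f z)"

definition Euler_bar :: "(complex ^ 'n \<Rightarrow> complex) \<Rightarrow> complex ^ 'n \<Rightarrow> complex" where
  "Euler_bar f z = (\<Sum>j\<in>UNIV. cnj (z $ j) * d_zbar j f z)"

definition Delta :: "real \<Rightarrow> real \<Rightarrow> (complex ^ 'n \<Rightarrow> complex) \<Rightarrow> complex ^ 'n \<Rightarrow> complex" where
  "Delta \<nu> \<mu> f z =
     4 * (\<Sum>j\<in>UNIV. d_z j (d_zbar j f) z)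
     + 2 * \<i> * of_real \<nu> * (Euler f z + Euler_bar f z + of_nat CARD('n) * f z)
     + 2 * of_real \<mu> * (Euler f z - Euler_bar f z)
     - of_real ((\<nu>\<^sup>2 + \<mu>\<^sup>2) * (norm z)\<^sup>2) * f z"

definition A2 :: "real \<Rightarrow> real \<Rightarrow> nat \<Rightarrow> (complex ^ 'n \<Rightarrow> complex) set" where
  "A2 \<nu> \<mu> l = {F \<in> L2. C_infinity F \<and>
     (\<forall>z. Delta \<nu> \<mu> F z = - 2 * of_real \<mu> * (2 * of_nat l + of_nat CARD('n)) * F z)}"

definition hyp_1F1 :: "real \<Rightarrow> real \<Rightarrow> real \<Rightarrow> real" where
  "hyp_1F1 a c x = (\<Sum>k. pochhammer a k / pochhammer c k * x ^ k / fact k)"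

definition j_factor :: "real \<Rightarrow> real \<Rightarrow> complex ^ 'n \<Rightarrow> complex ^ 'n \<Rightarrow> complex" where
  "j_factor \<nu> \<mu> z w =
     exp (- (\<i> * of_real \<nu> / 2) * of_real ((norm z)\<^sup>2 - (norm w)\<^sup>2)
          + of_real (\<mu> / 2) * (hermitian z w - cnj (hermitian z w)))"

end

theory Submission
  imports Defs "HOL-Probability.Distributions"
begin

text \<open>The whole argument rests on one computation, \<open>Delta_radial\<close>. Translation from \<open>0\<close> to \<open>w\<close> followed by
multiplication with the phase \<open>z \<mapsto> j z w\<close>, where \<open>j\<close> is \<open>j_factor\<close>, carries the operator with \<open>\<nu> = 0\<close> to
the operator with parameter \<open>\<nu>\<close>, and on radial functions the rotation term \<open>E - E_bar\<close> vanishes. So on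
\<open>g (|z - w|^2) * j z w\<close>, as a function of \<open>z\<close> and for any centre \<open>w\<close>, the operator acts through an ordinary
differential operator on the profile: it replaces \<open>g\<close> by \<open>4 t g'' + 4 n g' - \<mu>^2 t g\<close>, where
\<open>t = |z - w|^2\<close>. This is used for two kinds of profiles.

The kernel of the theorem has the profile \<open>exp (- \<mu> t / 2) * 1F1 (- l; n; \<mu> t)\<close> up to a constant, and
Kummer's equation says that this profile is an eigenvector for \<open>- 2 \<mu> (2 l + n)\<close>. So the kernel is an
eigenfunction in \<open>z\<close> (\<open>Delta_landau_kernel\<close>).

The reproducing property \<open>F z = \<integral> K z w * F w\<close> for \<open>F\<close> in the eigenspace
(\<open>landau_kernel_reproducing\<close>) comes from the Gaussian profiles \<open>exp (- a t)\<close> with variable \<open>a\<close>. Let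
\<open>M k a\<close> be the integral over \<open>w\<close> of \<open>t^k * exp (- a t) * j z w * F w\<close>. The operator is symmetric, so
pairing the eigenvalue equation of \<open>F\<close> with the Gaussians (first with compactly supported
truncations, because nothing is known about the growth of the derivatives of \<open>F\<close>) yields a linear
relation between \<open>M 1 a\<close> and \<open>M 0 a\<close>. Since \<open>M 1\<close> is minus the derivative of \<open>M 0\<close>, this is a first order
equation, and \<open>M 0 a = C * (a - \<mu>/2)^l / (a + \<mu>/2)^(l + n)\<close> for \<open>a > \<mu>/2\<close>. As \<open>a\<close> grows the Gaussians
concentrate at \<open>z\<close>, which gives \<open>C = \<pi>^n * F z\<close> (\<open>gauss_moment_0_eq\<close>). The Taylor expansion of \<open>M 0\<close> at
\<open>\<mu>/2\<close> has the numbers \<open>M k (\<mu>/2)\<close> as its coefficients, up to signs and factorials; so they vanish for \<open>k < l\<close>, and \<open>M l (\<mu>/2)\<close> is an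
explicit multiple of \<open>F z\<close> (\<open>gauss_moment_critical\<close>). The profile of the kernel is
\<open>exp (- \<mu> t / 2)\<close> times a polynomial of degree \<open>l\<close>, hence only its leading coefficient contributes to
\<open>\<integral> K z w * F w\<close>, and the normalising constant turns the result into \<open>F z\<close>.

It remains to see that the integral operator with kernel \<open>K\<close> is the orthogonal projection. It maps
\<open>L2\<close> to smooth eigenfunctions by differentiation under the integral sign; for this the kernels of the
form polynomial times Gaussian times phase are treated together, because they are closed under
derivatives. It is bounded on \<open>L2\<close> because \<open>K\<close> is dominated by a convolution kernel
\<open>C * exp (- \<mu> |z - w|^2 / 4)\<close>. Finally \<open>K w z\<close> is the conjugate of \<open>K z w\<close>, so Fubini's theorem and the
reproducing property give \<open>\<langle>K f, g\<rangle> = \<langle>f, g\<rangle>\<close> for every \<open>g\<close> in the eigenspace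
(\<open>landau_projection_orthogonal\<close>). Two projections onto a space of continuous functions agree at every
point (\<open>orthogonal_projection_unique\<close>), and a kernel is determined almost everywhere by its operator
(\<open>schwartz_kernel_unique\<close>).\<close>

section \<open>Lebesgue measure and Gaussian integrals\<close>

lemma sigma_finite_lebesgue: "sigma_finite_measure (lebesgue :: 'a::euclidean_space measure)"
proof -
  obtain A :: "'a set set" where A: "countable A" "A \<subseteq> sets lborel" "\<Union>A = space lborel"
      "\<forall>a\<in>A. emeasure lborel a \<noteq> (\<infinity>::ennreal)"
    using sigma_finite_measure.sigma_finite_countable[OF sigma_finite_lborel] by metis
  show ?thesis
    by (rule sigma_finite_measure.intro, rule exI[of _ A]) (use A in \<open>auto simp: subset_iff\<close>)
qed

lemma continuous_imp_lebesgue_measurable: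
  fixes f :: "'a::euclidean_space \<Rightarrow> 'b::topological_space"
  assumes "continuous_on UNIV f" shows "f \<in> borel_measurable lebesgue"
  using borel_measurable_continuous_onI[OF assms] by (simp add: measurable_completion)

lemma integral_lebesgue_translation:
  fixes f :: "'a::euclidean_space \<Rightarrow> 'b::{banach, second_countable_topology}"
  assumes "f \<in> borel_measurable borel"
  shows "(\<integral>x. f (x + c) \<partial>lebesgue) = (\<integral>x. f x \<partial>lebesgue)"
proof -
  have "(\<integral>x. f (x + c) \<partial>lborel) = (\<integral>x. f x \<partial>distr lborel borel ((+) c))"
    by (subst integral_distr) (use assms in \<open>auto simp: add.commute\<close>)
  then show ?thesis
    using assms by (simp add: integral_completion lborel_distr_plus)
qed

lemma integrable_lebesgue_translation:
  fixes f :: "'a::euclidean_space \<Rightarrow> 'b::{banach, second_countable_topology}"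
  assumes "f \<in> borel_measurable borel" "integrable lebesgue f"
  shows "integrable lebesgue (\<lambda>x. f (x + c))"
proof -
  have "integrable lborel f" using assms by (simp add: integrable_completion)
  then have "integrable (distr lborel borel ((+) c)) f" by (simp add: lborel_distr_plus)
  then have "integrable lborel (\<lambda>x. f (c + x))"
    by (subst (asm) integrable_distr_eq) (use assms in auto)
  then show ?thesis
    using assms by (subst integrable_completion) (auto simp: add.commute)
qed

text \<open>The Gaussian is a product of one-dimensional Gaussians in the coordinates, so Tonelli's theorem
reduces the integral to the classical one.\<close>

lemma gaussian_has_integral:
  fixes z :: "'a::euclidean_space"
  assumes "a > 0"
  shows "has_bochner_integral lebesgue (\<lambda>x. exp (- a * (norm (x - z))\<^sup>2)) (sqrt (pi / a) ^ DIM('a))"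
proof -
  have one: "(\<integral>\<^sup>+x. ennreal (exp (- a * x\<^sup>2)) \<partial>lborel) = ennreal (sqrt (pi / a))"
  proof -
    have "has_bochner_integral lborel (\<lambda>x. exp (- x\<^sup>2)) (sqrt pi)"
      using gaussian_moment_0 has_bochner_integral_even_function[of "\<lambda>x. exp (- x\<^sup>2)" "sqrt pi / 2"]
      by simp
    then have "has_bochner_integral lborel (\<lambda>x. exp (- (0 + sqrt a * x)\<^sup>2)) (sqrt pi /\<^sub>R \<bar>sqrt a\<bar>)"
      using assms by (subst (asm) lborel_has_bochner_integral_real_affine_iff[of "sqrt a" _ _ 0]) auto
    then have "has_bochner_integral lborel (\<lambda>x. exp (- a * x\<^sup>2)) (sqrt (pi / a))"
      using assms by (simp add: power_mult_distrib real_sqrt_divide divide_inverse mult.commute real_sqrt_mult real_sqrt_inverse)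
    then show ?thesis
      by (subst nn_integral_eq_integral) (auto simp: has_bochner_integral_iff)
  qed
  have prod: "exp (- a * (norm x)\<^sup>2) = (\<Prod>b\<in>Basis. exp (- a * (x \<bullet> b)\<^sup>2))" for x :: 'a
  proof -
    have "(norm x)\<^sup>2 = (\<Sum>b\<in>Basis. (x \<bullet> b)\<^sup>2)"
      unfolding power2_norm_eq_inner by (subst euclidean_inner) (simp add: power2_eq_square)
    then show ?thesis
      by (simp add: exp_sum sum_distrib_left flip: sum_negf)
  qed
  have "(\<integral>\<^sup>+x. ennreal (exp (- a * (norm (x::'a))\<^sup>2)) \<partial>lborel) =
        (\<integral>\<^sup>+x. (\<Prod>b\<in>Basis. ennreal (exp (- a * ((x::'a) \<bullet> b)\<^sup>2))) \<partial>lborel)"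
    unfolding prod by (simp add: prod_ennreal)
  also have "\<dots> = (\<Prod>b\<in>(Basis::'a set). (\<integral>\<^sup>+x. ennreal (exp (- a * x\<^sup>2)) \<partial>lborel))"
    by (rule nn_integral_lborel_prod) auto
  also have "\<dots> = ennreal (sqrt (pi / a) ^ DIM('a))"
    unfolding one using assms by (simp add: ennreal_power)
  finally have *: "has_bochner_integral lborel (\<lambda>x::'a. exp (- a * (norm x)\<^sup>2)) (sqrt (pi / a) ^ DIM('a))"
    by (intro has_bochner_integral_nn_integral) (use assms in auto)
  then have "has_bochner_integral lebesgue (\<lambda>x::'a. exp (- a * (norm x)\<^sup>2)) (sqrt (pi / a) ^ DIM('a))"
    by (simp add: has_bochner_integral_iff integrable_completion integral_completion)
  then show ?thesis
    using integrable_lebesgue_translation[of "\<lambda>x::'a. exp (- a * (norm x)\<^sup>2)" "-z"]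
      integral_lebesgue_translation[of "\<lambda>x::'a. exp (- a * (norm x)\<^sup>2)" "-z"]
    by (simp add: has_bochner_integral_iff)
qed

section \<open>Square integrable functions\<close>

lemma L2_D: 
  assumes "f \<in> L2" 
  shows "f \<in> borel_measurable lebesgue" "integrable lebesgue (\<lambda>x. (norm (f x))\<^sup>2)"
  using assms by (auto simp: L2_def)

lemma L2_I: "f \<in> borel_measurable lebesgue \<Longrightarrow> integrable lebesgue (\<lambda>x. (norm (f x))\<^sup>2) \<Longrightarrow> f \<in> L2"
  by (auto simp: L2_def)

lemma L2_mult_integrable:
  fixes f g :: "'a::euclidean_space \<Rightarrow> complex"
  assumes "f \<in> L2" "g \<in> L2"
  shows "integrable lebesgue (\<lambda>x. f x * g x)"
proof (rule Bochner_Integration.integrable_bound)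
  show "integrable lebesgue (\<lambda>x. (norm (f x))\<^sup>2 + (norm (g x))\<^sup>2)"
    using assms by (auto simp: L2_def)
  show "(\<lambda>x. f x * g x) \<in> borel_measurable lebesgue"
    using assms by (auto simp: L2_def)
  have "norm (a * b) \<le> norm ((norm a)\<^sup>2 + (norm b)\<^sup>2)" for a b :: complex
  proof -
    have "norm a * norm b \<le> 2 * norm a * norm b" by simp
    also have "\<dots> \<le> (norm a)\<^sup>2 + (norm b)\<^sup>2"
      by (rule sum_squares_bound)
    finally show ?thesis by (simp add: norm_mult)
  qed
  then show "AE x in lebesgue. norm (f x * g x) \<le> norm ((norm (f x))\<^sup>2 + (norm (g x))\<^sup>2)"
    by blast
qed

lemma L2_mono:
  assumes "g \<in> L2" "f \<in> borel_measurable lebesgue" "\<And>x. norm (f x) \<le> norm (g x)"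
  shows "f \<in> L2"
proof (rule L2_I)
  show "integrable lebesgue (\<lambda>x. (norm (f x))\<^sup>2)"
    by (rule Bochner_Integration.integrable_bound[OF L2_D(2)[OF assms(1)]])
      (use assms in \<open>auto intro!: power_mono\<close>)
qed (use assms in auto)

lemma L2_diff:
  fixes f g :: "'a::euclidean_space \<Rightarrow> complex"
  assumes "f \<in> L2" "g \<in> L2"
  shows "(\<lambda>x. f x - g x) \<in> L2"
proof (rule L2_I)
  have "norm ((norm (a - b))\<^sup>2) \<le> norm (2 * (norm a)\<^sup>2 + 2 * (norm b)\<^sup>2)" for a b :: complex
  proof -
    have "(norm (a - b))\<^sup>2 \<le> (norm a + norm b)\<^sup>2"
      by (intro power_mono norm_triangle_ineq4) auto
    also have "\<dots> \<le> 2 * (norm a)\<^sup>2 + 2 * (norm b)\<^sup>2"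
      using sum_squares_bound[of "norm a" "norm b"] by (simp add: power2_sum)
    finally show ?thesis by simp
  qed
  then have bound: "AE x in lebesgue. norm ((norm (f x - g x))\<^sup>2) \<le> norm (2 * (norm (f x))\<^sup>2 + 2 * (norm (g x))\<^sup>2)"
    by blast
  show "integrable lebesgue (\<lambda>x. (norm (f x - g x))\<^sup>2)"
    by (rule Bochner_Integration.integrable_bound[OF _ _ bound])
      (use assms in \<open>auto simp: L2_def\<close>)
qed (use assms in \<open>auto simp: L2_def\<close>)

lemma L2_cnj: "f \<in> L2 \<Longrightarrow> (\<lambda>x. cnj (f x)) \<in> L2"
  by (rule L2_mono[of f]) (auto simp: L2_def intro!: measurable_compose[of f lebesgue borel cnj] borel_measurable_continuous_onI continuous_intros)

lemma gaussian_L2: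
  fixes z :: "'a::euclidean_space"
  assumes "a > 0"
  shows "(\<lambda>x. of_real (c * exp (- a * (norm (x - z))\<^sup>2))) \<in> L2"
proof (rule L2_I)
  show "(\<lambda>x. complex_of_real (c * exp (- a * (norm (x - z))\<^sup>2))) \<in> borel_measurable lebesgue"
    by (intro continuous_imp_lebesgue_measurable continuous_intros)
  have "(norm (complex_of_real (c * exp (- a * (norm (x - z))\<^sup>2))))\<^sup>2
      = c\<^sup>2 * exp (- (2 * a) * (norm (x - z))\<^sup>2)" for x
    by (simp add: norm_mult power_mult_distrib exp_double[symmetric] mult.assoc del: of_real_mult of_real_exp)
  then show "integrable lebesgue (\<lambda>x. (norm (complex_of_real (c * exp (- a * (norm (x - z))\<^sup>2))))\<^sup>2)"
    using gaussian_has_integral[of "2 * a" z] assms by (simp add: has_bochner_integral_iff)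
qed

lemma gaussian_mult_integrable:
  fixes f :: "'a::euclidean_space \<Rightarrow> complex"
  assumes "f \<in> L2" "a > 0"
  shows "integrable lebesgue (\<lambda>x. exp (- a * (norm (x - z))\<^sup>2) * norm (f x))"
  using integrable_norm[OF L2_mult_integrable[OF gaussian_L2[OF assms(2), of 1 z] assms(1)]]
  by (simp add: norm_mult)

section \<open>Differentiation under the integral sign\<close>

text \<open>A bound on the derivative, uniform for \<open>z\<close> near \<open>c\<close> and integrable in \<open>w\<close>, also bounds the difference
quotients by the mean value inequality, and dominated convergence applies.\<close>

lemma has_derivative_integral:
  fixes k :: "'a::euclidean_space \<Rightarrow> 'b \<Rightarrow> complex"
  assumes r: "r > 0"
    and k_int: "\<And>z. z \<in> ball c r \<Longrightarrow> integrable M (k z)"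
    and D_meas: "\<And>v. (\<lambda>w. D c w v) \<in> borel_measurable M"
    and deriv: "\<And>z w. z \<in> ball c r \<Longrightarrow> ((\<lambda>z. k z w) has_derivative D z w) (at z)"
    and bound: "\<And>z w v. z \<in> ball c r \<Longrightarrow> norm (D z w v) \<le> B w * norm v"
    and B_int: "integrable M B"
  shows "((\<lambda>z. \<integral>w. k z w \<partial>M) has_derivative (\<lambda>v. \<integral>w. D c w v \<partial>M)) (at c)"
proof -
  have c: "c \<in> ball c r" using r by simp
  have lin: "bounded_linear (D c w)" for w
    using deriv[OF c] by (rule has_derivative_bounded_linear)
  have D_int: "integrable M (\<lambda>w. D c w v)" for v
    by (rule Bochner_Integration.integrable_bound[of _ "\<lambda>w. B w * norm v"])
      (use B_int D_meas bound[OF c] in \<open>auto intro!: AE_I2 order_trans[OF bound[OF c]]\<close>)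
  have bl: "bounded_linear (\<lambda>v. \<integral>w. D c w v \<partial>M)"
  proof (rule bounded_linear_intro[where K = "\<integral>w. B w \<partial>M"])
    fix x y
    show "(\<integral>w. D c w (x + y) \<partial>M) = (\<integral>w. D c w x \<partial>M) + (\<integral>w. D c w y \<partial>M)"
      using D_int by (simp add: linear_add[OF bounded_linear.linear[OF lin]])
  next
    fix r x
    show "(\<integral>w. D c w (r *\<^sub>R x) \<partial>M) = r *\<^sub>R (\<integral>w. D c w x \<partial>M)"
      by (simp add: linear_scale[OF bounded_linear.linear[OF lin]] del: scaleR_conv_of_real)
  next
    fix x
    have "norm (\<integral>w. D c w x \<partial>M) \<le> (\<integral>w. B w * norm x \<partial>M)"
      by (intro order_trans[OF integral_norm_bound integral_mono]) (use D_int B_int bound[OF c] in auto)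
    then show "norm (\<integral>w. D c w x \<partial>M) \<le> norm x * (\<integral>w. B w \<partial>M)"
      by (simp add: mult.commute)
  qed
  let ?q = "\<lambda>z w. norm (k z w - k c w - D c w (z - c)) / norm (z - c)"
  have q_bound: "?q z w \<le> 2 * B w" if z: "z \<in> ball c r" "z \<noteq> c" for z w
  proof -
    have "norm (k z w - k c w) \<le> B w * norm (z - c)"
    proof (rule differentiable_bound[of "ball c r" "\<lambda>z. k z w" "\<lambda>z. D z w" "B w"])
      show "((\<lambda>z. k z w) has_derivative D x w) (at x within ball c r)" if "x \<in> ball c r" for x
        using deriv[OF that] by (rule has_derivative_at_withinI)
      show "onorm (D x w) \<le> B w" if "x \<in> ball c r" for x
        by (rule onorm_le) (rule bound[OF that])
    qed (use z c in auto)
    moreover have "norm (D c w (z - c)) \<le> B w * norm (z - c)"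
      by (rule bound[OF c])
    ultimately have "norm (k z w - k c w - D c w (z - c)) \<le> 2 * B w * norm (z - c)"
      by (intro order_trans[OF norm_triangle_ineq4]) simp
    then show ?thesis using z by (simp add: divide_le_eq)
  qed
  have q_int: "integrable M (?q z)" if "z \<in> ball c r" for z
    using k_int[OF that] k_int[OF c] D_int by auto
  have "((\<lambda>z. norm ((\<integral>w. k z w \<partial>M) - (\<integral>w. k c w \<partial>M) - (\<integral>w. D c w (z - c) \<partial>M)) / norm (z - c)) \<longlongrightarrow> 0) (at c)"
    unfolding tendsto_at_iff_sequentially comp_def
  proof (intro allI impI)
    fix X :: "nat \<Rightarrow> 'a" assume X: "\<forall>i. X i \<in> UNIV - {c}" "X \<longlonglongrightarrow> c"
    then have "\<forall>\<^sub>F i in sequentially. X i \<in> ball c r"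
      by (metis open_ball topological_tendstoD c)
    then obtain N where N: "\<And>i. X (i + N) \<in> ball c r"
      by (metis eventually_sequentially le_add2)
    have XN: "(\<lambda>i. X (i + N)) \<longlonglongrightarrow> c" using X(2) by (rule LIMSEQ_ignore_initial_segment)
    have "(\<lambda>i. \<integral>w. ?q (X (i + N)) w \<partial>M) \<longlonglongrightarrow> (\<integral>w. 0 \<partial>M)"
    proof (rule integral_dominated_convergence[where w = "\<lambda>w. 2 * B w"])
      show "AE w in M. (\<lambda>i. ?q (X (i + N)) w) \<longlonglongrightarrow> 0"
      proof (rule AE_I2)
        fix w
        have "((\<lambda>z. ?q z w) \<longlongrightarrow> 0) (at c)"
          using deriv[OF c, of w] by (simp add: has_derivative_iff_norm)
        then show "(\<lambda>i. ?q (X (i + N)) w) \<longlonglongrightarrow> 0"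
          unfolding tendsto_at_iff_sequentially comp_def using X XN by auto
      qed
      show "AE w in M. norm (?q (X (i + N)) w) \<le> 2 * B w" for i
      proof (rule AE_I2)
        fix w
        have "norm (?q (X (i + N)) w) = ?q (X (i + N)) w" by simp
        also have "\<dots> \<le> 2 * B w" by (rule q_bound) (use N[of i] X in auto)
        finally show "norm (?q (X (i + N)) w) \<le> 2 * B w" .
      qed
    qed (use q_int[OF N] B_int in auto)
    then have lim: "(\<lambda>i. \<integral>w. ?q (X (i + N)) w \<partial>M) \<longlonglongrightarrow> 0" by simp
    have "(\<lambda>i. norm ((\<integral>w. k (X (i + N)) w \<partial>M) - (\<integral>w. k c w \<partial>M) -
              (\<integral>w. D c w (X (i + N) - c) \<partial>M)) / norm (X (i + N) - c)) \<longlonglongrightarrow> 0"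
    proof (rule Lim_null_comparison[OF always_eventually lim], rule allI)
      fix i
      let ?z = "X (i + N)"
      have "norm ((\<integral>w. k ?z w \<partial>M) - (\<integral>w. k c w \<partial>M) - (\<integral>w. D c w (?z - c) \<partial>M))
          = norm (\<integral>w. k ?z w - k c w - D c w (?z - c) \<partial>M)"
        using k_int[OF N] k_int[OF c] D_int by simp
      also have "\<dots> \<le> (\<integral>w. norm (k ?z w - k c w - D c w (?z - c)) \<partial>M)"
        by (rule integral_norm_bound)
      finally show "norm (norm ((\<integral>w. k ?z w \<partial>M) - (\<integral>w. k c w \<partial>M) - (\<integral>w. D c w (?z - c) \<partial>M)) / norm (?z - c))
        \<le> (\<integral>w. ?q ?z w \<partial>M)"
        by (simp add: divide_right_mono)
    qed
    then show "(\<lambda>i. norm ((\<integral>w. k (X i) w \<partial>M) - (\<integral>w. k c w \<partial>M) -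
              (\<integral>w. D c w (X i - c) \<partial>M)) / norm (X i - c)) \<longlonglongrightarrow> 0"
      by (rule LIMSEQ_offset)
  qed
  then show "((\<lambda>z. \<integral>w. k z w \<partial>M) has_derivative (\<lambda>v. \<integral>w. D c w v \<partial>M)) (at c)"
    using bl by (simp add: has_derivative_iff_norm)
qed

section \<open>Functions of class $C^k$\<close>

lemma C_diff_SucI:
  assumes "\<And>x. (f has_derivative f' x) (at x)" "\<And>b. b \<in> Basis \<Longrightarrow> C_diff k (\<lambda>x. f' x b)"
  shows "C_diff (Suc k) f"
proof -
  have "frechet_derivative f (at x) = f' x" for x
    using frechet_derivative_at[OF assms(1)] by simp
  then show ?thesis
    using assms by (auto simp: differentiable_def)
qed

lemma C_diff_SucD:
  assumes "C_diff (Suc k) f"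
  shows "(f has_derivative frechet_derivative f (at x)) (at x)"
    and "b \<in> Basis \<Longrightarrow> C_diff k (\<lambda>x. frechet_derivative f (at x) b)"
  using assms by (auto simp: frechet_derivative_works)

lemma C_diff_Suc_imp: "C_diff (Suc k) f \<Longrightarrow> C_diff k f"
proof (induction k arbitrary: f)
  case 0
  then show ?case
    by (auto intro!: continuous_at_imp_continuous_on differentiable_imp_continuous_within)
next
  case (Suc k)
  show ?case
    by (rule C_diff_SucI[OF C_diff_SucD(1)[OF Suc.prems]])
      (rule Suc.IH[OF C_diff_SucD(2)[OF Suc.prems]])
qed

lemma C_diff_const: "C_diff k (\<lambda>_. c)"
proof (induction k arbitrary: c)
  case (Suc k)
  show ?case by (rule C_diff_SucI[OF has_derivative_const]) (rule Suc.IH)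
qed simp

lemma C_diff_add: "C_diff k f \<Longrightarrow> C_diff k g \<Longrightarrow> C_diff k (\<lambda>x. f x + g x)"
proof (induction k arbitrary: f g)
  case (Suc k)
  show ?case
    by (rule C_diff_SucI[OF has_derivative_add[OF C_diff_SucD(1)[OF Suc.prems(1)] C_diff_SucD(1)[OF Suc.prems(2)]]])
      (intro Suc.IH C_diff_SucD(2) Suc.prems)
qed (auto intro: continuous_intros)

lemma C_diff_mult: "C_diff k f \<Longrightarrow> C_diff k g \<Longrightarrow> C_diff k (\<lambda>x. f x * g x)"
proof (induction k arbitrary: f g)
  case (Suc k)
  show ?case
    by (rule C_diff_SucI[OF has_derivative_mult[OF C_diff_SucD(1)[OF Suc.prems(1)] C_diff_SucD(1)[OF Suc.prems(2)]]])
      (intro C_diff_add Suc.IH C_diff_SucD(2) C_diff_Suc_imp[of k f] C_diff_Suc_imp[of k g] Suc.prems)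
qed (auto intro: continuous_intros)

lemma C_diff_bounded_linear: "bounded_linear f \<Longrightarrow> C_diff k f"
  by (cases k) (auto intro!: C_diff_SucI[OF bounded_linear_imp_has_derivative] C_diff_const
    linear_continuous_on simp del: C_diff.simps(2))

lemma C_diff_compose_bounded_linear:
  assumes "bounded_linear h" shows "C_diff k f \<Longrightarrow> C_diff k (\<lambda>x. h (f x))"
proof (induction k arbitrary: f)
  case 0
  then show ?case using bounded_linear.continuous_on[OF assms] by simp
next
  case (Suc k)
  show ?case
    by (rule C_diff_SucI[OF bounded_linear.has_derivative[OF assms C_diff_SucD(1)[OF Suc.prems]]])
      (intro Suc.IH C_diff_SucD(2) Suc.prems)
qed

lemma C_diff_sum: "finite I \<Longrightarrow> (\<And>i. i \<in> I \<Longrightarrow> C_diff k (f i)) \<Longrightarrow> C_diff k (\<lambda>x. \<Sum>i\<in>I. f i x)"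
  by (induction I rule: finite_induct) (auto intro: C_diff_const C_diff_add)

lemma exp_has_derivative:
  fixes f :: "'a::real_normed_vector \<Rightarrow> complex"
  assumes "(f has_derivative f') (at x)"
  shows "((\<lambda>x. exp (f x)) has_derivative (\<lambda>v. f' v * exp (f x))) (at x)"
proof -
  have e: "(exp has_derivative (\<lambda>y. exp (f x) * y)) (at (f x))"
    using DERIV_exp[of "f x"] unfolding has_field_derivative_def .
  have "((\<lambda>x. exp (f x)) has_derivative (\<lambda>v. exp (f x) * f' v)) (at x)"
    using has_derivative_compose[OF assms e] .
  then show ?thesis by (simp only: mult.commute)
qed

lemma C_diff_exp: "C_diff k f \<Longrightarrow> C_diff k (\<lambda>x. exp (f x))"
proof (induction k arbitrary: f)
  case 0
  then show ?case by (auto intro: continuous_intros)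
next
  case (Suc k)
  have "((\<lambda>x. exp (f x)) has_derivative (\<lambda>v. frechet_derivative f (at x) v * exp (f x))) (at x)" for x
    by (rule exp_has_derivative) (rule C_diff_SucD(1)[OF Suc.prems])
  then show ?case
    by (rule C_diff_SucI)
      (intro C_diff_mult Suc.IH C_diff_SucD(2) C_diff_Suc_imp[of k f] Suc.prems)
qed

lemma norm_diff_sq_has_derivative:
  "((\<lambda>z. (norm (z - w))\<^sup>2) has_derivative (\<lambda>v. 2 * ((z - w) \<bullet> v))) (at z)"
  unfolding power2_norm_eq_inner
  by (auto intro!: derivative_eq_intros simp: inner_commute)

lemma radial_has_derivative:
  fixes z w :: "'a::euclidean_space" and g :: "real \<Rightarrow> real"
  assumes "(g has_real_derivative d) (at ((norm (z - w))\<^sup>2))"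
  shows "((\<lambda>z. complex_of_real (g ((norm (z - w))\<^sup>2))) has_derivative
     (\<lambda>v. of_real d * of_real (2 * ((z - w) \<bullet> v)))) (at z)"
proof -
  have "((\<lambda>z. g ((norm (z - w))\<^sup>2)) has_derivative (\<lambda>v. d * (2 * ((z - w) \<bullet> v)))) (at z)"
    using has_derivative_compose[OF norm_diff_sq_has_derivative assms[unfolded has_field_derivative_def]] .
  from has_derivative_of_real[OF this] show ?thesis by simp
qed

text \<open>The list \<open>g 0, g 1, \<dots>, g k\<close> consists of a profile and its successive derivatives; quantifying over the
list makes the induction on \<open>k\<close> a shift of the index.\<close>

lemma C_diff_radial:
  fixes w :: "'a::euclidean_space" and g :: "nat \<Rightarrow> real \<Rightarrow> real"
  assumes "\<And>i t. i < k \<Longrightarrow> (g i has_real_derivative g (Suc i) t) (at t)" "continuous_on UNIV (g k)"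
  shows "C_diff k (\<lambda>z. complex_of_real (g 0 ((norm (z - w))\<^sup>2)))"
  using assms
proof (induction k arbitrary: g)
  case 0
  have "continuous_on UNIV (\<lambda>z. g 0 ((norm (z - w))\<^sup>2))"
    by (rule continuous_on_compose2[OF 0(2)]) (auto intro!: continuous_intros)
  then show ?case by (auto intro!: continuous_intros)
next
  case (Suc k)
  have lin: "C_diff k (\<lambda>z. complex_of_real (2 * ((z - w) \<bullet> b)))" for b
  proof -
    have "bounded_linear (\<lambda>z. complex_of_real (2 * (z \<bullet> b)))"
      by (intro bounded_linear_compose[OF bounded_linear_of_real]
          bounded_linear_const_mult bounded_linear_inner_left)
    then have "C_diff k (\<lambda>z. complex_of_real (2 * (z \<bullet> b)))"
      by (rule C_diff_bounded_linear)
    from C_diff_add[OF this C_diff_const[of k "- complex_of_real (2 * (w \<bullet> b))"]] show ?thesis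
      by (simp add: inner_diff_left algebra_simps)
  qed
  show ?case
  proof (rule C_diff_SucI[OF radial_has_derivative[OF Suc.prems(1)[of 0]]])
    fix b :: 'a
    show "C_diff k (\<lambda>x. of_real (g (Suc 0) ((norm (x - w))\<^sup>2)) * of_real (2 * ((x - w) \<bullet> b)))"
      by (intro C_diff_mult lin Suc.IH[of "\<lambda>i. g (Suc i)"] Suc.prems) simp_all
  qed simp
qed

section \<open>Wirtinger derivatives\<close>

text \<open>\<open>p\<close> and \<open>q\<close> are the values at \<open>z\<close> of the derivatives of \<open>f\<close> with respect to \<open>z j\<close> and to its conjugate. As a
predicate, like \<open>has_derivative\<close>, it carries differentiability along, so that the rules below compose
by resolution.\<close>

definition has_wirtinger :: "'n \<Rightarrow> (complex ^ 'n \<Rightarrow> complex) \<Rightarrow> complex \<Rightarrow> complex \<Rightarrow> complex ^ 'n \<Rightarrow> bool" where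
  "has_wirtinger j f p q z \<longleftrightarrow> (\<exists>D. (f has_derivative D) (at z) \<and>
     p = (D (axis j 1) - \<i> * D (axis j \<i>)) / 2 \<and> q = (D (axis j 1) + \<i> * D (axis j \<i>)) / 2)"

lemma has_wirtingerD:
  assumes "has_wirtinger j f p q z"
  shows "d_z j f z = p" "d_zbar j f z = q"
  using assms frechet_derivative_at unfolding has_wirtinger_def d_z_def d_zbar_def by metis+

lemma has_wirtinger_differentiable:
  "f differentiable at z \<Longrightarrow> has_wirtinger j f (d_z j f z) (d_zbar j f z) z"
  unfolding has_wirtinger_def d_z_def d_zbar_def frechet_derivative_works by blast

lemma has_wirtinger_const: "has_wirtinger j (\<lambda>_. c) 0 0 z"
  unfolding has_wirtinger_def by (rule exI[of _ "\<lambda>_. 0"]) auto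

lemma has_wirtinger_add:
  "has_wirtinger j f p q z \<Longrightarrow> has_wirtinger j g p' q' z \<Longrightarrow>
   has_wirtinger j (\<lambda>z. f z + g z) (p + p') (q + q') z"
  unfolding has_wirtinger_def
  by (elim exE, rule exI, intro conjI, rule has_derivative_add) (auto simp: field_simps)

lemma has_wirtinger_mult:
  "has_wirtinger j f p q z \<Longrightarrow> has_wirtinger j g p' q' z \<Longrightarrow>
   has_wirtinger j (\<lambda>z. f z * g z) (p * g z + f z * p') (q * g z + f z * q') z"
  unfolding has_wirtinger_def
  by (clarify, rule exI, intro conjI, rule has_derivative_mult) (auto simp: field_simps)

lemma has_wirtinger_cnj:
  "has_wirtinger j f p q z \<Longrightarrow> has_wirtinger j (\<lambda>z. cnj (f z)) (cnj q) (cnj p) z"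
  unfolding has_wirtinger_def
  by (clarify, rule exI, intro conjI, rule has_derivative_cnj) auto

lemma has_wirtinger_exp:
  assumes "has_wirtinger j f p q z" 
  shows "has_wirtinger j (\<lambda>z. exp (f z)) (p * exp (f z)) (q * exp (f z)) z"
proof -
  obtain D where D: "(f has_derivative D) (at z)"
    "p = (D (axis j 1) - \<i> * D (axis j \<i>)) / 2" "q = (D (axis j 1) + \<i> * D (axis j \<i>)) / 2"
    using assms unfolding has_wirtinger_def by blast
  show ?thesis unfolding has_wirtinger_def
    by (rule exI, intro conjI, rule exp_has_derivative[OF D(1)]) (auto simp: D field_simps)
qed

lemma has_wirtinger_coord:
  "has_wirtinger j (\<lambda>z. z $ k) (if j = k then 1 else 0) 0 z"
  unfolding has_wirtinger_def
  by (rule exI[of _ "\<lambda>v. v $ k"])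
    (auto simp: axis_def intro!: bounded_linear_imp_has_derivative bounded_linear_vec_nth)

lemma has_wirtinger_radial:
  fixes z w :: "complex ^ 'n"
  assumes "(g has_real_derivative d) (at ((norm (z - w))\<^sup>2))"
  shows "has_wirtinger j (\<lambda>z. complex_of_real (g ((norm (z - w))\<^sup>2)))
     (of_real d * cnj ((z - w) $ j)) (of_real d * (z - w) $ j) z"
  unfolding has_wirtinger_def
  by (rule exI, intro conjI, rule radial_has_derivative[OF assms])
    (auto simp: inner_axis complex_eq_iff algebra_simps)

section \<open>Integration by parts\<close>

lemma compact_support_integrable:
  fixes f :: "'a::euclidean_space \<Rightarrow> complex"
  assumes "continuous_on UNIV f" "\<And>x. norm x > R \<Longrightarrow> f x = 0"
  shows "integrable lebesgue f"
proof -
  have "integrable lborel (\<lambda>x. indicator (cball 0 R) x *\<^sub>R f x)"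
    by (rule borel_integrable_compact) (use continuous_on_subset[OF assms(1)] in auto)
  moreover have "indicator (cball 0 R) x *\<^sub>R f x = f x" for x
    using assms(2)[of x] by (auto simp: indicator_def dist_norm)
  ultimately show ?thesis
    using borel_measurable_continuous_onI[OF assms(1)] by (simp add: integrable_completion)
qed

lemma compact_support_mult_integrable:
  fixes u f :: "'a::euclidean_space \<Rightarrow> complex"
  assumes "continuous_on UNIV u" "continuous_on UNIV f" "\<And>x. norm x > R \<Longrightarrow> u x = 0"
  shows "integrable lebesgue (\<lambda>x. u x * f x)"
  by (rule compact_support_integrable[of _ R]) (use assms in \<open>auto intro: continuous_intros\<close>)

lemma frechet_derivative_outside_support:
  fixes f :: "'a::euclidean_space \<Rightarrow> complex"
  assumes "\<And>x. norm x > R \<Longrightarrow> f x = 0" "norm x > R"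
  shows "frechet_derivative f (at x) b = 0"
proof -
  have "((\<lambda>_. 0) has_derivative (\<lambda>_. 0 :: complex)) (at x)" by simp
  then have "(f has_derivative (\<lambda>_. 0)) (at x)"
    by (rule has_derivative_transform_within_open[of _ _ _ _ "- cball 0 R"])
      (use assms in \<open>auto simp: dist_norm\<close>)
  from frechet_derivative_at[OF this] show ?thesis by metis
qed

text \<open>By translation invariance the integral of \<open>f (x + s b)\<close> over \<open>x\<close> is constant in \<open>s\<close>. Its derivative at
\<open>s = 0\<close> is the integral of the partial derivative.\<close>

lemma integral_partial_derivative_zero:
  fixes f :: "'a::euclidean_space \<Rightarrow> complex"
  assumes C1: "C_diff (Suc 0) f" and supp: "\<And>x. norm x > R \<Longrightarrow> f x = 0" and b: "b \<in> Basis"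
  shows "(\<integral>x. frechet_derivative f (at x) b \<partial>lebesgue) = 0"
proof -
  define d where "d x = frechet_derivative f (at x) b" for x
  have cont_d: "continuous_on UNIV d" and cont_f: "continuous_on UNIV f"
    using C_diff_SucD(2)[OF C1 b] C_diff_Suc_imp[OF C1] by (auto simp: d_def[abs_def])
  have d0: "d x = 0" if "norm x > R" for x
    unfolding d_def by (rule frechet_derivative_outside_support[OF supp that])
  have "bounded (d ` cball 0 R)"
    by (intro compact_imp_bounded compact_continuous_image continuous_on_subset[OF cont_d]) auto
  then obtain B where B: "B > 0" "\<And>x. norm x \<le> R \<Longrightarrow> norm (d x) \<le> B"
    unfolding bounded_pos by (auto simp: dist_norm)
  define B' where "B' x = B * indicator (cball 0 (R + 1)) x" for x :: 'a
  have d_bound: "norm (d (x + s *\<^sub>R b)) \<le> B' x" if "\<bar>s\<bar> < 1" for x s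
  proof (cases "norm (x + s *\<^sub>R b) > R")
    case True
    then show ?thesis using d0[OF True] B by (simp add: B'_def)
  next
    case False
    then have "norm x - norm (s *\<^sub>R b) \<le> R" using norm_diff_ineq[of x "s *\<^sub>R b"] by linarith
    then have "norm x \<le> R + 1" using that b by (simp add: norm_Basis)
    then show ?thesis using B False by (auto simp: B'_def dist_norm indicator_def)
  qed
  have transl: "(\<lambda>x. f (x + s *\<^sub>R b)) \<in> borel_measurable borel" for s
    by (intro borel_measurable_continuous_onI continuous_on_compose2[OF cont_f] continuous_intros) auto
  have f_int: "integrable lebesgue f"
    by (rule compact_support_integrable[OF cont_f supp])
  have d_int: "integrable lebesgue d"
    by (rule compact_support_integrable[OF cont_d d0])
  have fder: "(f has_derivative frechet_derivative f (at x)) (at x)" for x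
    by (rule C_diff_SucD[OF C1])
  \<comment> \<open>Shifts of length less than 1 enlarge the support by at most 1, hence the radius in \<open>B'\<close>.\<close>
  have "((\<lambda>s. \<integral>x. f (x + s *\<^sub>R b) \<partial>lebesgue) has_derivative
      (\<lambda>v. \<integral>x. v *\<^sub>R d (x + 0 *\<^sub>R b) \<partial>lebesgue)) (at 0)"
  proof (rule has_derivative_integral[where r = 1 and B = B' and M = lebesgue and c = "0::real"
        and k = "\<lambda>s x. f (x + s *\<^sub>R b)" and D = "\<lambda>s x v. v *\<^sub>R d (x + s *\<^sub>R b)"])
    show "integrable lebesgue (\<lambda>x. f (x + s *\<^sub>R b))" for s
      by (rule integrable_lebesgue_translation[OF _ f_int]) (use transl[of 0] in simp)
    show "(\<lambda>x. v *\<^sub>R d (x + 0 *\<^sub>R b)) \<in> borel_measurable lebesgue" for v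
      using d_int by simp
    show "((\<lambda>s. f (x + s *\<^sub>R b)) has_derivative (\<lambda>v. v *\<^sub>R d (x + s *\<^sub>R b))) (at s)" for s x
    proof -
      have "((\<lambda>s. x + s *\<^sub>R b) has_derivative (\<lambda>v. v *\<^sub>R b)) (at s)"
        by (auto intro!: derivative_eq_intros)
      from has_derivative_compose[OF this fder]
      show ?thesis
        using linear_scale[OF has_derivative_linear[OF fder]] by (simp add: d_def scaleR_conv_of_real)
    qed
    show "norm (v *\<^sub>R d (x + s *\<^sub>R b)) \<le> B' x * norm v" if "s \<in> ball 0 1" for s x v
      using mult_right_mono[OF d_bound[of s x] norm_ge_zero[of v]] that
      by (simp add: dist_norm mult.commute)
    have "integrable lborel (\<lambda>x. indicator (cball 0 (R + 1)) x *\<^sub>R B)"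
      by (rule borel_integrable_compact) auto
    then show "integrable lebesgue B'"
      unfolding B'_def by (subst integrable_completion) (auto simp: mult.commute)
  qed simp
  moreover have "(\<lambda>s. \<integral>x. f (x + s *\<^sub>R b) \<partial>lebesgue) = (\<lambda>_. \<integral>x. f x \<partial>lebesgue)"
    using transl[of 0] by (simp add: integral_lebesgue_translation)
  ultimately have "((\<lambda>_::real. \<integral>x. f x \<partial>lebesgue) has_derivative
      (\<lambda>v. \<integral>x. v *\<^sub>R d x \<partial>lebesgue)) (at 0)" by simp
  from has_derivative_unique[OF this has_derivative_const]
  have "(\<integral>x. 1 *\<^sub>R d x \<partial>lebesgue) = 0" by metis
  then show ?thesis by (simp add: d_def)
qed

lemma C_diff_cmult: "C_diff k f \<Longrightarrow> C_diff k (\<lambda>x. c * f x)"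
  by (intro C_diff_mult C_diff_const)

lemma axis_complex_in_Basis: "axis j (1::complex) \<in> Basis" "axis j \<i> \<in> Basis"
  by (auto simp: axis_in_Basis_iff Basis_complex_def)

lemma C_diff_wirtinger:
  assumes "C_diff (Suc k) f"
  shows "C_diff k (d_z j f)" "C_diff k (d_zbar j f)"
proof -
  note b = axis_complex_in_Basis
  have *: "C_diff k (\<lambda>z. 1/2 * frechet_derivative f (at z) (axis j 1) + c * frechet_derivative f (at z) (axis j \<i>))" for c
    by (intro C_diff_add C_diff_cmult C_diff_SucD(2)[OF assms] b)
  show "C_diff k (d_z j f)" "C_diff k (d_zbar j f)"
    using *[of "- \<i> / 2"] *[of "\<i> / 2"] unfolding d_z_def[abs_def] d_zbar_def[abs_def]
    by (simp_all add: field_simps)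
qed

lemma integral_wirtinger_zero:
  assumes C1: "C_diff (Suc 0) f" and supp: "\<And>x. norm x > R \<Longrightarrow> f x = 0"
  shows "(\<integral>x. d_z j f x \<partial>lebesgue) = 0" "(\<integral>x. d_zbar j f x \<partial>lebesgue) = 0"
proof -
  note b = axis_complex_in_Basis
  have int: "integrable lebesgue (\<lambda>x. frechet_derivative f (at x) b)" if "b \<in> Basis" for b
    by (rule compact_support_integrable[of _ R])
      (use C_diff_SucD(2)[OF C1 that] frechet_derivative_outside_support[OF supp] in auto)
  show "(\<integral>x. d_z j f x \<partial>lebesgue) = 0" "(\<integral>x. d_zbar j f x \<partial>lebesgue) = 0"
    unfolding d_z_def d_zbar_def
    using int[OF b(1)] int[OF b(2)] integral_partial_derivative_zero[OF C1 supp b(1)]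
      integral_partial_derivative_zero[OF C1 supp b(2)] by simp_all
qed

lemma has_wirtinger_C_diff:
  "C_diff (Suc k) f \<Longrightarrow> has_wirtinger j f (d_z j f z) (d_zbar j f z) z"
  by (rule has_wirtinger_differentiable) simp

lemma wirtinger_outside_support:
  assumes "\<And>x. norm x > R \<Longrightarrow> f x = 0" "norm x > R"
  shows "d_z j f x = 0" "d_zbar j f x = 0"
  using frechet_derivative_outside_support[of R f x] assms by (auto simp: d_z_def d_zbar_def)

lemma wirtinger_integration_by_parts:
  assumes u: "C_diff (Suc 0) u" and f: "C_diff (Suc 0) f" and supp: "\<And>x. norm x > R \<Longrightarrow> u x = 0"
  shows "(\<integral>x. u x * d_z j f x \<partial>lebesgue) = - (\<integral>x. d_z j u x * f x \<partial>lebesgue)"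
    and "(\<integral>x. u x * d_zbar j f x \<partial>lebesgue) = - (\<integral>x. d_zbar j u x * f x \<partial>lebesgue)"
proof -
  note w = has_wirtinger_mult[OF has_wirtinger_C_diff[OF u] has_wirtinger_C_diff[OF f]]
  have uf: "C_diff (Suc 0) (\<lambda>x. u x * f x)" by (rule C_diff_mult[OF u f])
  have cont: "continuous_on UNIV u" "continuous_on UNIV f"
    "continuous_on UNIV (d_z j u)" "continuous_on UNIV (d_zbar j u)"
    "continuous_on UNIV (d_z j f)" "continuous_on UNIV (d_zbar j f)"
    using C_diff_wirtinger[OF u, of j] C_diff_wirtinger[OF f, of j]
      C_diff_Suc_imp[OF u] C_diff_Suc_imp[OF f] by auto
  have int: "integrable lebesgue (\<lambda>x. u x * d_z j f x)" "integrable lebesgue (\<lambda>x. u x * d_zbar j f x)"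
    "integrable lebesgue (\<lambda>x. d_z j u x * f x)" "integrable lebesgue (\<lambda>x. d_zbar j u x * f x)"
    by (intro compact_support_mult_integrable[of _ _ R] cont supp wirtinger_outside_support[OF supp]; assumption)+
  have "(\<integral>x. d_z j u x * f x + u x * d_z j f x \<partial>lebesgue) = 0"
    "(\<integral>x. d_zbar j u x * f x + u x * d_zbar j f x \<partial>lebesgue) = 0"
    using integral_wirtinger_zero[OF uf, of R j] supp by (simp_all add: has_wirtingerD[OF w])
  then show "(\<integral>x. u x * d_z j f x \<partial>lebesgue) = - (\<integral>x. d_z j u x * f x \<partial>lebesgue)"
    "(\<integral>x. u x * d_zbar j f x \<partial>lebesgue) = - (\<integral>x. d_zbar j u x * f x \<partial>lebesgue)"
    using int by (simp_all add: eq_neg_iff_add_eq_0 add.commute)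
qed

section \<open>Symmetry of the operator\<close>

text \<open>The operator is a sum over the coordinates of commuting one-dimensional operators of the same kind;
both its symmetry and its action on radial functions can be checked coordinate by coordinate.\<close>

definition Delta_coord :: "real \<Rightarrow> real \<Rightarrow> 'n \<Rightarrow> (complex ^ 'n \<Rightarrow> complex) \<Rightarrow> complex ^ 'n \<Rightarrow> complex" where
  "Delta_coord \<nu> \<mu> j f z =
     4 * d_z j (d_zbar j f) z
     + 2 * \<i> * of_real \<nu> * (z $ j * d_z j f z + cnj (z $ j) * d_zbar j f z + f z)
     + 2 * of_real \<mu> * (z $ j * d_z j f z - cnj (z $ j) * d_zbar j f z)
     - of_real (\<nu>\<^sup>2 + \<mu>\<^sup>2) * (z $ j * cnj (z $ j)) * f z"

lemma norm_sq_eq_sum: "complex_of_real ((norm z)\<^sup>2) = (\<Sum>j\<in>UNIV. z $ j * cnj (z $ j))"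
  for z :: "complex ^ 'n"
proof -
  have "(norm z)\<^sup>2 = (\<Sum>j\<in>UNIV. (norm (z $ j))\<^sup>2)"
    unfolding norm_vec_def L2_set_def by (simp add: sum_nonneg)
  then show ?thesis by (simp add: complex_norm_square del: of_real_power)
qed

lemma Delta_eq_sum: "Delta \<nu> \<mu> f z = (\<Sum>j\<in>UNIV. Delta_coord \<nu> \<mu> j f z)"
  for f :: "complex ^ 'n \<Rightarrow> complex"
proof -
  have "Delta \<nu> \<mu> f z =
     4 * (\<Sum>j\<in>UNIV. d_z j (d_zbar j f) z)
     + 2 * \<i> * of_real \<nu> * ((\<Sum>j\<in>UNIV. z $ j * d_z j f z) + (\<Sum>j\<in>UNIV. cnj (z $ j) * d_zbar j f z)
         + (\<Sum>j\<in>(UNIV::'n set). f z))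
     + 2 * of_real \<mu> * ((\<Sum>j\<in>UNIV. z $ j * d_z j f z) - (\<Sum>j\<in>UNIV. cnj (z $ j) * d_zbar j f z))
     - of_real (\<nu>\<^sup>2 + \<mu>\<^sup>2) * (\<Sum>j\<in>UNIV. z $ j * cnj (z $ j)) * f z"
    unfolding Delta_def Euler_def Euler_bar_def by (simp add: norm_sq_eq_sum[symmetric] del: of_real_power)
  also have "\<dots> = (\<Sum>j\<in>UNIV. Delta_coord \<nu> \<mu> j f z)"
    unfolding Delta_coord_def sum.distrib sum_subtractf
    by (simp only: sum_distrib_left sum_distrib_right sum.distrib sum_subtractf distrib_left right_diff_distrib mult.assoc)
  finally show ?thesis .
qed

lemma C_diff_coord: "C_diff k (\<lambda>z::complex^'n. z $ j)" "C_diff k (\<lambda>z::complex^'n. cnj (z $ j))"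
  by (auto intro!: C_diff_bounded_linear bounded_linear_vec_nth
      bounded_linear_compose[OF bounded_linear_cnj])

lemma has_wirtinger_cnj_coord:
  "has_wirtinger j (\<lambda>z. cnj (z $ k)) 0 (if j = k then 1 else 0) z"
  using has_wirtinger_cnj[OF has_wirtinger_coord[of j k z]] by (simp split: if_splits)

lemma Delta_coord_continuous:
  assumes "C_diff (Suc (Suc 0)) f"
  shows "continuous_on UNIV (Delta_coord \<nu> \<mu> j f)"
proof -
  have "C_diff 0 (d_z j (d_zbar j f))" "C_diff 0 (d_z j f)" "C_diff 0 (d_zbar j f)" "C_diff 0 f"
    using assms by (blast intro: C_diff_wirtinger C_diff_Suc_imp)+
  then show ?thesis
    unfolding Delta_coord_def[abs_def] by (auto intro!: continuous_intros)
qed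

lemma Delta_coord_outside_support:
  assumes "\<And>x. norm x > R \<Longrightarrow> f x = 0" "norm x > R"
  shows "Delta_coord \<nu> \<mu> j f x = 0"
  using wirtinger_outside_support[of R f] wirtinger_outside_support[of R "d_zbar j f" x j] assms
  by (auto simp: Delta_coord_def)

text \<open>Two integrations by parts move the second order term. A first order term \<open>z \<partial>\<close> becomes \<open>- z \<partial> - 1\<close>; the
constants cancel in the part with \<open>\<mu>\<close>, and in the part with \<open>\<nu>\<close> the summand \<open>f z\<close> of \<open>Delta_coord\<close>
compensates them.\<close>

lemma Delta_coord_symmetric:
  fixes \<Psi> F :: "complex ^ 'n \<Rightarrow> complex"
  assumes \<Psi>: "C_diff (Suc (Suc 0)) \<Psi>" and F: "C_diff (Suc (Suc 0)) F"
    and supp: "\<And>x. norm x > R \<Longrightarrow> \<Psi> x = 0"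
  shows "(\<integral>x. cnj (\<Psi> x) * Delta_coord \<nu> \<mu> j F x \<partial>lebesgue) =
    (\<integral>x. cnj (Delta_coord \<nu> \<mu> j \<Psi> x) * F x \<partial>lebesgue)"
proof -
  define u where "u x = cnj (\<Psi> x)" for x
  note S = C_diff_Suc_imp
  have C_cnj: "C_diff k (\<lambda>x. cnj (f x))" if "C_diff k f" for k and f :: "complex ^ 'n \<Rightarrow> complex"
    by (rule C_diff_compose_bounded_linear[OF bounded_linear_cnj that])
  have u: "C_diff (Suc (Suc 0)) u" unfolding u_def by (rule C_cnj[OF \<Psi>])
  have usupp: "norm x > R \<Longrightarrow> u x = 0" for x by (simp add: u_def supp)
  have supps: "norm x > R \<Longrightarrow> d_z j \<Psi> x = 0" "norm x > R \<Longrightarrow> d_zbar j \<Psi> x = 0"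
    "norm x > R \<Longrightarrow> d_z j (d_zbar j \<Psi>) x = 0" for x
    using wirtinger_outside_support[of R \<Psi>] wirtinger_outside_support[of R "d_zbar j \<Psi>" x j] supp by auto
  have du: "d_z j u x = cnj (d_zbar j \<Psi> x)" "d_zbar j u x = cnj (d_z j \<Psi> x)" for x
    using has_wirtingerD[OF has_wirtinger_cnj[OF has_wirtinger_C_diff[OF \<Psi>]]] by (auto simp: u_def[abs_def])
  have dF: "C_diff (Suc 0) (d_z j F)" "C_diff (Suc 0) (d_zbar j F)"
    using C_diff_wirtinger[OF F] by auto
  have d\<Psi>: "C_diff (Suc 0) (d_z j \<Psi>)" "C_diff (Suc 0) (d_zbar j \<Psi>)"
    using C_diff_wirtinger[OF \<Psi>] by auto
  have ddu: "d_zbar j (\<lambda>x. cnj (d_zbar j \<Psi> x)) x = cnj (d_z j (d_zbar j \<Psi>) x)" for x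
    using has_wirtingerD[OF has_wirtinger_cnj[OF has_wirtinger_C_diff[OF d\<Psi>(2)]]] by auto
  have "(\<integral>x. u x * d_z j (d_zbar j F) x \<partial>lebesgue) = - (\<integral>x. cnj (d_zbar j \<Psi> x) * d_zbar j F x \<partial>lebesgue)"
    using wirtinger_integration_by_parts(1)[where j = j, OF S[OF u] dF(2) usupp] by (simp add: du)
  also have "(\<integral>x. cnj (d_zbar j \<Psi> x) * d_zbar j F x \<partial>lebesgue)
      = - (\<integral>x. cnj (d_z j (d_zbar j \<Psi>) x) * F x \<partial>lebesgue)"
    using wirtinger_integration_by_parts(2)[OF C_cnj[OF d\<Psi>(2)] S[OF F], of R j]
    by (simp add: ddu supps)
  finally have A: "(\<integral>x. u x * d_z j (d_zbar j F) x \<partial>lebesgue)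
      = (\<integral>x. cnj (d_z j (d_zbar j \<Psi>) x) * F x \<partial>lebesgue)" by simp
  have uz: "has_wirtinger j (\<lambda>x. u x * x $ j) (cnj (d_zbar j \<Psi> x) * x $ j + u x) (cnj (d_z j \<Psi> x) * x $ j) x"
    "has_wirtinger j (\<lambda>x. u x * cnj (x $ j)) (cnj (d_zbar j \<Psi> x) * cnj (x $ j)) (cnj (d_z j \<Psi> x) * cnj (x $ j) + u x) x" for x
    using has_wirtinger_mult[OF has_wirtinger_C_diff[OF u, of j x] has_wirtinger_coord[of j j x]]
      has_wirtinger_mult[OF has_wirtinger_C_diff[OF u, of j x] has_wirtinger_cnj_coord[of j j x]]
    by (simp_all add: du)
  have Cuz: "C_diff (Suc 0) (\<lambda>x. u x * x $ j)" "C_diff (Suc 0) (\<lambda>x. u x * cnj (x $ j))"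
    by (intro C_diff_mult S[OF u] C_diff_coord)+
  have cont: "continuous_on UNIV \<Psi>" "continuous_on UNIV u" "continuous_on UNIV F"
    "continuous_on UNIV (d_z j F)" "continuous_on UNIV (d_zbar j F)"
    "continuous_on UNIV (d_z j \<Psi>)" "continuous_on UNIV (d_zbar j \<Psi>)"
    "continuous_on UNIV (d_z j (d_zbar j \<Psi>))" "continuous_on UNIV (d_z j (d_zbar j F))"
    using S[OF S[OF \<Psi>]] S[OF S[OF u]] S[OF S[OF F]] S[OF dF(1)] S[OF dF(2)] S[OF d\<Psi>(1)] S[OF d\<Psi>(2)]
      C_diff_wirtinger(1)[OF d\<Psi>(2), of j] C_diff_wirtinger(1)[OF dF(2), of j] by auto

  have int: "integrable lebesgue (\<lambda>x. u x * d_z j (d_zbar j F) x)"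
    "integrable lebesgue (\<lambda>x. cnj (d_z j (d_zbar j \<Psi>) x) * F x)"
    "integrable lebesgue (\<lambda>x. u x * x $ j * d_z j F x)"
    "integrable lebesgue (\<lambda>x. u x * cnj (x $ j) * d_zbar j F x)"
    "integrable lebesgue (\<lambda>x. cnj (d_zbar j \<Psi> x) * x $ j * F x)"
    "integrable lebesgue (\<lambda>x. cnj (d_z j \<Psi> x) * cnj (x $ j) * F x)"
    "integrable lebesgue (\<lambda>x. u x * F x)"
    "integrable lebesgue (\<lambda>x. u x * (x $ j * cnj (x $ j)) * F x)"
    by (intro compact_support_mult_integrable[of _ _ R] continuous_intros cont; simp add: usupp supps)+
  have B: "(\<integral>x. u x * x $ j * d_z j F x \<partial>lebesgue) =
      - (\<integral>x. cnj (d_zbar j \<Psi> x) * x $ j * F x \<partial>lebesgue) - (\<integral>x. u x * F x \<partial>lebesgue)"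
    using wirtinger_integration_by_parts(1)[OF Cuz(1) S[OF F], of R j] int usupp
    by (simp add: has_wirtingerD[OF uz(1)] distrib_right)
  have C: "(\<integral>x. u x * cnj (x $ j) * d_zbar j F x \<partial>lebesgue) =
      - (\<integral>x. cnj (d_z j \<Psi> x) * cnj (x $ j) * F x \<partial>lebesgue) - (\<integral>x. u x * F x \<partial>lebesgue)"
    using wirtinger_integration_by_parts(2)[OF Cuz(2) S[OF F], of R j] int usupp
    by (simp add: has_wirtingerD[OF uz(2)] distrib_right)
  have L: "cnj (\<Psi> x) * Delta_coord \<nu> \<mu> j F x =
      4 * (u x * d_z j (d_zbar j F) x)
      + (2 * \<i> * of_real \<nu> + 2 * of_real \<mu>) * (u x * x $ j * d_z j F x)
      + (2 * \<i> * of_real \<nu> - 2 * of_real \<mu>) * (u x * cnj (x $ j) * d_zbar j F x)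
      + 2 * \<i> * of_real \<nu> * (u x * F x)
      - of_real (\<nu>\<^sup>2 + \<mu>\<^sup>2) * (u x * (x $ j * cnj (x $ j)) * F x)" for x
    by (simp add: Delta_coord_def u_def algebra_simps)
  have R: "cnj (Delta_coord \<nu> \<mu> j \<Psi> x) * F x =
      4 * (cnj (d_z j (d_zbar j \<Psi>) x) * F x)
      - (2 * \<i> * of_real \<nu> + 2 * of_real \<mu>) * (cnj (d_zbar j \<Psi> x) * x $ j * F x)
      - (2 * \<i> * of_real \<nu> - 2 * of_real \<mu>) * (cnj (d_z j \<Psi> x) * cnj (x $ j) * F x)
      - 2 * \<i> * of_real \<nu> * (u x * F x)
      - of_real (\<nu>\<^sup>2 + \<mu>\<^sup>2) * (u x * (x $ j * cnj (x $ j)) * F x)" for x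
    by (simp add: Delta_coord_def u_def algebra_simps)
  have E1: "(\<integral>x. cnj (\<Psi> x) * Delta_coord \<nu> \<mu> j F x \<partial>lebesgue) =
      4 * (\<integral>x. u x * d_z j (d_zbar j F) x \<partial>lebesgue)
      + (2 * \<i> * of_real \<nu> + 2 * of_real \<mu>) * (\<integral>x. u x * x $ j * d_z j F x \<partial>lebesgue)
      + (2 * \<i> * of_real \<nu> - 2 * of_real \<mu>) * (\<integral>x. u x * cnj (x $ j) * d_zbar j F x \<partial>lebesgue)
      + 2 * \<i> * of_real \<nu> * (\<integral>x. u x * F x \<partial>lebesgue)
      - of_real (\<nu>\<^sup>2 + \<mu>\<^sup>2) * (\<integral>x. u x * (x $ j * cnj (x $ j)) * F x \<partial>lebesgue)"
    unfolding L using int by (simp del: of_real_add of_real_power)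
  have E2: "(\<integral>x. cnj (Delta_coord \<nu> \<mu> j \<Psi> x) * F x \<partial>lebesgue) =
      4 * (\<integral>x. cnj (d_z j (d_zbar j \<Psi>) x) * F x \<partial>lebesgue)
      - (2 * \<i> * of_real \<nu> + 2 * of_real \<mu>) * (\<integral>x. cnj (d_zbar j \<Psi> x) * x $ j * F x \<partial>lebesgue)
      - (2 * \<i> * of_real \<nu> - 2 * of_real \<mu>) * (\<integral>x. cnj (d_z j \<Psi> x) * cnj (x $ j) * F x \<partial>lebesgue)
      - 2 * \<i> * of_real \<nu> * (\<integral>x. u x * F x \<partial>lebesgue)
      - of_real (\<nu>\<^sup>2 + \<mu>\<^sup>2) * (\<integral>x. u x * (x $ j * cnj (x $ j)) * F x \<partial>lebesgue)"
    unfolding R using int by (simp del: of_real_add of_real_power)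
  show ?thesis
    unfolding E1 E2 A B C by (simp add: algebra_simps del: of_real_add of_real_power)
qed

text \<open>Compact support of one function removes all boundary terms, so the other one can be an eigenfunction
about whose derivatives nothing is known at infinity.\<close>

lemma Delta_symmetric:
  fixes \<Psi> F :: "complex ^ 'n \<Rightarrow> complex"
  assumes \<Psi>: "C_diff (Suc (Suc 0)) \<Psi>" and F: "C_diff (Suc (Suc 0)) F"
    and supp: "\<And>x. norm x > R \<Longrightarrow> \<Psi> x = 0"
  shows "(\<integral>x. cnj (\<Psi> x) * Delta \<nu> \<mu> F x \<partial>lebesgue) =
    (\<integral>x. cnj (Delta \<nu> \<mu> \<Psi> x) * F x \<partial>lebesgue)"
proof -
  have cont: "continuous_on UNIV \<Psi>" "continuous_on UNIV F"
    using C_diff_Suc_imp[OF C_diff_Suc_imp[OF \<Psi>]] C_diff_Suc_imp[OF C_diff_Suc_imp[OF F]] by auto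
  have int: "integrable lebesgue (\<lambda>x. cnj (\<Psi> x) * Delta_coord \<nu> \<mu> j F x)"
    "integrable lebesgue (\<lambda>x. cnj (Delta_coord \<nu> \<mu> j \<Psi> x) * F x)" for j
    by (rule compact_support_integrable[of _ R];
      use cont supp Delta_coord_continuous[OF F] Delta_coord_continuous[OF \<Psi>]
        Delta_coord_outside_support[OF supp] in \<open>auto intro!: continuous_intros\<close>)+
  show ?thesis
    unfolding Delta_eq_sum sum_distrib_left cnj_sum sum_distrib_right
    by (subst (1 2) Bochner_Integration.integral_sum) (use int Delta_coord_symmetric[OF assms] in auto)
qed

section \<open>The operator on radial functions\<close>

lemma has_wirtinger_sum:
  "finite I \<Longrightarrow> (\<And>i. i \<in> I \<Longrightarrow> has_wirtinger j (f i) (p i) (q i) z) \<Longrightarrow>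
   has_wirtinger j (\<lambda>z. \<Sum>i\<in>I. f i z) (\<Sum>i\<in>I. p i) (\<Sum>i\<in>I. q i) z"
  by (induction I rule: finite_induct) (auto intro: has_wirtinger_const has_wirtinger_add)

lemma has_wirtinger_cmult:
  "has_wirtinger j f p q z \<Longrightarrow> has_wirtinger j (\<lambda>z. c * f z) (c * p) (c * q) z"
  using has_wirtinger_mult[OF has_wirtinger_const, of j f p q z c] by simp

lemma has_wirtinger_norm_sq:
  fixes z :: "complex ^ 'n"
  shows "has_wirtinger j (\<lambda>z. of_real ((norm z)\<^sup>2)) (cnj (z $ j)) (z $ j) z"
  using has_wirtinger_radial[OF DERIV_ident, where w = 0 and z = z] by (simp del: of_real_power)

lemma has_wirtinger_hermitian:
  "has_wirtinger j (\<lambda>z. hermitian z w) (cnj (w $ j)) 0 z"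
proof -
  have "has_wirtinger j (\<lambda>z. \<Sum>k\<in>UNIV. z $ k * cnj (w $ k))
     (\<Sum>k\<in>UNIV. (if j = k then 1 else 0) * cnj (w $ k) + z $ k * 0) (\<Sum>k\<in>UNIV. 0 * cnj (w $ k) + z $ k * 0) z"
    by (intro has_wirtinger_sum has_wirtinger_mult has_wirtinger_coord has_wirtinger_const) auto
  then show ?thesis
    by (simp add: hermitian_def if_distrib[of "\<lambda>x. x * _"] cong: if_cong)
qed

lemma has_wirtinger_j_factor:
  "has_wirtinger j (\<lambda>z. j_factor \<nu> \<mu> z w)
     ((of_real (\<mu> / 2) * cnj (w $ j) - \<i> * of_real \<nu> / 2 * cnj (z $ j)) * j_factor \<nu> \<mu> z w)
     ((- of_real (\<mu> / 2) * w $ j - \<i> * of_real \<nu> / 2 * z $ j) * j_factor \<nu> \<mu> z w) z"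
proof -
  have "has_wirtinger j (\<lambda>z. - (\<i> * of_real \<nu> / 2) * (of_real ((norm z)\<^sup>2) + of_real (- (norm w)\<^sup>2))
          + of_real (\<mu> / 2) * (hermitian z w + (- 1) * cnj (hermitian z w)))
     (- (\<i> * of_real \<nu> / 2) * (cnj (z $ j) + 0) + of_real (\<mu> / 2) * (cnj (w $ j) + (- 1) * cnj 0))
     (- (\<i> * of_real \<nu> / 2) * (z $ j + 0) + of_real (\<mu> / 2) * (0 + (- 1) * cnj (cnj (w $ j)))) z"
    by (intro has_wirtinger_add has_wirtinger_cmult has_wirtinger_norm_sq has_wirtinger_hermitian
        has_wirtinger_cnj has_wirtinger_const)
  from has_wirtinger_exp[OF this] show ?thesis
    unfolding j_factor_def by (simp add: algebra_simps)
qed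

lemma C_diff_hermitian: "C_diff k (\<lambda>z. hermitian z w)"
  unfolding hermitian_def by (intro C_diff_sum C_diff_mult C_diff_coord C_diff_const) auto

lemma C_diff_norm_sq: "C_diff k (\<lambda>z::complex^'n. of_real ((norm z)\<^sup>2))"
  unfolding norm_sq_eq_sum by (intro C_diff_sum C_diff_mult C_diff_coord) auto

lemma C_diff_j_factor: "C_diff k (\<lambda>z. j_factor \<nu> \<mu> z w)"
proof -
  have "C_diff k (\<lambda>z. - (\<i> * of_real \<nu> / 2) * (of_real ((norm z)\<^sup>2) + of_real (- (norm w)\<^sup>2))
          + of_real (\<mu> / 2) * (hermitian z w + (- 1) * cnj (hermitian z w)))"
    by (intro C_diff_add C_diff_cmult C_diff_norm_sq C_diff_hermitian C_diff_const
        C_diff_compose_bounded_linear[OF bounded_linear_cnj])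
  from C_diff_exp[OF this] show ?thesis
    unfolding j_factor_def by simp
qed

text \<open>The derivatives of the phase cancel the terms with \<open>\<nu>\<close> and complete the square in the potential, so
that the coefficient of \<open>g\<close> depends on \<open>z j\<close> and \<open>w j\<close> only through their difference.\<close>

lemma Delta_coord_radial:
  fixes z w :: "complex ^ 'n" and g g' g'' :: "real \<Rightarrow> real"
  assumes g: "\<And>t. (g has_real_derivative g' t) (at t)" and g': "\<And>t. (g' has_real_derivative g'' t) (at t)"
  defines "t \<equiv> (norm (z - w))\<^sup>2"
  shows "Delta_coord \<nu> \<mu> j (\<lambda>z. of_real (g ((norm (z - w))\<^sup>2)) * j_factor \<nu> \<mu> z w) z =
    (of_real (4 * g'' t - \<mu>\<^sup>2 * g t) * ((z - w) $ j * cnj ((z - w) $ j)) + 4 * of_real (g' t))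
      * j_factor \<nu> \<mu> z w"
proof -
  let ?\<Psi> = "\<lambda>z. of_real (g ((norm (z - w))\<^sup>2)) * j_factor \<nu> \<mu> z w"
  let ?J = "\<lambda>z. j_factor \<nu> \<mu> z w"
  define I m where "I = \<i> * of_real \<nu> / 2" and "m = complex_of_real (\<mu> / 2)"
  note J = has_wirtinger_j_factor[where \<nu> = \<nu> and \<mu> = \<mu>, folded I_def m_def]
  note w1 = has_wirtinger_mult[OF has_wirtinger_radial[OF g] J]
  have dbar: "d_zbar j ?\<Psi> = (\<lambda>z.
      (of_real (g' ((norm (z - w))\<^sup>2)) * (z $ j + - (w $ j))
       + of_real (g ((norm (z - w))\<^sup>2)) * (- m * w $ j + (- I) * z $ j)) * ?J z)"
    by (rule ext, subst has_wirtingerD(2)[OF w1]) (simp add: algebra_simps)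
  have d: "d_z j ?\<Psi> z = (of_real (g' t) * (cnj (z $ j) - cnj (w $ j))
       + of_real (g t) * (m * cnj (w $ j) - I * cnj (z $ j))) * ?J z"
    unfolding t_def by (subst has_wirtingerD(1)[OF w1]) (simp add: algebra_simps)
  note w2 = has_wirtinger_mult[OF has_wirtinger_add[OF
      has_wirtinger_mult[OF has_wirtinger_radial[OF g'] has_wirtinger_add[OF has_wirtinger_coord has_wirtinger_const]]
      has_wirtinger_mult[OF has_wirtinger_radial[OF g] has_wirtinger_add[OF has_wirtinger_const has_wirtinger_cmult[OF has_wirtinger_coord]]]]
      J]
  have dd: "d_z j (d_zbar j ?\<Psi>) z =
      (of_real (g'' t) * (cnj (z $ j) - cnj (w $ j)) * (z $ j - w $ j) + of_real (g' t)
       + (of_real (g' t) * (cnj (z $ j) - cnj (w $ j)) * (- m * w $ j - I * z $ j)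
       + of_real (g t) * (- I))
       + (of_real (g' t) * (z $ j - w $ j) + of_real (g t) * (- m * w $ j - I * z $ j))
         * (m * cnj (w $ j) - I * cnj (z $ j))) * ?J z"
    unfolding dbar t_def by (subst has_wirtingerD(1)[OF w2]) (simp add: algebra_simps)
  \<comment> \<open>With \<open>I = \<i> \<nu> / 2\<close> and \<open>m = \<mu> / 2\<close> the claim is an identity of polynomials, in which conjugate
    variables may be treated as independent.\<close>
  have alg: "4 * ((g2 * (Zb - Wb) * (Z - W) + g1
       + (g1 * (Zb - Wb) * (- m * W - I * Z) + g0 * (- I))
       + (g1 * (Z - W) + g0 * (- m * W - I * Z)) * (m * Wb - I * Zb)) * J)
     + 4 * I * (Z * ((g1 * (Zb - Wb) + g0 * (m * Wb - I * Zb)) * J)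
          + Zb * ((g1 * (Z + - W) + g0 * (- m * W + - I * Z)) * J) + g0 * J)
     + 4 * m * (Z * ((g1 * (Zb - Wb) + g0 * (m * Wb - I * Zb)) * J)
          - Zb * ((g1 * (Z + - W) + g0 * (- m * W + - I * Z)) * J))
     - (- 4 * I\<^sup>2 + 4 * m\<^sup>2) * (Z * Zb) * (g0 * J)
     = ((4 * g2 - 4 * m\<^sup>2 * g0) * ((Z - W) * (Zb - Wb)) + 4 * g1) * J"
    for Z Zb W Wb g0 g1 g2 J :: complex
    by algebra
  have I2: "of_real (\<nu>\<^sup>2 + \<mu>\<^sup>2) = - 4 * I\<^sup>2 + 4 * m\<^sup>2" "2 * \<i> * of_real \<nu> = 4 * I"
    "2 * of_real \<mu> = 4 * m" "of_real (4 * g'' t - \<mu>\<^sup>2 * g t) = 4 * of_real (g'' t) - 4 * m\<^sup>2 * of_real (g t)"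
    by (simp_all add: power_mult_distrib power_divide I_def m_def)
  show ?thesis
    unfolding Delta_coord_def dd d I2 t_def[symmetric] vector_minus_component complex_cnj_diff
    unfolding dbar t_def[symmetric]
    by (rule alg)
qed

lemma Delta_radial:
  fixes z w :: "complex ^ 'n" and g g' g'' :: "real \<Rightarrow> real"
  assumes g: "\<And>t. (g has_real_derivative g' t) (at t)" and g': "\<And>t. (g' has_real_derivative g'' t) (at t)"
  defines "t \<equiv> (norm (z - w))\<^sup>2"
  shows "Delta \<nu> \<mu> (\<lambda>z. of_real (g ((norm (z - w))\<^sup>2)) * j_factor \<nu> \<mu> z w) z =
    of_real (4 * t * g'' t + 4 * real CARD('n) * g' t - \<mu>\<^sup>2 * t * g t) * j_factor \<nu> \<mu> z w"
proof -
  have "Delta \<nu> \<mu> (\<lambda>z. of_real (g ((norm (z - w))\<^sup>2)) * j_factor \<nu> \<mu> z w) z =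
    (of_real (4 * g'' t - \<mu>\<^sup>2 * g t) * (\<Sum>j\<in>UNIV. (z - w) $ j * cnj ((z - w) $ j))
      + (\<Sum>j\<in>(UNIV::'n set). 4 * of_real (g' t))) * j_factor \<nu> \<mu> z w"
    unfolding Delta_eq_sum Delta_coord_radial[OF g g'] t_def
    by (simp only: sum_distrib_right sum_distrib_left sum.distrib distrib_right)
  also have "\<dots> = of_real (4 * t * g'' t + 4 * real CARD('n) * g' t - \<mu>\<^sup>2 * t * g t) * j_factor \<nu> \<mu> z w"
    unfolding norm_sq_eq_sum[symmetric] t_def[symmetric] by (simp add: algebra_simps)
  finally show ?thesis .
qed

lemma norm_j_factor [simp]: "norm (j_factor \<nu> \<mu> z w) = 1"
  by (simp add: j_factor_def)

lemma j_factor_self: "j_factor \<nu> \<mu> z z = 1"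
proof -
  have "cnj (hermitian z z) = hermitian z z" by (simp add: hermitian_def mult.commute)
  then show ?thesis by (simp add: j_factor_def)
qed

lemma cnj_j_factor: "cnj (j_factor \<nu> \<mu> z w) = j_factor \<nu> \<mu> w z"
proof -
  have "cnj (hermitian z w) = hermitian w z" "cnj (hermitian w z) = hermitian z w" 
    by (simp_all add: hermitian_def mult.commute)
  then show ?thesis unfolding j_factor_def exp_cnj
    by (simp add: algebra_simps)
qed

section \<open>Gaussian moments\<close>

lemma power_exp_bound:
  fixes a :: real
  assumes "a > 0"
  shows "\<exists>C>0. \<forall>x\<ge>0. x ^ k * exp (- a * x) \<le> C * exp (- (a / 2) * x)"
proof (intro exI[of _ "fact k / (a / 2) ^ k"] conjI allI impI)
  show "fact k / (a / 2) ^ k > 0" using assms by simp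
  fix x :: real assume x: "x \<ge> 0"
  define b where "b = a / 2"
  have b: "b > 0" using assms by (simp add: b_def)
  have "(\<Sum>i\<in>{k}. (b * x) ^ i /\<^sub>R fact i) \<le> (\<Sum>i. (b * x) ^ i /\<^sub>R fact i)"
    by (rule sum_le_suminf[OF summable_exp_generic]) (use x b in auto)
  then have "(b * x) ^ k / fact k \<le> exp (b * x)"
    unfolding exp_def by (simp add: divide_inverse mult.commute)
  then have "x ^ k \<le> fact k / b ^ k * exp (b * x)"
    using b by (simp add: power_mult_distrib field_simps)
  then have "x ^ k * exp (- a * x) \<le> fact k / b ^ k * exp (b * x) * exp (- a * x)"
    by (rule mult_right_mono) simp
  also have "\<dots> = fact k / b ^ k * (exp (b * x) * exp (- a * x))" by (rule mult.assoc)
  also have "exp (b * x) * exp (- a * x) = exp (- b * x)"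
    unfolding exp_add[symmetric] by (simp add: b_def)
  finally show "x ^ k * exp (- a * x) \<le> fact k / (a / 2) ^ k * exp (- (a / 2) * x)"
    unfolding b_def .
qed

definition gauss_moment :: "('a::euclidean_space \<Rightarrow> complex) \<Rightarrow> 'a \<Rightarrow> nat \<Rightarrow> real \<Rightarrow> complex" where
  "gauss_moment h z k a = (\<integral>w. of_real (((norm (w - z))\<^sup>2) ^ k * exp (- a * (norm (w - z))\<^sup>2)) * h w \<partial>lebesgue)"

lemma gauss_moment_integrable:
  fixes h :: "'a::euclidean_space \<Rightarrow> complex"
  assumes h: "h \<in> L2" and a: "a > 0"
  shows "integrable lebesgue (\<lambda>w. of_real (((norm (w - z))\<^sup>2) ^ k * exp (- a * (norm (w - z))\<^sup>2)) * h w)"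
proof -
  obtain C where C: "C > 0" "\<And>x. x \<ge> 0 \<Longrightarrow> x ^ k * exp (- a * x) \<le> C * exp (- (a / 2) * x)"
    using power_exp_bound[OF a] by blast
  have "integrable lebesgue (\<lambda>w. C * (exp (- (a / 2) * (norm (w - z))\<^sup>2) * norm (h w)))"
    using gaussian_mult_integrable[OF h, of "a / 2" z] a by simp
  then show ?thesis
  proof (rule Bochner_Integration.integrable_bound)
    have "(\<lambda>w. complex_of_real (((norm (w - z))\<^sup>2) ^ k * exp (- a * (norm (w - z))\<^sup>2))) \<in> borel_measurable lebesgue"
      by (intro continuous_imp_lebesgue_measurable continuous_intros)
    then show "(\<lambda>w. complex_of_real (((norm (w - z))\<^sup>2) ^ k * exp (- a * (norm (w - z))\<^sup>2)) * h w) \<in> borel_measurable lebesgue"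
      using L2_D(1)[OF h] by (rule borel_measurable_times)
    show "AE w in lebesgue. norm (of_real (((norm (w - z))\<^sup>2) ^ k * exp (- a * (norm (w - z))\<^sup>2)) * h w)
        \<le> norm (C * (exp (- (a / 2) * (norm (w - z))\<^sup>2) * norm (h w)))"
    proof (rule AE_I2)
      fix w
      have "((norm (w - z))\<^sup>2) ^ k * exp (- a * (norm (w - z))\<^sup>2) * norm (h w)
          \<le> C * exp (- (a / 2) * (norm (w - z))\<^sup>2) * norm (h w)"
        by (intro mult_right_mono C(2)) auto
      then show "norm (of_real (((norm (w - z))\<^sup>2) ^ k * exp (- a * (norm (w - z))\<^sup>2)) * h w)
        \<le> norm (C * (exp (- (a / 2) * (norm (w - z))\<^sup>2) * norm (h w)))"
        using C(1) by (simp add: norm_mult mult.assoc del: of_real_mult)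
    qed
  qed
qed

lemma gauss_moment_norm_integrable:
  fixes h :: "'a::euclidean_space \<Rightarrow> complex"
  assumes h: "h \<in> L2" and a: "a > 0"
  shows "integrable lebesgue (\<lambda>w. ((norm (w - z))\<^sup>2) ^ k * exp (- a * (norm (w - z))\<^sup>2) * norm (h w))"
  using integrable_norm[OF gauss_moment_integrable[OF assms, of z k]]
  by (simp add: norm_mult del: of_real_mult of_real_power of_real_exp)

lemma gauss_moment_derivative:
  fixes h :: "'a::euclidean_space \<Rightarrow> complex"
  assumes h: "h \<in> L2" and a: "a > 0"
  shows "(gauss_moment h z k has_vector_derivative - gauss_moment h z (Suc k) a) (at a)"
proof -
  define t where "t w = (norm (w - z))\<^sup>2" for w
  have t0: "t w \<ge> 0" for w by (simp add: t_def)
  have "((\<lambda>a. \<integral>w. of_real (t w ^ k * exp (- a * t w)) * h w \<partial>lebesgue) has_derivative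
      (\<lambda>v. \<integral>w. of_real (- v * (t w ^ Suc k * exp (- a * t w))) * h w \<partial>lebesgue)) (at a)"
  proof (rule has_derivative_integral[where r = "a / 2" and M = lebesgue and
        B = "\<lambda>w. t w ^ Suc k * exp (- (a / 2) * t w) * norm (h w)" and
        D = "\<lambda>a w v. of_real (- v * (t w ^ Suc k * exp (- a * t w))) * h w"])
    show "integrable lebesgue (\<lambda>w. complex_of_real (t w ^ k * exp (- b * t w)) * h w)" if "b \<in> ball a (a / 2)" for b
      unfolding t_def by (rule gauss_moment_integrable[OF h]) (use that a in \<open>auto simp: dist_real_def abs_if split: if_splits\<close>)
    have "integrable lebesgue (\<lambda>w. of_real (- v) * (complex_of_real (t w ^ Suc k * exp (- a * t w)) * h w))" for v
      unfolding t_def by (intro integrable_mult_right gauss_moment_integrable[OF h a])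
    then show "(\<lambda>w. complex_of_real (- v * (t w ^ Suc k * exp (- a * t w))) * h w) \<in> borel_measurable lebesgue" for v
      by (auto simp: mult.assoc dest: borel_measurable_integrable)
    show "((\<lambda>a. complex_of_real (t w ^ k * exp (- a * t w)) * h w) has_derivative
          (\<lambda>v. complex_of_real (- v * (t w ^ Suc k * exp (- b * t w))) * h w)) (at b)" for b w
    proof -
      have "((\<lambda>a. t w ^ k * exp (- a * t w)) has_derivative (\<lambda>v. - v * (t w ^ Suc k * exp (- b * t w)))) (at b)"
        by (auto intro!: derivative_eq_intros)
      from has_derivative_mult_left[OF has_derivative_of_real[OF this]] show ?thesis .
    qed
    show "norm (complex_of_real (- v * (t w ^ Suc k * exp (- b * t w))) * h w)
        \<le> t w ^ Suc k * exp (- (a / 2) * t w) * norm (h w) * norm v" if "b \<in> ball a (a / 2)" for b w v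
    proof -
      have "a / 2 < b" using that by (auto simp: dist_real_def abs_if split: if_splits)
      then have "(a / 2) * t w \<le> b * t w" by (intro mult_right_mono t0) simp
      then have "exp (- b * t w) \<le> exp (- (a / 2) * t w)" by simp
      then have "norm v * (t w ^ Suc k * exp (- b * t w) * norm (h w)) \<le>
          norm v * (t w ^ Suc k * exp (- (a / 2) * t w) * norm (h w))"
        by (intro mult_left_mono mult_right_mono) (auto simp: t0)
      moreover have "norm (complex_of_real (- v * (t w ^ Suc k * exp (- b * t w))) * h w)
         = norm v * (t w ^ Suc k * exp (- b * t w) * norm (h w))"
        using t0[of w] by (simp only: norm_mult norm_of_real abs_mult abs_minus_cancel) (simp add: abs_mult)
      ultimately show ?thesis by (simp add: mult_ac)
    qed
    show "integrable lebesgue (\<lambda>w. t w ^ Suc k * exp (- (a / 2) * t w) * norm (h w))"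
      unfolding t_def by (rule gauss_moment_norm_integrable[OF h]) (use a in simp)
  qed (use a in auto)
  moreover have "(\<integral>w. of_real (- v * (t w ^ Suc k * exp (- a * t w))) * h w \<partial>lebesgue)
      = v *\<^sub>R (- gauss_moment h z (Suc k) a)" for v
  proof -
    have "(\<integral>w. of_real (- v * (t w ^ Suc k * exp (- a * t w))) * h w \<partial>lebesgue)
        = (\<integral>w. of_real (- v) * (of_real (t w ^ Suc k * exp (- a * t w)) * h w) \<partial>lebesgue)"
      by (simp only: of_real_mult mult.assoc)
    also have "\<dots> = of_real (- v) * gauss_moment h z (Suc k) a"
      unfolding gauss_moment_def t_def by (rule integral_mult_right_zero)
    finally show ?thesis by (simp add: scaleR_conv_of_real)
  qed
  ultimately show ?thesis
    unfolding has_vector_derivative_def gauss_moment_def[abs_def] t_def by simp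
qed

text \<open>For large \<open>a\<close> the mass of the Gaussian outside a ball around \<open>z\<close> decays exponentially in \<open>a\<close>, which beats
the polynomial normalisation. The function \<open>h\<close> may be unbounded, so the decay is taken from
\<open>exp (- (a - 1) t)\<close> and the remaining factor \<open>exp (- t)\<close> is kept to integrate \<open>h\<close>.\<close>

lemma gaussian_approximate_identity:
  fixes h :: "'a::euclidean_space \<Rightarrow> complex"
  assumes h: "h \<in> L2" and cont: "isCont h z"
  shows "((\<lambda>a. of_real (sqrt a ^ DIM('a)) * gauss_moment h z 0 a) \<longlongrightarrow> of_real (sqrt pi ^ DIM('a)) * h z) at_top"
proof -
  define t where "t w = (norm (w - z))\<^sup>2" for w
  define H where "H w = h w - h z" for w
  let ?n = "DIM('a)"
  have gauss: "has_bochner_integral lebesgue (\<lambda>w. exp (- a * t w)) (sqrt (pi / a) ^ ?n)" if "a > 0" for a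
    unfolding t_def by (rule gaussian_has_integral[OF that])
  have gauss_int: "integrable lebesgue (\<lambda>w. exp (- a * t w))" if "a > 0" for a
    using gauss[OF that] by (simp add: has_bochner_integral_iff)
  have h_int: "integrable lebesgue (\<lambda>w. of_real (exp (- a * t w)) * h w)" if "a > 0" for a
    using gauss_moment_integrable[OF h that, of z 0] by (simp add: t_def)
  have H_int: "integrable lebesgue (\<lambda>w. of_real (exp (- a * t w)) * H w)" if "a > 0" for a
    unfolding H_def right_diff_distrib
    by (intro Bochner_Integration.integrable_diff h_int that integrable_mult_left integrable_of_real gauss_int)
  define K where "K = (\<integral>w. exp (- 1 * t w) * norm (H w) \<partial>lebesgue)"
  have HN: "integrable lebesgue (\<lambda>w. exp (- a * t w) * norm (H w))" if "a > 0" for a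
    using integrable_norm[OF H_int[OF that]] by (simp add: norm_mult)
  have split: "of_real (sqrt a ^ ?n) * gauss_moment h z 0 a - of_real (sqrt pi ^ ?n) * h z
     = of_real (sqrt a ^ ?n) * (\<integral>w. of_real (exp (- a * t w)) * H w \<partial>lebesgue)" if a: "a > 0" for a
  proof -
    have "(\<integral>w. of_real (exp (- a * t w)) * H w \<partial>lebesgue) =
        (\<integral>w. of_real (exp (- a * t w)) * h w \<partial>lebesgue) - (\<integral>w. of_real (exp (- a * t w)) * h z \<partial>lebesgue)"
      unfolding H_def right_diff_distrib
      by (rule Bochner_Integration.integral_diff[OF h_int[OF a] integrable_mult_left[OF integrable_of_real[OF gauss_int[OF a]]]])
    also have "(\<integral>w. of_real (exp (- a * t w)) * h z \<partial>lebesgue) = of_real (sqrt (pi / a) ^ ?n) * h z"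
      using gauss[OF a] by (simp add: has_bochner_integral_iff del: of_real_power of_real_exp)
    finally have "(\<integral>w. of_real (exp (- a * t w)) * H w \<partial>lebesgue) =
        gauss_moment h z 0 a - of_real (sqrt (pi / a) ^ ?n) * h z" by (simp add: gauss_moment_def t_def)
    moreover have "complex_of_real (sqrt a ^ ?n) * of_real (sqrt (pi / a) ^ ?n) = of_real (sqrt pi ^ ?n)"
      using a by (simp flip: of_real_mult power_mult_distrib real_sqrt_mult)
    ultimately show ?thesis by (simp add: right_diff_distrib mult.assoc[symmetric] del: of_real_power)
  qed
  have bound: "norm (of_real (sqrt a ^ ?n) * (\<integral>w. of_real (exp (- a * t w)) * H w \<partial>lebesgue))
      \<le> \<epsilon> * sqrt pi ^ ?n + sqrt a ^ ?n * exp (- (a - 1) * \<delta>\<^sup>2) * K"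
    if a: "a > 1" and \<epsilon>: "\<epsilon> > 0" and \<delta>: "\<delta> > 0" and near: "\<And>w. norm (w - z) < \<delta> \<Longrightarrow> norm (H w) \<le> \<epsilon>" for a \<epsilon> \<delta>
  proof -
    have a0: "a > 0" using a by simp
    have pw: "exp (- a * t w) * norm (H w) \<le> \<epsilon> * exp (- a * t w) + exp (- (a - 1) * \<delta>\<^sup>2) * (exp (- 1 * t w) * norm (H w))" for w
    proof (cases "norm (w - z) < \<delta>")
      case True
      have "exp (- a * t w) * norm (H w) \<le> \<epsilon> * exp (- a * t w)"
        using mult_left_mono[OF near[OF True], of "exp (- a * t w)"] by (simp add: mult.commute)
      moreover have "0 \<le> exp (- (a - 1) * \<delta>\<^sup>2) * (exp (- 1 * t w) * norm (H w))" by simp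
      ultimately show ?thesis by linarith
    next
      case False
      then have "\<delta>\<^sup>2 \<le> t w" unfolding t_def using \<delta> by (intro power_mono) auto
      then have "(a - 1) * \<delta>\<^sup>2 \<le> (a - 1) * t w" using a by (intro mult_left_mono) auto
      then have "- a * t w \<le> - (a - 1) * \<delta>\<^sup>2 + - 1 * t w" by (simp add: algebra_simps)
      then have "exp (- a * t w) \<le> exp (- (a - 1) * \<delta>\<^sup>2) * exp (- 1 * t w)" by (simp flip: exp_add)
      then have "exp (- a * t w) * norm (H w) \<le> exp (- (a - 1) * \<delta>\<^sup>2) * exp (- 1 * t w) * norm (H w)"
        by (rule mult_right_mono) simp
      moreover have "0 \<le> \<epsilon> * exp (- a * t w)" using \<epsilon> by simp
      ultimately show ?thesis by (simp add: mult.assoc)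
    qed
    have "norm (\<integral>w. of_real (exp (- a * t w)) * H w \<partial>lebesgue) \<le> (\<integral>w. norm (of_real (exp (- a * t w)) * H w) \<partial>lebesgue)"
      by (rule integral_norm_bound)
    also have "\<dots> = (\<integral>w. exp (- a * t w) * norm (H w) \<partial>lebesgue)" by (simp add: norm_mult)
    also have "\<dots> \<le> (\<integral>w. \<epsilon> * exp (- a * t w) + exp (- (a - 1) * \<delta>\<^sup>2) * (exp (- 1 * t w) * norm (H w)) \<partial>lebesgue)"
      by (intro integral_mono HN[OF a0] Bochner_Integration.integrable_add integrable_mult_right gauss_int[OF a0] HN pw) simp
    also have "\<dots> = \<epsilon> * sqrt (pi / a) ^ ?n + exp (- (a - 1) * \<delta>\<^sup>2) * K"
      unfolding K_def using gauss[OF a0] HN[of 1] gauss_int[OF a0]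
      by (subst Bochner_Integration.integral_add) (auto simp: has_bochner_integral_iff)
    finally have "norm (of_real (sqrt a ^ ?n) * (\<integral>w. of_real (exp (- a * t w)) * H w \<partial>lebesgue)) \<le>
        sqrt a ^ ?n * (\<epsilon> * sqrt (pi / a) ^ ?n + exp (- (a - 1) * \<delta>\<^sup>2) * K)"
      unfolding norm_mult using a0 by (intro mult_mono) (auto simp: norm_power)
    also have "\<dots> = \<epsilon> * (sqrt a * sqrt (pi / a)) ^ ?n + sqrt a ^ ?n * exp (- (a - 1) * \<delta>\<^sup>2) * K"
      by (simp add: algebra_simps power_mult_distrib)
    also have "sqrt a * sqrt (pi / a) = sqrt pi" using a0 by (simp flip: real_sqrt_mult)
    finally show ?thesis .
  qed
  have "((\<lambda>a. of_real (sqrt a ^ ?n) * gauss_moment h z 0 a - of_real (sqrt pi ^ ?n) * h z) \<longlongrightarrow> 0) at_top"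
  proof (rule tendstoI)
    fix e :: real assume e: "e > 0"
    \<comment> \<open>The total mass of the rescaled Gaussian is \<open>sqrt pi ^ DIM('a)\<close>, so the ball around \<open>z\<close> contributes \<open>e / 2\<close>.\<close>
    define \<epsilon> where "\<epsilon> = e / (2 * sqrt pi ^ ?n)"
    have \<epsilon>: "\<epsilon> > 0" "\<epsilon> * sqrt pi ^ ?n = e / 2" using e by (auto simp: \<epsilon>_def)
    obtain \<delta> where \<delta>: "\<delta> > 0" "\<And>w. norm (w - z) < \<delta> \<Longrightarrow> norm (H w) \<le> \<epsilon>"
      using cont[unfolded continuous_at_eps_delta, rule_format, OF \<epsilon>(1)]
      unfolding H_def dist_norm by (metis less_imp_le)
    have "((\<lambda>x::real. x ^ ?n / exp x) \<longlongrightarrow> 0) at_top" by (rule tendsto_power_div_exp_0)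
    moreover have "filterlim (\<lambda>a::real. \<delta>\<^sup>2 * a) at_top at_top"
      by (rule filterlim_tendsto_pos_mult_at_top[OF tendsto_const]) (use \<delta> in \<open>auto intro: filterlim_ident\<close>)
    ultimately have "((\<lambda>a. (\<delta>\<^sup>2 * a) ^ ?n / exp (\<delta>\<^sup>2 * a)) \<longlongrightarrow> 0) at_top"
      by (rule filterlim_compose)
    then have "((\<lambda>a. (\<delta>\<^sup>2 * a) ^ ?n / exp (\<delta>\<^sup>2 * a) * (exp (\<delta>\<^sup>2) * K / (\<delta>\<^sup>2) ^ ?n)) \<longlongrightarrow> 0 * (exp (\<delta>\<^sup>2) * K / (\<delta>\<^sup>2) ^ ?n)) at_top"
      by (intro tendsto_mult tendsto_const)
    then have "\<forall>\<^sub>F a in at_top. (\<delta>\<^sup>2 * a) ^ ?n / exp (\<delta>\<^sup>2 * a) * (exp (\<delta>\<^sup>2) * K / (\<delta>\<^sup>2) ^ ?n) < e / 2"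
      using e by (intro order_tendstoD(2)[where a = "e/2"]) auto
    then show "\<forall>\<^sub>F a in at_top. dist (of_real (sqrt a ^ ?n) * gauss_moment h z 0 a - of_real (sqrt pi ^ ?n) * h z) 0 < e"
      using eventually_gt_at_top[of 1]
    proof eventually_elim
      case (elim a)
      have K0: "K \<ge> 0" unfolding K_def by (intro integral_nonneg_AE AE_I2) auto
      have "sqrt a \<le> a" using elim(2) real_sqrt_le_mono[of a "a\<^sup>2"] by (simp add: power2_eq_square)
      then have "sqrt a ^ ?n \<le> a ^ ?n" using elim(2) by (intro power_mono) auto
      then have "sqrt a ^ ?n * exp (- (a - 1) * \<delta>\<^sup>2) * K \<le> a ^ ?n * exp (- (a - 1) * \<delta>\<^sup>2) * K"
        using K0 by (intro mult_right_mono) auto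
      also have "\<dots> = (\<delta>\<^sup>2 * a) ^ ?n / exp (\<delta>\<^sup>2 * a) * (exp (\<delta>\<^sup>2) * K / (\<delta>\<^sup>2) ^ ?n)"
      proof -
        have "exp (- (a - 1) * \<delta>\<^sup>2) = exp (\<delta>\<^sup>2) / exp (\<delta>\<^sup>2 * a)"
          by (simp add: exp_diff[symmetric] algebra_simps)
        then show ?thesis using \<delta>(1) by (simp add: power_mult_distrib)
      qed
      also have "\<dots> < e / 2" by (rule elim(1))
      finally have "norm (of_real (sqrt a ^ ?n) * (\<integral>w. of_real (exp (- a * t w)) * H w \<partial>lebesgue)) < e"
        using bound[OF elim(2) \<epsilon>(1) \<delta>] \<epsilon>(2) by linarith
      then show ?case using split[of a] elim(2) by (simp add: dist_norm del: of_real_power)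
    qed
  qed
  then show ?thesis by (simp add: LIM_zero_iff del: of_real_power)
qed

text \<open>Uniqueness of asymptotic expansions at 0: letting \<open>s\<close> tend to 0 kills the constant coefficient, and
dividing by \<open>s\<close> lowers the degree.\<close>

lemma polynomial_eq_power_times_limit:
  fixes c :: "nat \<Rightarrow> complex"
  assumes eq: "\<And>s. 0 < s \<Longrightarrow> s < \<delta> \<Longrightarrow> (\<Sum>k\<le>l. c k * of_real s ^ k) = of_real s ^ l * \<phi> s"
    and \<delta>: "\<delta> > 0" and lim: "(\<phi> \<longlongrightarrow> L) (at_right 0)"
  shows "(\<forall>k<l. c k = 0) \<and> c l = L"
  using eq
proof (induction l arbitrary: c)
  case 0
  have "\<forall>\<^sub>F s in at_right 0. \<phi> s = c 0"
    using eventually_at_right_less[of 0] eventually_at_right_field[of "\<lambda>s. s < \<delta>" 0] \<delta>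
    by (auto simp: eventually_at_right_field intro!: exI[of _ \<delta>]) (use 0 in auto)
  then have "(\<phi> \<longlongrightarrow> c 0) (at_right 0)" by (rule tendsto_eventually)
  then show ?case using lim tendsto_unique[OF trivial_limit_at_right_real] by auto
next
  case (Suc l)
  have ev: "\<forall>\<^sub>F s in at_right 0. (\<Sum>k\<le>Suc l. c k * of_real s ^ k) = of_real s ^ Suc l * \<phi> s"
    using Suc.prems \<delta> by (auto simp: eventually_at_right_field intro!: exI[of _ \<delta>])
  have "((\<lambda>s. \<Sum>k\<le>Suc l. c k * complex_of_real s ^ k) \<longlongrightarrow> (\<Sum>k\<le>Suc l. c k * complex_of_real 0 ^ k)) (at_right 0)"
    by (intro tendsto_intros)
  moreover have "(\<Sum>k\<le>Suc l. c k * complex_of_real 0 ^ k) = c 0"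
    by (simp add: power_0_left if_distrib[of "\<lambda>x. _ * x"] cong: if_cong)
  moreover have "((\<lambda>s. complex_of_real s ^ Suc l * \<phi> s) \<longlongrightarrow> complex_of_real 0 ^ Suc l * L) (at_right 0)"
    by (intro tendsto_intros lim)
  ultimately have "c 0 = 0"
    using tendsto_unique[OF trivial_limit_at_right_real] tendsto_cong[OF ev] by auto
  have "(\<Sum>k\<le>l. c (Suc k) * of_real s ^ k) = of_real s ^ l * \<phi> s" if s: "0 < s" "s < \<delta>" for s
  proof -
    have "of_real s * (\<Sum>k\<le>l. c (Suc k) * of_real s ^ k) = of_real s * (of_real s ^ l * \<phi> s)"
      using Suc.prems[OF s] \<open>c 0 = 0\<close>
      by (subst (asm) sum.atMost_Suc_shift) (simp add: sum_distrib_left mult_ac)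
    then show ?thesis using s by simp
  qed
  from Suc.IH[OF this] \<open>c 0 = 0\<close> show ?case
    by (auto simp: less_Suc_eq_0_disj)
qed

section \<open>Gaussian moments of eigenfunctions\<close>

lemma A2_D:
  assumes "F \<in> A2 \<nu> \<mu> l"
  shows "F \<in> L2" "\<And>k. C_diff k F" "continuous_on UNIV F"
    "\<And>z. Delta \<nu> \<mu> F z = of_real (- 2 * \<mu> * (2 * real l + real CARD('n))) * F (z :: complex ^ 'n)"
proof -
  show "F \<in> L2" "\<And>k. C_diff k F"
    using assms by (auto simp: A2_def C_infinity_def)
  from this(2)[of 0] show "continuous_on UNIV F" by simp
  show "Delta \<nu> \<mu> F z = of_real (- 2 * \<mu> * (2 * real l + real CARD('n))) * F z" for z
    using assms by (simp add: A2_def)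
qed

lemma continuous_j_factor_fst: "continuous_on UNIV (\<lambda>z. j_factor \<nu> \<mu> z w)"
  using C_diff_j_factor[of 0] by simp

lemma continuous_j_factor_snd: "continuous_on UNIV (\<lambda>w. j_factor \<nu> \<mu> z w)"
  unfolding cnj_j_factor[symmetric, of _ _ z] by (intro continuous_intros continuous_j_factor_fst)

lemma j_factor_mult_L2:
  assumes "F \<in> L2" shows "(\<lambda>w. j_factor \<nu> \<mu> z w * F w) \<in> L2"
proof (rule L2_mono[OF assms])
  show "(\<lambda>w. j_factor \<nu> \<mu> z w * F w) \<in> borel_measurable lebesgue"
    by (intro borel_measurable_times L2_D(1)[OF assms]
        continuous_imp_lebesgue_measurable continuous_j_factor_snd)
qed (simp add: norm_mult)

text \<open>The eigenvalue equation of \<open>F\<close> tested against a compactly supported function that is radial around \<open>z\<close>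
up to the phase.\<close>

lemma weak_radial_eigenequation:
  fixes F :: "complex ^ 'n \<Rightarrow> complex" and g g' g'' :: "real \<Rightarrow> real"
  assumes F: "F \<in> A2 \<nu> \<mu> l"
    and g: "\<And>t. (g has_real_derivative g' t) (at t)" and g': "\<And>t. (g' has_real_derivative g'' t) (at t)"
    and g'': "continuous_on UNIV g''" and supp: "\<And>t. t > T \<Longrightarrow> g t = 0"
  defines "t \<equiv> \<lambda>z w :: complex ^ 'n. (norm (w - z))\<^sup>2"
  shows "(\<integral>w. of_real (4 * t z w * g'' (t z w) + 4 * real CARD('n) * g' (t z w) - \<mu>\<^sup>2 * t z w * g (t z w))
            * (j_factor \<nu> \<mu> z w * F w) \<partial>lebesgue)
     = of_real (- 2 * \<mu> * (2 * real l + real CARD('n)))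
       * (\<integral>w. of_real (g (t z w)) * (j_factor \<nu> \<mu> z w * F w) \<partial>lebesgue)"
proof -
  let ?\<Psi> = "\<lambda>w. of_real (g ((norm (w - z))\<^sup>2)) * j_factor \<nu> \<mu> w z"
  let ?g = "\<lambda>i::nat. if i = 0 then g else if i = 1 then g' else g''"
  have "C_diff 2 (\<lambda>w. complex_of_real (?g 0 ((norm (w - z))\<^sup>2)))"
    by (rule C_diff_radial) (use g g' g'' in \<open>auto simp: less_2_cases_iff\<close>)
  then have \<Psi>: "C_diff (Suc (Suc 0)) ?\<Psi>"
    by (intro C_diff_mult C_diff_j_factor) (simp add: numeral_2_eq_2 del: C_diff.simps)
  have out: "?\<Psi> w = 0" if "norm w > norm z + \<bar>T\<bar> + 1" for w
  proof -
    have "norm (w - z) > \<bar>T\<bar> + 1" using that norm_triangle_sub[of w z] by linarith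
    then have "(norm (w - z))\<^sup>2 > norm (w - z) * 1"
      unfolding power2_eq_square by (intro mult_strict_left_mono) auto
    then have "(norm (w - z))\<^sup>2 > T" using \<open>norm (w - z) > \<bar>T\<bar> + 1\<close> by linarith
    then show ?thesis by (simp add: supp)
  qed
  have "(\<integral>w. cnj (?\<Psi> w) * Delta \<nu> \<mu> F w \<partial>lebesgue) = (\<integral>w. cnj (Delta \<nu> \<mu> ?\<Psi> w) * F w \<partial>lebesgue)"
    by (rule Delta_symmetric[OF \<Psi> A2_D(2)[OF F] out])
  moreover have "(\<integral>w. cnj (?\<Psi> w) * Delta \<nu> \<mu> F w \<partial>lebesgue)
      = of_real (- 2 * \<mu> * (2 * real l + real CARD('n)))
       * (\<integral>w. of_real (g (t z w)) * (j_factor \<nu> \<mu> z w * F w) \<partial>lebesgue)"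
  proof -
    have "cnj (?\<Psi> w) * Delta \<nu> \<mu> F w = of_real (- 2 * \<mu> * (2 * real l + real CARD('n)))
       * (of_real (g (t z w)) * (j_factor \<nu> \<mu> z w * F w))" for w
      unfolding A2_D(4)[OF F] complex_cnj_mult cnj_j_factor complex_cnj_complex_of_real t_def
      by (simp only: mult_ac)
    then show ?thesis by (simp only: integral_mult_right_zero)
  qed
  moreover have "cnj (Delta \<nu> \<mu> ?\<Psi> w) * F w =
     of_real (4 * t z w * g'' (t z w) + 4 * real CARD('n) * g' (t z w) - \<mu>\<^sup>2 * t z w * g (t z w))
            * (j_factor \<nu> \<mu> z w * F w)" for w
    unfolding Delta_radial[OF g g'] complex_cnj_mult cnj_j_factor complex_cnj_complex_of_real t_def
    by (simp only: mult.assoc)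
  ultimately show ?thesis by simp
qed

text \<open>Powers of the positive part supply cutoff functions of finite smoothness.\<close>

lemma max_power_has_derivative:
  "((\<lambda>x::real. max 0 x ^ Suc (Suc k)) has_real_derivative real (Suc (Suc k)) * max 0 x ^ Suc k) (at x)"
proof (cases x "0 :: real" rule: linorder_cases)
  case less
  have "((\<lambda>_. 0) has_real_derivative 0) (at x)" by simp
  then have "((\<lambda>x::real. max 0 x ^ Suc (Suc k)) has_real_derivative 0) (at x)"
    by (rule has_field_derivative_transform_within_open[of _ _ _ "{..<0}"]) (use less in auto)
  then show ?thesis using less by simp
next
  case greater
  have "((\<lambda>x. x ^ Suc (Suc k)) has_real_derivative real (Suc (Suc k)) * x ^ Suc k) (at x)"
    by (rule derivative_eq_intros refl)+ simp
  then have "((\<lambda>x::real. max 0 x ^ Suc (Suc k)) has_real_derivative real (Suc (Suc k)) * x ^ Suc k) (at x)"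
    by (rule has_field_derivative_transform_within_open[of _ _ _ "{0<..}"]) (use greater in auto)
  then show ?thesis using greater by simp
next
  case equal
  have "((\<lambda>h::real. max 0 h ^ Suc k) \<longlongrightarrow> max 0 0 ^ Suc k) (at 0)"
    by (intro tendsto_intros)
  then have "((\<lambda>h::real. max 0 h ^ Suc k) \<longlongrightarrow> 0) (at 0)" by simp
  moreover have "\<forall>\<^sub>F h::real in at 0. max 0 h ^ Suc k = (max 0 (0 + h) ^ Suc (Suc k) - max 0 0 ^ Suc (Suc k)) / h"
    by (auto simp: eventually_at_filter max_def)
  ultimately have "((\<lambda>h::real. (max 0 (0 + h) ^ Suc (Suc k) - max 0 0 ^ Suc (Suc k)) / h) \<longlongrightarrow> 0) (at 0)"
    by (rule Lim_transform_eventually)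
  then show ?thesis using equal by (simp add: DERIV_def)
qed

text \<open>The Gaussian profile satisfies \<open>4 t g'' + 4 n g' - \<mu>^2 t g = ((4 a^2 - \<mu>^2) t - 4 n a) g\<close>, so this is the
eigenvalue equation tested against a Gaussian. The Gaussian is not compactly supported; it is the limit
for \<open>r\<close> to 0 of its products with \<open>max 0 (1 - r t)^3\<close>, which are of class $C^2$ and whose derivatives
are dominated uniformly in \<open>r \<le> 1\<close>.\<close>

lemma gauss_moment_eigenequation:
  fixes F :: "complex ^ 'n \<Rightarrow> complex" and z :: "complex ^ 'n"
  assumes F: "F \<in> A2 \<nu> \<mu> l" and a: "a > 0"
  defines "h \<equiv> \<lambda>w. j_factor \<nu> \<mu> z w * F w"
  shows "of_real (4 * a\<^sup>2 - \<mu>\<^sup>2) * gauss_moment h z 1 a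
    = of_real (4 * real CARD('n) * a - 2 * \<mu> * (2 * real l + real CARD('n))) * gauss_moment h z 0 a"
proof -
  define t where "t w = (norm (w - z))\<^sup>2" for w
  let ?n = "real CARD('n)"
  let ?lam = "- 2 * \<mu> * (2 * real l + ?n)"
  have t0: "t w \<ge> 0" for w by (simp add: t_def)
  have h: "h \<in> L2" unfolding h_def by (rule j_factor_mult_L2[OF A2_D(1)[OF F]])
  define p where "p k r s = max 0 (1 - r * s) ^ k" for k :: nat and r s :: real
  define g0 where "g0 r s = exp (- a * s) * p 3 r s" for r s
  define g1 where "g1 r s = exp (- a * s) * (- a * p 3 r s - 3 * r * p 2 r s)" for r s
  define g2 where "g2 r s = exp (- a * s) * (a\<^sup>2 * p 3 r s + 6 * a * r * p 2 r s + 6 * r\<^sup>2 * p 1 r s)" for r s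
  have p_deriv: "(p (Suc (Suc k)) r has_real_derivative - r * (real (Suc (Suc k)) * p (Suc k) r s)) (at s)" for k r s
  proof -
    have "((\<lambda>s. 1 - r * s) has_real_derivative - r) (at s)"
      by (auto intro!: derivative_eq_intros)
    from DERIV_chain2[OF max_power_has_derivative this] show ?thesis
      unfolding p_def by (simp only: mult.commute)
  qed
  have p3: "(p 3 r has_real_derivative - 3 * r * p 2 r s) (at s)" for r s
    using p_deriv[of 1 r s] by (simp add: numeral_3_eq_3 numeral_2_eq_2 algebra_simps)
  have p2: "(p 2 r has_real_derivative - 2 * r * p 1 r s) (at s)" for r s
    using p_deriv[of 0 r s] by (simp add: numeral_2_eq_2 algebra_simps)
  have e: "((\<lambda>s. exp (- a * s)) has_real_derivative - a * exp (- a * s)) (at s)" for s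
    by (auto intro!: derivative_eq_intros)
  have d0: "(g0 r has_real_derivative g1 r s) (at s)" for r s
    unfolding g0_def[abs_def] g1_def
    by (rule DERIV_cong[OF DERIV_mult[OF e p3]]) (simp add: algebra_simps)
  have d1: "(g1 r has_real_derivative g2 r s) (at s)" for r s
    unfolding g1_def[abs_def] g2_def
    by (rule DERIV_cong[OF DERIV_mult[OF e DERIV_diff[OF DERIV_cmult[OF p3] DERIV_cmult[OF p2]]]])
      (simp add: algebra_simps power2_eq_square)
  define Q where "Q r s = 4 * s * g2 r s + 4 * ?n * g1 r s - \<mu>\<^sup>2 * s * g0 r s" for r s
  have weak: "(\<integral>w. of_real (Q r (t w)) * h w \<partial>lebesgue) = of_real ?lam * (\<integral>w. of_real (g0 r (t w)) * h w \<partial>lebesgue)"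
    if r: "r > 0" for r
    unfolding Q_def h_def t_def
  proof (rule weak_radial_eigenequation[OF F d0 d1])
    show "continuous_on UNIV (g2 r)"
      unfolding g2_def[abs_def] p_def by (intro continuous_intros)
    show "g0 r s = 0" if "s > 1 / r" for s
      using that r by (simp add: g0_def p_def max_def field_simps)
  qed
  define r where "r m = inverse (real (Suc m))" for m
  have r: "0 < r m" "r m \<le> 1" for m by (auto simp: r_def field_simps)
  have r_lim: "r \<longlonglongrightarrow> 0" unfolding r_def[abs_def] by (rule LIMSEQ_inverse_real_of_nat)
  have p01: "0 \<le> p k (r m) s" "p k (r m) s \<le> 1" if "s \<ge> 0" for k m s
    using that r(1)[of m] by (auto simp: p_def intro!: power_le_one)
  define C1 where "C1 = 4 * (a\<^sup>2 + 6 * a + 6) + \<mu>\<^sup>2"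
  define C2 where "C2 = 4 * ?n * (a + 3)"
  have Q_bound: "\<bar>Q (r m) s\<bar> \<le> C1 * (s * exp (- a * s)) + C2 * exp (- a * s)" if s: "s \<ge> 0" for m s
  proof -
    have rp: "0 \<le> r m * p 2 (r m) s" "r m * p 2 (r m) s \<le> 1" "0 \<le> (r m)\<^sup>2 * p 1 (r m) s" "(r m)\<^sup>2 * p 1 (r m) s \<le> 1"
      using r[of m] p01[OF s] by (auto intro!: mult_le_one power_le_one)
    define A where "A = a\<^sup>2 * p 3 (r m) s + 6 * a * (r m * p 2 (r m) s) + 6 * ((r m)\<^sup>2 * p 1 (r m) s)"
    define B where "B = a * p 3 (r m) s + 3 * (r m * p 2 (r m) s)"
    have "a\<^sup>2 * p 3 (r m) s \<le> a\<^sup>2 * 1" "a * p 3 (r m) s \<le> a * 1" "a * (r m * p 2 (r m) s) \<le> a * 1"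
      "0 \<le> a\<^sup>2 * p 3 (r m) s" "0 \<le> a * p 3 (r m) s" "0 \<le> a * (r m * p 2 (r m) s)"
      using rp p01[OF s] a by (auto intro!: mult_left_mono simp del: mult_1_right)
    then have AB: "0 \<le> A" "A \<le> a\<^sup>2 + 6 * a + 6" "0 \<le> B" "B \<le> a + 3"
      unfolding A_def B_def using rp by linarith+
    have "Q (r m) s = exp (- a * s) * (4 * s * A - 4 * ?n * B - \<mu>\<^sup>2 * s * p 3 (r m) s)"
      by (simp add: Q_def g0_def g1_def g2_def A_def B_def algebra_simps)
    then have "\<bar>Q (r m) s\<bar> = exp (- a * s) * \<bar>4 * s * A - 4 * ?n * B - \<mu>\<^sup>2 * s * p 3 (r m) s\<bar>"
      by (simp add: abs_mult)
    also have "\<dots> \<le> exp (- a * s) * (C1 * s + C2)"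
    proof (rule mult_left_mono)
      have "0 \<le> s * A" "s * A \<le> s * (a\<^sup>2 + 6 * a + 6)" "0 \<le> ?n * B" "?n * B \<le> ?n * (a + 3)"
        using AB s by (auto intro!: mult_left_mono mult_nonneg_nonneg)
      moreover have "0 \<le> \<mu>\<^sup>2 * s * p 3 (r m) s" "\<mu>\<^sup>2 * s * p 3 (r m) s \<le> \<mu>\<^sup>2 * s * 1"
        using p01[OF s] s by (auto intro!: mult_left_mono mult_nonneg_nonneg simp del: mult_1_right)
      moreover have "C1 * s + C2 = 4 * (s * (a\<^sup>2 + 6 * a + 6)) + \<mu>\<^sup>2 * s * 1 + 4 * (?n * (a + 3))"
        by (simp add: C1_def C2_def algebra_simps)
      ultimately show "\<bar>4 * s * A - 4 * ?n * B - \<mu>\<^sup>2 * s * p 3 (r m) s\<bar> \<le> C1 * s + C2"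
        by linarith
    qed simp
    finally show ?thesis by (simp add: algebra_simps)
  qed
  have meas: "(\<lambda>w. of_real (f (t w)) * h w) \<in> borel_measurable lebesgue" if "continuous_on UNIV f" for f
    unfolding t_def
    by (intro borel_measurable_times L2_D(1)[OF h] continuous_imp_lebesgue_measurable
        continuous_on_of_real continuous_on_compose2[OF that] continuous_intros) auto
  define Q0 where "Q0 s = (4 * a\<^sup>2 - \<mu>\<^sup>2) * (s * exp (- a * s)) - 4 * ?n * a * exp (- a * s)" for s
  have m0: "integrable lebesgue (\<lambda>w. of_real (exp (- a * t w)) * h w)"
    and m1: "integrable lebesgue (\<lambda>w. of_real (t w * exp (- a * t w)) * h w)"
    using gauss_moment_integrable[OF h a, of z 0] gauss_moment_integrable[OF h a, of z 1] by (simp_all add: t_def)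
  have n0: "integrable lebesgue (\<lambda>w. exp (- a * t w) * norm (h w))"
    and n1: "integrable lebesgue (\<lambda>w. t w * exp (- a * t w) * norm (h w))"
    using gauss_moment_norm_integrable[OF h a, of z 0] gauss_moment_norm_integrable[OF h a, of z 1] by (simp_all add: t_def)
  have "(\<lambda>m. \<integral>w. of_real (Q (r m) (t w)) * h w \<partial>lebesgue) \<longlonglongrightarrow> (\<integral>w. of_real (Q0 (t w)) * h w \<partial>lebesgue)"
  proof (rule integral_dominated_convergence[where
        w = "\<lambda>w. C1 * (t w * exp (- a * t w) * norm (h w)) + C2 * (exp (- a * t w) * norm (h w))"])
    show "(\<lambda>w. of_real (Q0 (t w)) * h w) \<in> borel_measurable lebesgue"
      by (rule meas) (unfold Q0_def, intro continuous_intros)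
    show "(\<lambda>w. of_real (Q (r m) (t w)) * h w) \<in> borel_measurable lebesgue" for m
      by (rule meas) (unfold Q_def g0_def g1_def g2_def p_def, intro continuous_intros)
    show "integrable lebesgue (\<lambda>w. C1 * (t w * exp (- a * t w) * norm (h w)) + C2 * (exp (- a * t w) * norm (h w)))"
      by (intro Bochner_Integration.integrable_add integrable_mult_right n0 n1)
    show "AE w in lebesgue. (\<lambda>m. of_real (Q (r m) (t w)) * h w) \<longlonglongrightarrow> of_real (Q0 (t w)) * h w"
    proof (rule AE_I2)
      fix w
      have "(\<lambda>m. Q (r m) (t w)) \<longlonglongrightarrow> Q 0 (t w)"
        unfolding Q_def g0_def g1_def g2_def p_def by (intro tendsto_intros r_lim)
      also have "Q 0 (t w) = Q0 (t w)"
        by (simp add: Q_def Q0_def g0_def g1_def g2_def p_def algebra_simps)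
      finally show "(\<lambda>m. of_real (Q (r m) (t w)) * h w) \<longlonglongrightarrow> of_real (Q0 (t w)) * h w"
        by (intro tendsto_intros)
    qed
    show "AE w in lebesgue. norm (of_real (Q (r m) (t w)) * h w)
       \<le> C1 * (t w * exp (- a * t w) * norm (h w)) + C2 * (exp (- a * t w) * norm (h w))" for m
    proof (rule AE_I2)
      fix w
      have "\<bar>Q (r m) (t w)\<bar> * norm (h w) \<le> (C1 * (t w * exp (- a * t w)) + C2 * exp (- a * t w)) * norm (h w)"
        by (intro mult_right_mono Q_bound t0) auto
      then show "norm (of_real (Q (r m) (t w)) * h w)
       \<le> C1 * (t w * exp (- a * t w) * norm (h w)) + C2 * (exp (- a * t w) * norm (h w))"
        by (simp add: norm_mult algebra_simps)
    qed
  qed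
  moreover have "(\<lambda>m. \<integral>w. of_real (g0 (r m) (t w)) * h w \<partial>lebesgue) \<longlonglongrightarrow> (\<integral>w. of_real (exp (- a * t w)) * h w \<partial>lebesgue)"
  proof (rule integral_dominated_convergence[where w = "\<lambda>w. exp (- a * t w) * norm (h w)"])
    show "(\<lambda>w. of_real (g0 (r m) (t w)) * h w) \<in> borel_measurable lebesgue" for m
      by (rule meas) (unfold g0_def p_def, intro continuous_intros)
    show "AE w in lebesgue. (\<lambda>m. of_real (g0 (r m) (t w)) * h w) \<longlonglongrightarrow> of_real (exp (- a * t w)) * h w"
    proof (rule AE_I2)
      fix w
      have "(\<lambda>m. g0 (r m) (t w)) \<longlonglongrightarrow> g0 0 (t w)"
        unfolding g0_def p_def by (intro tendsto_intros r_lim)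
      also have "g0 0 (t w) = exp (- a * t w)" by (simp add: g0_def p_def)
      finally show "(\<lambda>m. of_real (g0 (r m) (t w)) * h w) \<longlonglongrightarrow> of_real (exp (- a * t w)) * h w"
        by (intro tendsto_intros)
    qed
    show "AE w in lebesgue. norm (of_real (g0 (r m) (t w)) * h w) \<le> exp (- a * t w) * norm (h w)" for m
    proof (rule AE_I2)
      fix w
      have "\<bar>g0 (r m) (t w)\<bar> \<le> exp (- a * t w) * 1"
        unfolding g0_def abs_mult using p01[OF t0[of w], of 3 m] by (intro mult_mono) auto
      then have "\<bar>g0 (r m) (t w)\<bar> * norm (h w) \<le> exp (- a * t w) * norm (h w)"
        by (intro mult_right_mono) auto
      then show "norm (of_real (g0 (r m) (t w)) * h w) \<le> exp (- a * t w) * norm (h w)"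
        by (simp add: norm_mult)
    qed
  qed (use m0 n0 in auto)
  ultimately have "(\<integral>w. of_real (Q0 (t w)) * h w \<partial>lebesgue) = of_real ?lam * (\<integral>w. of_real (exp (- a * t w)) * h w \<partial>lebesgue)"
    unfolding weak[OF r(1)] using LIMSEQ_unique tendsto_mult_left by blast
  moreover have "(\<integral>w. of_real (Q0 (t w)) * h w \<partial>lebesgue) =
     of_real (4 * a\<^sup>2 - \<mu>\<^sup>2) * gauss_moment h z 1 a - of_real (4 * ?n * a) * gauss_moment h z 0 a"
  proof -
    have "(\<integral>w. of_real (Q0 (t w)) * h w \<partial>lebesgue) =
      (\<integral>w. of_real (4 * a\<^sup>2 - \<mu>\<^sup>2) * (of_real (t w * exp (- a * t w)) * h w)
         - of_real (4 * ?n * a) * (of_real (exp (- a * t w)) * h w) \<partial>lebesgue)"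
      by (rule Bochner_Integration.integral_cong) (auto simp: Q0_def algebra_simps)
    also have "\<dots> = of_real (4 * a\<^sup>2 - \<mu>\<^sup>2) * (\<integral>w. of_real (t w * exp (- a * t w)) * h w \<partial>lebesgue)
        - of_real (4 * ?n * a) * (\<integral>w. of_real (exp (- a * t w)) * h w \<partial>lebesgue)"
      by (subst Bochner_Integration.integral_diff[OF integrable_mult_right[OF m1] integrable_mult_right[OF m0]])
        (simp only: integral_mult_right_zero)
    finally show ?thesis by (simp add: gauss_moment_def t_def)
  qed
  moreover have "gauss_moment h z 0 a = (\<integral>w. of_real (exp (- a * t w)) * h w \<partial>lebesgue)"
    by (simp add: gauss_moment_def t_def)
  ultimately have "of_real (4 * a\<^sup>2 - \<mu>\<^sup>2) * gauss_moment h z 1 a - of_real (4 * ?n * a) * gauss_moment h z 0 a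
      = of_real ?lam * gauss_moment h z 0 a"
    by metis
  then have "of_real (4 * a\<^sup>2 - \<mu>\<^sup>2) * gauss_moment h z 1 a = of_real (4 * ?n * a + ?lam) * gauss_moment h z 0 a"
    unfolding of_real_add distrib_right by (simp only: diff_eq_eq add.commute)
  then show ?thesis by simp
qed

lemma shifted_power_derivative:
  assumes "a + c \<noteq> (0::real)"
  shows "((\<lambda>a. (a + c) ^ k) has_real_derivative real k * (a + c) ^ k / (a + c)) (at a)"
proof -
  have "((\<lambda>a. (a + c) ^ k) has_real_derivative real k * (a + c) ^ (k - 1)) (at a)"
    by (auto intro!: derivative_eq_intros)
  moreover have "real k * (a + c) ^ (k - 1) = real k * (a + c) ^ k / (a + c)"
    using assms by (cases k) auto
  ultimately show ?thesis by simp
qed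

text \<open>Since \<open>gauss_moment h z 1\<close> is minus the derivative of \<open>gauss_moment h z 0\<close>, \<open>gauss_moment_eigenequation\<close> is
a linear differential equation. It determines \<open>gauss_moment h z 0\<close> up to a constant factor, which the
limit \<open>a \<rightarrow> \<infinity>\<close> identifies.\<close>

lemma gauss_moment_0_eq:
  fixes F :: "complex ^ 'n \<Rightarrow> complex" and z :: "complex ^ 'n"
  assumes F: "F \<in> A2 \<nu> \<mu> l" and \<mu>: "\<mu> > 0" and a: "a > \<mu> / 2"
  defines "h \<equiv> \<lambda>w. j_factor \<nu> \<mu> z w * F w"
  shows "gauss_moment h z 0 a
    = of_real (pi ^ CARD('n) * (a - \<mu> / 2) ^ l / (a + \<mu> / 2) ^ (l + CARD('n))) * F z"
proof -
  define c where "c = \<mu> / 2"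
  have c: "c > 0" using \<mu> by (simp add: c_def)
  let ?n = "CARD('n)"
  have h: "h \<in> L2" unfolding h_def by (rule j_factor_mult_L2[OF A2_D(1)[OF F]])
  \<comment> \<open>The inverse of the expected solution is an integrating factor.\<close>
  define \<phi> where "\<phi> a = (a + c) ^ (l + ?n) / (a - c) ^ l" for a
  define f where "f a = of_real (\<phi> a) * gauss_moment h z 0 a" for a
  have \<phi>_deriv: "(\<phi> has_real_derivative \<phi> a * (real (l + ?n) / (a + c) - real l / (a - c))) (at a)"
    if "a > c" for a
  proof -
    have ne: "a + c \<noteq> 0" "a - c \<noteq> 0" using that c by auto
    have dl: "((\<lambda>a. (a - c) ^ l) has_real_derivative real l * (a - c) ^ l / (a - c)) (at a)"
      using shifted_power_derivative[of a "- c" l] ne by simp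
    have "(\<phi> has_real_derivative (real (l + ?n) * (a + c) ^ (l + ?n) / (a + c) * (a - c) ^ l -
        (a + c) ^ (l + ?n) * (real l * (a - c) ^ l / (a - c))) / ((a - c) ^ l * (a - c) ^ l)) (at a)"
      unfolding \<phi>_def[abs_def]
      by (rule DERIV_divide[OF shifted_power_derivative[OF ne(1)] dl]) (use ne in simp)
    moreover have "(N * X / P * Y - X * (M * Y / Q)) / (Y * Y) = X / Y * (N / P - M / Q)"
      if "Y \<noteq> 0" for X Y N M P Q :: real
    proof -
      have "N * X / P * Y - X * (M * Y / Q) = (X * (N / P - M / Q)) * Y" by (simp add: algebra_simps)
      then show ?thesis using that by simp
    qed
    ultimately show ?thesis using ne unfolding \<phi>_def by simp
  qed
  have f_deriv: "(f has_vector_derivative 0) (at a)" if a: "a > c" for a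
  proof -
    have a0: "a > 0" using a c by simp
    have ne: "a + c \<noteq> 0" "a - c \<noteq> 0" using a c by auto
    define \<kappa> where "\<kappa> = real (l + ?n) / (a + c) - real l / (a - c)"
    have "4 * a\<^sup>2 - \<mu>\<^sup>2 = 4 * (a + c) * (a - c)" by (simp add: c_def algebra_simps power2_eq_square)
    moreover have "4 * real ?n * a - 2 * \<mu> * (2 * real l + real ?n) = 4 * (a + c) * (a - c) * \<kappa>"
    proof -
      have "4 * P * Q * (N / P - M / Q) = 4 * (N * Q - M * P)" if "P \<noteq> 0" "Q \<noteq> 0" for P Q N M :: real
        using that by (simp add: right_diff_distrib)
      then have "4 * (a + c) * (a - c) * \<kappa> = 4 * (real (l + ?n) * (a - c) - real l * (a + c))"
        unfolding \<kappa>_def using ne by blast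
      then show ?thesis by (simp add: c_def algebra_simps)
    qed
    ultimately have "of_real (4 * (a + c) * (a - c)) * gauss_moment h z 1 a =
        of_real (4 * (a + c) * (a - c)) * (of_real \<kappa> * gauss_moment h z 0 a)"
      using gauss_moment_eigenequation[OF F a0, of z, folded h_def] by (simp add: mult.assoc)
    then have M1: "gauss_moment h z 1 a = of_real \<kappa> * gauss_moment h z 0 a"
      using ne by (simp add: of_real_eq_0_iff del: of_real_add of_real_diff of_real_mult)
    have "((\<lambda>a. complex_of_real (\<phi> a)) has_vector_derivative of_real (\<phi> a * \<kappa>)) (at a)"
      using \<phi>_deriv[OF a] unfolding \<kappa>_def
      by (intro has_vector_derivative_of_real) (simp add: has_real_derivative_iff_has_vector_derivative)
    from has_vector_derivative_mult[OF this gauss_moment_derivative[OF h a0, of z 0]]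
    show ?thesis
      unfolding f_def[abs_def] using M1 by (simp add: mult_ac)
  qed
  obtain L where L: "\<And>a. a > c \<Longrightarrow> f a = L"
  proof -
    have "\<exists>L. \<forall>a\<in>{c<..}. f a = L"
      by (rule has_vector_derivative_zero_constant[of "{c<..}" f])
        (auto intro: has_vector_derivative_at_within f_deriv)
    then show ?thesis using that by auto
  qed
  have "isCont h z"
  proof -
    have "continuous_on UNIV h"
      unfolding h_def by (intro continuous_intros continuous_j_factor_snd A2_D(3)[OF F])
    then show ?thesis by (simp add: continuous_on_eq_continuous_at)
  qed
  have lim: "((\<lambda>a. of_real (sqrt a ^ (2 * ?n)) * gauss_moment h z 0 a) \<longlongrightarrow> of_real (sqrt pi ^ (2 * ?n)) * h z) at_top"
    using gaussian_approximate_identity[OF h \<open>isCont h z\<close>] by (simp add: mult.commute)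
  have inv: "((\<lambda>a. c * inverse a) \<longlongrightarrow> 0) at_top"
    by (intro tendsto_mult_right_zero tendsto_inverse_0_at_top filterlim_ident)
  have "((\<lambda>a. (1 + c * inverse a) ^ ?n * ((1 + c * inverse a) / (1 - c * inverse a)) ^ l) \<longlongrightarrow>
      (1 + 0) ^ ?n * ((1 + 0) / (1 - 0)) ^ l) at_top"
    by (intro tendsto_intros inv) simp
  then have quot: "((\<lambda>a. (1 + c * inverse a) ^ ?n * ((1 + c * inverse a) / (1 - c * inverse a)) ^ l) \<longlongrightarrow> 1) at_top"
    by simp
  have "\<forall>\<^sub>F a in at_top. (1 + c * inverse a) ^ ?n * ((1 + c * inverse a) / (1 - c * inverse a)) ^ l = \<phi> a / a ^ ?n"
    using eventually_gt_at_top[of c]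
  proof eventually_elim
    case (elim a)
    then have a0: "a > 0" using c by simp
    have e: "1 + c * inverse a = (a + c) / a" "1 - c * inverse a = (a - c) / a"
      using a0 by (simp_all add: field_simps)
    then show ?case using a0 elim unfolding e \<phi>_def power_divide power_add by (simp add: mult.commute)
  qed
  then have quot': "((\<lambda>a. \<phi> a / a ^ ?n) \<longlongrightarrow> 1) at_top"
    by (rule Lim_transform_eventually[OF quot])
  have "((\<lambda>a. complex_of_real (\<phi> a / a ^ ?n) * (of_real (sqrt a ^ (2 * ?n)) * gauss_moment h z 0 a))
      \<longlongrightarrow> of_real 1 * (of_real (sqrt pi ^ (2 * ?n)) * h z)) at_top"
    by (intro tendsto_mult tendsto_of_real quot' lim)
  moreover have "\<forall>\<^sub>F a in at_top. complex_of_real (\<phi> a / a ^ ?n) * (of_real (sqrt a ^ (2 * ?n)) * gauss_moment h z 0 a) = L"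
    using eventually_gt_at_top[of c]
  proof eventually_elim
    case (elim a)
    then have a0: "a > 0" using c by simp
    have "\<phi> a / a ^ ?n * sqrt a ^ (2 * ?n) = \<phi> a" using a0 by (simp add: power_mult)
    then have "complex_of_real (\<phi> a / a ^ ?n) * of_real (sqrt a ^ (2 * ?n)) = of_real (\<phi> a)"
      by (metis of_real_mult)
    then show ?case using L[OF elim] unfolding f_def by (metis mult.assoc)
  qed
  ultimately have "((\<lambda>_::real. L) \<longlongrightarrow> of_real 1 * (of_real (sqrt pi ^ (2 * ?n)) * h z)) at_top"
    by (rule Lim_transform_eventually)
  then have "L = of_real (sqrt pi ^ (2 * ?n)) * h z"
    using tendsto_unique[OF trivial_limit_at_top_linorder tendsto_const] by fastforce
  then have L_eq: "L = of_real (pi ^ ?n) * F z"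
    by (simp add: h_def j_factor_self power_mult flip: of_real_power)
  have ac: "a > c" using a by (simp add: c_def)
  have pos: "a - c > 0" "a + c > 0" using ac c by auto
  have "gauss_moment h z 0 a = of_real ((a - c) ^ l / (a + c) ^ (l + ?n) * \<phi> a) * gauss_moment h z 0 a"
    using pos by (simp add: \<phi>_def)
  also have "\<dots> = of_real ((a - c) ^ l / (a + c) ^ (l + ?n)) * f a"
    unfolding f_def by (simp only: of_real_mult mult.assoc)
  also have "\<dots> = of_real (pi ^ ?n * (a - c) ^ l / (a + c) ^ (l + ?n)) * F z"
    unfolding L[OF ac] L_eq by simp
  finally show ?thesis by (simp add: c_def)
qed

text \<open>The Taylor expansion of \<open>exp (- s t)\<close> integrated term by term. Its remainder grows at most like
\<open>exp (s t)\<close>, which half of the Gaussian \<open>exp (- c t)\<close> absorbs when \<open>s < c / 2\<close>.\<close>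

lemma gauss_moment_taylor:
  fixes h :: "'a::euclidean_space \<Rightarrow> complex"
  assumes h: "h \<in> L2" and c: "c > 0"
  shows "\<exists>K. \<forall>s. 0 < s \<and> s < c / 2 \<longrightarrow>
    norm (gauss_moment h z 0 (c + s) - (\<Sum>k\<le>l. of_real ((- s) ^ k / fact k) * gauss_moment h z k c)) \<le> s ^ Suc l * K"
proof (intro exI allI impI)
  fix s :: real assume s: "0 < s \<and> s < c / 2"
  define t where "t w = (norm (w - z))\<^sup>2" for w
  have t0: "t w \<ge> 0" for w by (simp add: t_def)
  have int: "integrable lebesgue (\<lambda>w. of_real (t w ^ k * exp (- a * t w)) * h w)" if "a > 0" for a k
    unfolding t_def by (rule gauss_moment_integrable[OF h that])
  define R where "R x = exp (- (c + s) * x) - (\<Sum>k\<le>l. (- s) ^ k / fact k * (x ^ k * exp (- c * x)))" for x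
  have R_bound: "\<bar>R x\<bar> \<le> s ^ Suc l * (x ^ Suc l * exp (- (c / 2) * x))" if x: "x \<ge> 0" for x
  proof -
    obtain y where y: "\<bar>y\<bar> \<le> \<bar>- s * x\<bar>"
      "exp (- s * x) = (\<Sum>m<Suc l. (- s * x) ^ m / fact m) + exp y / fact (Suc l) * (- s * x) ^ Suc l"
      using Maclaurin_exp_le[of "- s * x" "Suc l"] by blast
    have "R x = exp (- c * x) * (exp (- s * x) - (\<Sum>m<Suc l. (- s * x) ^ m / fact m))"
      unfolding R_def right_diff_distrib sum_distrib_left lessThan_Suc_atMost power_mult_distrib
      by (simp add: exp_add[symmetric] algebra_simps)
    also have "\<dots> = exp (- c * x) * (exp y / fact (Suc l) * (- s * x) ^ Suc l)"
      using y(2) by simp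
    finally have "\<bar>R x\<bar> = exp (- c * x) * (exp y / fact (Suc l) * (s * x) ^ Suc l)"
      using s x by (simp add: abs_mult power_abs del: power_Suc fact_Suc)
    also have "\<dots> \<le> exp (- c * x) * (exp (c / 2 * x) / 1 * (s * x) ^ Suc l)"
    proof (intro mult_left_mono mult_right_mono frac_le)
      have "s * x \<le> c / 2 * x" using s x by (intro mult_right_mono) auto
      then show "exp y \<le> exp (c / 2 * x)" using y(1) s x by (auto simp: abs_mult)
    qed (use s x in \<open>auto simp: fact_ge_1 simp del: fact_Suc\<close>)
    also have "\<dots> = (exp (- c * x) * exp (c / 2 * x)) * (s ^ Suc l * x ^ Suc l)"
      by (simp only: power_mult_distrib div_by_1 mult.assoc)
    also have "exp (- c * x) * exp (c / 2 * x) = exp (- (c / 2) * x)"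
      by (simp add: exp_add[symmetric])
    finally show ?thesis by (simp only: mult_ac)
  qed
  have "gauss_moment h z 0 (c + s) - (\<Sum>k\<le>l. of_real ((- s) ^ k / fact k) * gauss_moment h z k c)
     = (\<integral>w. of_real (R (t w)) * h w \<partial>lebesgue)"
  proof -
    have "of_real (R (t w)) * h w = of_real (t w ^ 0 * exp (- (c + s) * t w)) * h w
        - (\<Sum>k\<le>l. of_real ((- s) ^ k / fact k) * (of_real (t w ^ k * exp (- c * t w)) * h w))" for w
      by (simp add: R_def left_diff_distrib sum_distrib_right mult.assoc)
    then have "(\<integral>w. of_real (R (t w)) * h w \<partial>lebesgue) =
       (\<integral>w. of_real (t w ^ 0 * exp (- (c + s) * t w)) * h w
        - (\<Sum>k\<le>l. of_real ((- s) ^ k / fact k) * (of_real (t w ^ k * exp (- c * t w)) * h w)) \<partial>lebesgue)"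
      by simp
    also have "\<dots> = (\<integral>w. of_real (t w ^ 0 * exp (- (c + s) * t w)) * h w \<partial>lebesgue)
        - (\<integral>w. (\<Sum>k\<le>l. of_real ((- s) ^ k / fact k) * (of_real (t w ^ k * exp (- c * t w)) * h w)) \<partial>lebesgue)"
      by (intro Bochner_Integration.integral_diff Bochner_Integration.integrable_sum integrable_mult_right int)
        (use c s in auto)
    also have "(\<integral>w. (\<Sum>k\<le>l. of_real ((- s) ^ k / fact k) * (of_real (t w ^ k * exp (- c * t w)) * h w)) \<partial>lebesgue)
       = (\<Sum>k\<le>l. (\<integral>w. of_real ((- s) ^ k / fact k) * (of_real (t w ^ k * exp (- c * t w)) * h w) \<partial>lebesgue))"
      by (intro Bochner_Integration.integral_sum integrable_mult_right int c)
    also have "\<dots> = (\<Sum>k\<le>l. of_real ((- s) ^ k / fact k) * (\<integral>w. of_real (t w ^ k * exp (- c * t w)) * h w \<partial>lebesgue))"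
      by (simp only: integral_mult_right_zero)
    finally show ?thesis by (simp only: gauss_moment_def t_def)
  qed
  also have "norm \<dots> \<le> (\<integral>w. s ^ Suc l * (t w ^ Suc l * exp (- (c / 2) * t w) * norm (h w)) \<partial>lebesgue)"
  proof (rule order_trans[OF integral_norm_bound integral_mono_AE'])
    show "integrable lebesgue (\<lambda>w. s ^ Suc l * (t w ^ Suc l * exp (- (c / 2) * t w) * norm (h w)))"
      unfolding t_def by (intro integrable_mult_right gauss_moment_norm_integrable[OF h]) (use c in simp)
    show "AE w in lebesgue. norm (of_real (R (t w)) * h w) \<le> s ^ Suc l * (t w ^ Suc l * exp (- (c / 2) * t w) * norm (h w))"
    proof (rule AE_I2)
      fix w
      show "norm (of_real (R (t w)) * h w) \<le> s ^ Suc l * (t w ^ Suc l * exp (- (c / 2) * t w) * norm (h w))"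
        using mult_right_mono[OF R_bound[OF t0[of w]] norm_ge_zero[of "h w"]] by (simp add: norm_mult mult.assoc)
    qed
    show "AE w in lebesgue. 0 \<le> s ^ Suc l * (t w ^ Suc l * exp (- (c / 2) * t w) * norm (h w))"
      using s t0 by (intro AE_I2 mult_nonneg_nonneg zero_le_power) auto
  qed
  also have "\<dots> = s ^ Suc l * (\<integral>w. (t w ^ Suc l * exp (- (c / 2) * t w) * norm (h w)) \<partial>lebesgue)"
    by (rule integral_mult_right_zero)
  finally show "norm (gauss_moment h z 0 (c + s) - (\<Sum>k\<le>l. of_real ((- s) ^ k / fact k) * gauss_moment h z k c))
     \<le> s ^ Suc l * (\<integral>w. (((norm (w - z))\<^sup>2) ^ Suc l * exp (- (c / 2) * (norm (w - z))\<^sup>2) * norm (h w)) \<partial>lebesgue)"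
    unfolding t_def .
qed

text \<open>At \<open>a = \<mu> / 2\<close> the closed form of \<open>gauss_moment h z 0\<close> has a zero of order \<open>l\<close>. The moments at this
point are, up to sign and factorials, its Taylor coefficients there, taken from the right.\<close>

lemma gauss_moment_critical:
  fixes F :: "complex ^ 'n \<Rightarrow> complex" and z :: "complex ^ 'n"
  assumes F: "F \<in> A2 \<nu> \<mu> l" and \<mu>: "\<mu> > 0"
  defines "h \<equiv> \<lambda>w. j_factor \<nu> \<mu> z w * F w"
  shows "k < l \<Longrightarrow> gauss_moment h z k (\<mu> / 2) = 0"
    and "gauss_moment h z l (\<mu> / 2) = of_real ((- 1) ^ l * fact l * pi ^ CARD('n) / \<mu> ^ (l + CARD('n))) * F z"
proof -
  let ?n = "CARD('n)"
  define c where "c = \<mu> / 2"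
  have c: "c > 0" using \<mu> by (simp add: c_def)
  have h: "h \<in> L2" unfolding h_def by (rule j_factor_mult_L2[OF A2_D(1)[OF F]])
  obtain K where K: "\<And>s. 0 < s \<Longrightarrow> s < c / 2 \<Longrightarrow>
    norm (gauss_moment h z 0 (c + s) - (\<Sum>k\<le>l. of_real ((- s) ^ k / fact k) * gauss_moment h z k c)) \<le> s ^ Suc l * K"
    using gauss_moment_taylor[OF h c, of z l] by blast
  define b where "b k = of_real ((- 1) ^ k / fact k) * gauss_moment h z k c" for k
  define \<phi> where "\<phi> s = (\<Sum>k\<le>l. b k * of_real s ^ k) / of_real s ^ l" for s
  have b: "(\<Sum>k\<le>l. of_real ((- s) ^ k / fact k) * gauss_moment h z k c) = (\<Sum>k\<le>l. b k * of_real s ^ k)" for s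
    unfolding b_def by (rule sum.cong) (auto simp: power_minus[of s])
  define E where "E s = complex_of_real (pi ^ ?n / (s + \<mu>) ^ (l + ?n)) * F z" for s
  have "((\<lambda>s. \<phi> s - E s) \<longlongrightarrow> 0) (at_right 0)"
  proof (rule Lim_null_comparison)
    have "((\<lambda>s. s * K) \<longlongrightarrow> 0 * K) (at_right 0)" by (intro tendsto_intros)
    then show "((\<lambda>s. s * K) \<longlongrightarrow> 0) (at_right 0)" by simp
    have "norm (\<phi> s - E s) \<le> s * K" if s: "0 < s" "s < c / 2" for s
    proof -
      have "gauss_moment h z 0 (c + s) = of_real (s ^ l) * E s"
        unfolding E_def h_def c_def by (subst gauss_moment_0_eq[OF F \<mu>]) (use s in \<open>auto simp: add.commute\<close>)
      then have "norm (of_real (s ^ l) * E s - (\<Sum>k\<le>l. b k * of_real s ^ k)) \<le> s ^ Suc l * K"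
        using K[OF s] b by simp
      moreover have "of_real (s ^ l) * E s - (\<Sum>k\<le>l. b k * of_real s ^ k) = - (of_real (s ^ l) * (\<phi> s - E s))"
        unfolding \<phi>_def using s by (simp add: right_diff_distrib)
      ultimately have "s ^ l * norm (\<phi> s - E s) \<le> s ^ l * (s * K)"
        using s by (simp add: norm_mult norm_power mult_ac)
      then show ?thesis using s by simp
    qed
    then show "\<forall>\<^sub>F s in at_right 0. norm (\<phi> s - E s) \<le> s * K"
      using c by (auto simp: eventually_at_right_field intro!: exI[of _ "c / 2"])
  qed
  moreover have "(E \<longlongrightarrow> complex_of_real (pi ^ ?n / (0 + \<mu>) ^ (l + ?n)) * F z) (at_right 0)"
    unfolding E_def by (intro tendsto_intros) (use \<mu> in auto)
  ultimately have lim: "(\<phi> \<longlongrightarrow> of_real (pi ^ ?n / \<mu> ^ (l + ?n)) * F z) (at_right 0)"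
    using tendsto_add[of "\<lambda>s. \<phi> s - E s" 0 _ E] by simp
  have "(\<forall>k<l. b k = 0) \<and> b l = of_real (pi ^ ?n / \<mu> ^ (l + ?n)) * F z"
    by (rule polynomial_eq_power_times_limit[OF _ zero_less_one lim]) (simp add: \<phi>_def)
  then show "k < l \<Longrightarrow> gauss_moment h z k (\<mu> / 2) = 0"
    and "gauss_moment h z l (\<mu> / 2) = of_real ((- 1) ^ l * fact l * pi ^ ?n / \<mu> ^ (l + ?n)) * F z"
  proof -
    assume *: "(\<forall>k<l. b k = 0) \<and> b l = of_real (pi ^ ?n / \<mu> ^ (l + ?n)) * F z"
    show "k < l \<Longrightarrow> gauss_moment h z k (\<mu> / 2) = 0" using * by (auto simp: b_def c_def)
    have "gauss_moment h z l c = of_real ((- 1) ^ l * fact l) * b l"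
      by (simp add: b_def power_mult_distrib[symmetric])
    then show "gauss_moment h z l (\<mu> / 2) = of_real ((- 1) ^ l * fact l * pi ^ ?n / \<mu> ^ (l + ?n)) * F z"
      using * by (simp add: c_def)
  qed
qed

section \<open>The kernel and its reproducing property\<close>

text \<open>The kernel without its phase, as a function of the squared distance \<open>t\<close>, in complex dimension \<open>n\<close>.\<close>

definition landau_profile :: "real \<Rightarrow> nat \<Rightarrow> nat \<Rightarrow> real \<Rightarrow> real" where
  "landau_profile \<mu> n l t = (\<mu> / pi) ^ n * (fact (n - 1 + l) / (fact (n - 1) * fact l))
     * exp (- (\<mu> / 2) * t) * hyp_1F1 (- real l) (real n) (\<mu> * t)"

definition landau_kernel :: "real \<Rightarrow> real \<Rightarrow> nat \<Rightarrow> complex ^ 'n \<Rightarrow> complex ^ 'n \<Rightarrow> complex" where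
  "landau_kernel \<nu> \<mu> l z w = of_real (landau_profile \<mu> CARD('n) l ((norm (z - w))\<^sup>2)) * j_factor \<nu> \<mu> z w"

definition kummer_coeff :: "nat \<Rightarrow> nat \<Rightarrow> nat \<Rightarrow> real" where
  "kummer_coeff n l k = pochhammer (- real l) k / pochhammer (real n) k / fact k"

lemma hyp_1F1_polynomial: "hyp_1F1 (- real l) (real n) x = (\<Sum>k\<le>l. kummer_coeff n l k * x ^ k)"
proof -
  have "hyp_1F1 (- real l) (real n) x = (\<Sum>k\<le>l. pochhammer (- real l) k / pochhammer (real n) k * x ^ k / fact k)"
    unfolding hyp_1F1_def by (rule suminf_finite) (auto simp: pochhammer_of_nat_eq_0_iff)
  then show ?thesis by (simp add: kummer_coeff_def)
qed

lemma pochhammer_fact_quotient: "n \<ge> 1 \<Longrightarrow> pochhammer (real n) l * fact (n - 1) = fact (n - 1 + l)"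
proof (induction l)
  case (Suc l)
  have "fact (n - 1 + Suc l) = (real n + real l) * fact (n - 1 + l)"
    using Suc.prems by (cases n) (auto simp: algebra_simps)
  then show ?case using Suc by (simp add: pochhammer_Suc)
qed simp

lemma kummer_leading_coeff:
  assumes "n \<ge> 1"
  shows "fact (n - 1 + l) / (fact (n - 1) * fact l) * kummer_coeff n l l = (- 1) ^ l / fact l"
proof -
  have "pochhammer (real n) l \<noteq> 0" using assms by (simp add: pochhammer_eq_0_iff)
  moreover have "fact (n - 1 + l) = pochhammer (real n) l * fact (n - 1)"
    using pochhammer_fact_quotient[OF assms] by simp
  ultimately show ?thesis by (simp add: kummer_coeff_def pochhammer_same)
qed

text \<open>Expanding the hypergeometric polynomial writes the integral as a combination of the moments of order
at most \<open>l\<close> at \<open>\<mu> / 2\<close>, of which only the last one survives.\<close>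

lemma landau_kernel_reproducing:
  fixes F :: "complex ^ 'n \<Rightarrow> complex"
  assumes F: "F \<in> A2 \<nu> \<mu> l" and \<mu>: "\<mu> > 0"
  shows "(\<integral>w. landau_kernel \<nu> \<mu> l z w * F w \<partial>lebesgue) = F z"
proof -
  let ?n = "CARD('n)"
  define h where "h w = j_factor \<nu> \<mu> z w * F w" for w
  have h: "h \<in> L2" unfolding h_def by (rule j_factor_mult_L2[OF A2_D(1)[OF F]])
  define C :: real where "C = (\<mu> / pi) ^ ?n * (fact (?n - 1 + l) / (fact (?n - 1) * fact l))"
  have c: "\<mu> / 2 > 0" using \<mu> by simp
  have "landau_kernel \<nu> \<mu> l z w * F w = (\<Sum>k\<le>l. of_real (C * kummer_coeff ?n l k * \<mu> ^ k)
      * (of_real (((norm (w - z))\<^sup>2) ^ k * exp (- (\<mu> / 2) * (norm (w - z))\<^sup>2)) * h w))" for w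
  proof -
    have "landau_profile \<mu> ?n l ((norm (z - w))\<^sup>2) = (\<Sum>k\<le>l. C * kummer_coeff ?n l k * \<mu> ^ k
       * (((norm (w - z))\<^sup>2) ^ k * exp (- (\<mu> / 2) * (norm (w - z))\<^sup>2)))"
      unfolding landau_profile_def hyp_1F1_polynomial C_def[symmetric] norm_minus_commute[of z w] sum_distrib_left
      by (rule sum.cong) (simp_all add: power_mult_distrib mult_ac)
    then show ?thesis
      unfolding landau_kernel_def h_def
      by (simp add: sum_distrib_right mult.assoc del: of_real_power)
  qed
  then have "(\<integral>w. landau_kernel \<nu> \<mu> l z w * F w \<partial>lebesgue)
    = (\<integral>w. (\<Sum>k\<le>l. of_real (C * kummer_coeff ?n l k * \<mu> ^ k)
      * (of_real (((norm (w - z))\<^sup>2) ^ k * exp (- (\<mu> / 2) * (norm (w - z))\<^sup>2)) * h w)) \<partial>lebesgue)"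
    by (simp only:)
  also have "\<dots> = (\<Sum>k\<le>l. (\<integral>w. of_real (C * kummer_coeff ?n l k * \<mu> ^ k)
      * (of_real (((norm (w - z))\<^sup>2) ^ k * exp (- (\<mu> / 2) * (norm (w - z))\<^sup>2)) * h w) \<partial>lebesgue))"
    by (intro Bochner_Integration.integral_sum integrable_mult_right gauss_moment_integrable[OF h c])
  also have "\<dots> = (\<Sum>k\<le>l. of_real (C * kummer_coeff ?n l k * \<mu> ^ k) * gauss_moment h z k (\<mu> / 2))"
    unfolding gauss_moment_def by (simp only: integral_mult_right_zero)
  also have "\<dots> = (\<Sum>k\<in>{l}. of_real (C * kummer_coeff ?n l k * \<mu> ^ k) * gauss_moment h z k (\<mu> / 2))"
    by (rule sum.mono_neutral_right)
      (use gauss_moment_critical(1)[OF F \<mu>, of _ z] in \<open>auto simp: h_def[abs_def]\<close>)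
  also have "\<dots> = of_real (C * kummer_coeff ?n l l * \<mu> ^ l * ((- 1) ^ l * fact l * pi ^ ?n / \<mu> ^ (l + ?n))) * F z"
    using gauss_moment_critical(2)[OF F \<mu>, of z] by (simp add: h_def[abs_def])
  also have "C * kummer_coeff ?n l l * \<mu> ^ l * ((- 1) ^ l * fact l * pi ^ ?n / \<mu> ^ (l + ?n)) = 1"
  proof -
    have "C * kummer_coeff ?n l l = (\<mu> / pi) ^ ?n * ((- 1) ^ l / fact l)"
      unfolding C_def mult.assoc using kummer_leading_coeff[of ?n l] by (simp only: Suc_leI zero_less_card_finite One_nat_def)
    then have "C * kummer_coeff ?n l l * \<mu> ^ l * ((- 1) ^ l * fact l * pi ^ ?n / \<mu> ^ (l + ?n))
      = (\<mu> / pi) ^ ?n * ((- 1) ^ l / fact l) * \<mu> ^ l * ((- 1) ^ l * fact l * pi ^ ?n / \<mu> ^ (l + ?n))" by simp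
    also have "\<dots> = ((- 1) ^ l * (- 1) ^ l)"
      using \<mu> by (simp add: power_divide power_add)
    also have "\<dots> = 1" by (simp flip: power_mult_distrib)
    finally show ?thesis .
  qed
  finally show ?thesis by simp
qed

section \<open>The kernel as an eigenfunction\<close>

definition kummer_poly :: "nat \<Rightarrow> nat \<Rightarrow> real poly" where
  "kummer_poly n l = (\<Sum>k\<le>l. monom (kummer_coeff n l k) k)"

lemma coeff_kummer_poly: "coeff (kummer_poly n l) k = kummer_coeff n l k"
proof -
  have "kummer_coeff n l k = 0" if "k > l"
    using that by (simp add: kummer_coeff_def pochhammer_of_nat_eq_0_iff)
  then show ?thesis
    by (auto simp: kummer_poly_def coeff_sum not_le)
qed

lemma poly_kummer_poly: "poly (kummer_poly n l) x = hyp_1F1 (- real l) (real n) x"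
  by (simp add: kummer_poly_def poly_sum poly_monom hyp_1F1_polynomial)

lemma kummer_coeff_Suc:
  assumes "n \<ge> 1"
  shows "(real k + 1) * (real n + real k) * kummer_coeff n l (Suc k) = (real k - real l) * kummer_coeff n l k"
proof -
  have "pochhammer (real n) k \<noteq> 0" using assms by (simp add: pochhammer_eq_0_iff)
  moreover have "real n + real k \<noteq> 0" using assms by linarith
  moreover have "pochhammer (real n) (Suc k) = pochhammer (real n) k * (real n + real k)"
    "pochhammer (- real l) (Suc k) = pochhammer (- real l) k * (real k - real l)"
    by (simp_all add: pochhammer_Suc)
  moreover have "fact (Suc k) = (real k + 1) * fact k" by simp
  moreover have "x * y * (p * d / (q * y) / (x * f)) = d * (p / q / f)"
    if "q \<noteq> 0" "y \<noteq> 0" "x \<noteq> 0" for x y p d q f :: real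
    using that by simp
  moreover have "real k + 1 \<noteq> 0" by linarith
  ultimately show ?thesis
    unfolding kummer_coeff_def by (simp only:)
qed

text \<open>The recursion of the hypergeometric coefficients is the coefficientwise form of Kummer's equation.\<close>

lemma kummer_equation:
  assumes "n \<ge> 1" and p: "p = kummer_poly n l"
  shows "x * poly (pderiv (pderiv p)) x + (real n - x) * poly (pderiv p) x + real l * poly p x = 0"
proof -
  have "pCons 0 (pderiv (pderiv p)) + smult (real n) (pderiv p) - pCons 0 (pderiv p) + smult (real l) p = 0"
  proof (rule poly_eqI)
    fix k
    have "coeff (pCons 0 (pderiv (pderiv p)) + smult (real n) (pderiv p) - pCons 0 (pderiv p) + smult (real l) p) k
       = (real k + 1) * (real n + real k) * kummer_coeff n l (Suc k) - (real k - real l) * kummer_coeff n l k"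
      by (cases k) (simp_all add: p coeff_pderiv coeff_kummer_poly algebra_simps)
    then show "coeff (pCons 0 (pderiv (pderiv p)) + smult (real n) (pderiv p) - pCons 0 (pderiv p) + smult (real l) p) k = coeff 0 k"
      using kummer_coeff_Suc[OF assms(1)] by simp
  qed
  from arg_cong[OF this, of "\<lambda>q. poly q x"] show ?thesis by (simp add: algebra_simps)
qed

definition landau_poly :: "real \<Rightarrow> nat \<Rightarrow> nat \<Rightarrow> real poly" where
  "landau_poly \<mu> n l = smult ((\<mu> / pi) ^ n * (fact (n - 1 + l) / (fact (n - 1) * fact l)))
     (pcompose (kummer_poly n l) [:0, \<mu>:])"

lemma landau_profile_eq: "landau_profile \<mu> n l t = poly (landau_poly \<mu> n l) t * exp (- (\<mu> / 2) * t)"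
  by (simp add: landau_profile_def landau_poly_def poly_pcompose poly_kummer_poly)
    (simp add: mult.commute)

text \<open>Conjugating the radial operator with \<open>exp (- \<mu> t / 2)\<close> and rescaling \<open>x = \<mu> t\<close> turns it into
\<open>4 \<mu> (x f'' + (n - x) f' - (n / 2) f)\<close>, to which Kummer's equation applies.\<close>

lemma landau_profile_equation:
  assumes n: "n \<ge> 1"
  obtains g' g'' where "\<And>t. (landau_profile \<mu> n l has_real_derivative g' t) (at t)"
    "\<And>t. (g' has_real_derivative g'' t) (at t)"
    "\<And>t. 4 * t * g'' t + 4 * real n * g' t - \<mu>\<^sup>2 * t * landau_profile \<mu> n l t
       = - 2 * \<mu> * (2 * real l + real n) * landau_profile \<mu> n l t"
proof -
  define A :: real where "A = (\<mu> / pi) ^ n * (fact (n - 1 + l) / (fact (n - 1) * fact l))"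
  define p where "p = kummer_poly n l"
  define E where "E t = A * exp (- (\<mu> / 2) * t)" for t
  have E: "(E has_real_derivative - (\<mu> / 2) * E t) (at t)" for t
    unfolding E_def[abs_def] by (auto intro!: derivative_eq_intros)
  have P: "((\<lambda>t. poly q (\<mu> * t)) has_real_derivative \<mu> * poly (pderiv q) (\<mu> * t)) (at t)" for q t
  proof -
    have "((\<lambda>t. \<mu> * t) has_real_derivative \<mu>) (at t)" by (auto intro!: derivative_eq_intros)
    from DERIV_chain2[OF poly_DERIV this] show ?thesis by (simp add: mult.commute)
  qed
  have g: "landau_profile \<mu> n l = (\<lambda>t. E t * poly p (\<mu> * t))"
    by (rule ext) (simp add: landau_profile_def E_def A_def p_def poly_kummer_poly)
  define g' where "g' t = E t * (\<mu> * poly (pderiv p) (\<mu> * t) - \<mu> / 2 * poly p (\<mu> * t))" for t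
  define g'' where "g'' t = E t * (\<mu>\<^sup>2 * poly (pderiv (pderiv p)) (\<mu> * t)
      - \<mu>\<^sup>2 * poly (pderiv p) (\<mu> * t) + \<mu>\<^sup>2 / 4 * poly p (\<mu> * t))" for t
  show thesis
  proof (rule that)
    show "(landau_profile \<mu> n l has_real_derivative g' t) (at t)" for t
      unfolding g g'_def by (rule DERIV_cong[OF DERIV_mult[OF E P]]) (simp add: algebra_simps)
    show "(g' has_real_derivative g'' t) (at t)" for t
      unfolding g'_def[abs_def] g''_def
      by (rule DERIV_cong[OF DERIV_mult[OF E DERIV_diff[OF DERIV_cmult[OF P] DERIV_cmult[OF P]]]])
        (simp add: algebra_simps power2_eq_square)
    show "4 * t * g'' t + 4 * real n * g' t - \<mu>\<^sup>2 * t * landau_profile \<mu> n l t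
       = - 2 * \<mu> * (2 * real l + real n) * landau_profile \<mu> n l t" for t
    proof -
      have "4 * t * g'' t + 4 * real n * g' t - \<mu>\<^sup>2 * t * landau_profile \<mu> n l t
         + 2 * \<mu> * (2 * real l + real n) * landau_profile \<mu> n l t
        = 4 * \<mu> * E t * ((\<mu> * t) * poly (pderiv (pderiv p)) (\<mu> * t)
            + (real n - \<mu> * t) * poly (pderiv p) (\<mu> * t) + real l * poly p (\<mu> * t))"
        unfolding g g'_def g''_def by (simp add: algebra_simps power2_eq_square)
      also have "\<dots> = 0" unfolding kummer_equation[OF n p_def] by simp
      finally show ?thesis by simp
    qed
  qed
qed

lemma Delta_landau_kernel:
  fixes z w :: "complex ^ 'n"
  shows "Delta \<nu> \<mu> (\<lambda>z. landau_kernel \<nu> \<mu> l z w) z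
    = of_real (- 2 * \<mu> * (2 * real l + real CARD('n))) * landau_kernel \<nu> \<mu> l z w"
proof -
  have "CARD('n) \<ge> 1" by (simp add: Suc_leI)
  then obtain g' g'' where g: "\<And>t. (landau_profile \<mu> CARD('n) l has_real_derivative g' t) (at t)"
    "\<And>t. (g' has_real_derivative g'' t) (at t)"
    and eq: "\<And>t. 4 * t * g'' t + 4 * real CARD('n) * g' t - \<mu>\<^sup>2 * t * landau_profile \<mu> CARD('n) l t
       = - 2 * \<mu> * (2 * real l + real CARD('n)) * landau_profile \<mu> CARD('n) l t"
    using landau_profile_equation[of "CARD('n)" \<mu> l] by blast
  show ?thesis
    unfolding landau_kernel_def Delta_radial[OF g] eq by (simp add: mult.assoc)
qed

lemma poly_exp_bound:
  fixes p :: "real poly"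
  assumes a: "a > 0"
  shows "\<exists>C\<ge>0. \<forall>t\<ge>0. \<bar>poly p t * exp (- a * t)\<bar> \<le> C * exp (- (a / 2) * t)"
proof -
  have "\<exists>C. \<forall>k. C k > 0 \<and> (\<forall>t\<ge>0. t ^ k * exp (- a * t) \<le> C k * exp (- (a / 2) * t))"
    using power_exp_bound[OF a] by (intro choice) blast
  then obtain C where C: "\<And>k. C k > 0" "\<And>k t. t \<ge> 0 \<Longrightarrow> t ^ k * exp (- a * t) \<le> C k * exp (- (a / 2) * t)"
    by blast
  show ?thesis
  proof (intro exI[of _ "\<Sum>k\<le>degree p. \<bar>coeff p k\<bar> * C k"] conjI allI impI)
    show "0 \<le> (\<Sum>k\<le>degree p. \<bar>coeff p k\<bar> * C k)"
      using C(1) by (intro sum_nonneg mult_nonneg_nonneg) (auto simp: less_imp_le)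
    fix t :: real assume t: "t \<ge> 0"
    have "\<bar>poly p t * exp (- a * t)\<bar> = \<bar>\<Sum>k\<le>degree p. coeff p k * (t ^ k * exp (- a * t))\<bar>"
      by (simp add: poly_altdef sum_distrib_right mult.assoc)
    also have "\<dots> \<le> (\<Sum>k\<le>degree p. \<bar>coeff p k * (t ^ k * exp (- a * t))\<bar>)" by (rule sum_abs)
    also have "\<dots> = (\<Sum>k\<le>degree p. \<bar>coeff p k\<bar> * (t ^ k * exp (- a * t)))"
      using t by (simp add: abs_mult)
    also have "\<dots> \<le> (\<Sum>k\<le>degree p. \<bar>coeff p k\<bar> * (C k * exp (- (a / 2) * t)))"
      by (intro sum_mono mult_left_mono C(2) t) auto
    finally show "\<bar>poly p t * exp (- a * t)\<bar> \<le> (\<Sum>k\<le>degree p. \<bar>coeff p k\<bar> * C k) * exp (- (a / 2) * t)"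
      by (simp add: sum_distrib_right mult.assoc)
  qed
qed

lemma landau_kernel_bound:
  assumes "\<mu> > 0"
  obtains C where "C \<ge> 0" "\<And>z w :: complex ^ 'n. norm (landau_kernel \<nu> \<mu> l z w) \<le> C * exp (- (\<mu> / 4) * (norm (z - w))\<^sup>2)"
proof -
  obtain C where C: "C \<ge> 0"
    "\<And>t. t \<ge> 0 \<Longrightarrow> \<bar>poly (landau_poly \<mu> CARD('n) l) t * exp (- (\<mu> / 2) * t)\<bar> \<le> C * exp (- (\<mu> / 2 / 2) * t)"
    using poly_exp_bound[of "\<mu> / 2" "landau_poly \<mu> CARD('n) l"] assms by auto
  show thesis
  proof (rule that[OF C(1)])
    fix z w :: "complex ^ 'n"
    show "norm (landau_kernel \<nu> \<mu> l z w) \<le> C * exp (- (\<mu> / 4) * (norm (z - w))\<^sup>2)"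
      using C(2)[of "(norm (z - w))\<^sup>2"] by (simp add: landau_kernel_def norm_mult landau_profile_eq abs_mult)
  qed
qed

lemma landau_kernel_cnj: "cnj (landau_kernel \<nu> \<mu> l z w) = landau_kernel \<nu> \<mu> l w z"
  by (simp add: landau_kernel_def cnj_j_factor norm_minus_commute)

lemma landau_kernel_continuous: "continuous_on UNIV (\<lambda>(z, w). landau_kernel \<nu> \<mu> l z w)"
  unfolding landau_kernel_def landau_profile_eq j_factor_def hermitian_def case_prod_unfold
  by (intro continuous_intros) auto

section \<open>Kernels of the form polynomial times Gaussian\<close>

definition gauss_factor :: "real \<Rightarrow> real \<Rightarrow> complex ^ 'n \<Rightarrow> complex ^ 'n \<Rightarrow> complex" where
  "gauss_factor \<nu> \<mu> z w = of_real (exp (- (\<mu> / 2) * (norm (z - w))\<^sup>2)) * j_factor \<nu> \<mu> z w"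

text \<open>Polynomials in real-linear functions of the two variables. Derivatives with respect to \<open>z\<close> of such a
polynomial times \<open>gauss_factor\<close> have the same form, so that one statement about the whole class can be
iterated to any order.\<close>

inductive poly_kernel :: "('a::euclidean_space \<Rightarrow> 'a \<Rightarrow> complex) \<Rightarrow> bool" where
  const: "poly_kernel (\<lambda>z w. c)"
| fst: "bounded_linear L \<Longrightarrow> poly_kernel (\<lambda>z w. L z)"
| snd: "bounded_linear L \<Longrightarrow> poly_kernel (\<lambda>z w. L w)"
| add: "poly_kernel h \<Longrightarrow> poly_kernel k \<Longrightarrow> poly_kernel (\<lambda>z w. h z w + k z w)"
| mult: "poly_kernel h \<Longrightarrow> poly_kernel k \<Longrightarrow> poly_kernel (\<lambda>z w. h z w * k z w)"

lemma poly_kernel_cmult: "poly_kernel h \<Longrightarrow> poly_kernel (\<lambda>z w. c * h z w)"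
  by (intro poly_kernel.mult poly_kernel.const)

lemma poly_kernel_sum: "finite I \<Longrightarrow> (\<And>i. i \<in> I \<Longrightarrow> poly_kernel (h i)) \<Longrightarrow> poly_kernel (\<lambda>z w. \<Sum>i\<in>I. h i z w)"
  by (induction I rule: finite_induct) (auto intro: poly_kernel.const poly_kernel.add)

lemma poly_kernel_derivative:
  "poly_kernel h \<Longrightarrow> \<exists>h'. (\<forall>v. poly_kernel (h' v)) \<and>
     (\<forall>z w. ((\<lambda>z. h z w) has_derivative (\<lambda>v. h' v z w)) (at z))"
proof (induction rule: poly_kernel.induct)
  case (const c)
  show ?case by (rule exI[of _ "\<lambda>v z w. 0"]) (auto intro: poly_kernel.const)
next
  case (fst L)
  then show ?case
    by (intro exI[of _ "\<lambda>v z w. L v"]) (auto intro: poly_kernel.const bounded_linear_imp_has_derivative)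
next
  case (snd L)
  show ?case by (rule exI[of _ "\<lambda>v z w. 0"]) (auto intro: poly_kernel.const)
next
  case (add h k)
  then obtain h' k' where "\<forall>v. poly_kernel (h' v)" "\<forall>v. poly_kernel (k' v)"
    "\<forall>z w. ((\<lambda>z. h z w) has_derivative (\<lambda>v. h' v z w)) (at z)"
    "\<forall>z w. ((\<lambda>z. k z w) has_derivative (\<lambda>v. k' v z w)) (at z)" by blast
  then show ?case
    by (intro exI[of _ "\<lambda>v z w. h' v z w + k' v z w"])
      (auto intro: poly_kernel.add has_derivative_add)
next
  case (mult h k)
  then obtain h' k' where "\<forall>v. poly_kernel (h' v)" "\<forall>v. poly_kernel (k' v)"
    "\<forall>z w. ((\<lambda>z. h z w) has_derivative (\<lambda>v. h' v z w)) (at z)"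
    "\<forall>z w. ((\<lambda>z. k z w) has_derivative (\<lambda>v. k' v z w)) (at z)" by blast
  then show ?case using mult.hyps
    by (intro exI[of _ "\<lambda>v z w. h z w * k' v z w + h' v z w * k z w"] conjI allI
      poly_kernel.add poly_kernel.mult has_derivative_mult) blast+
qed

lemma bounded_linear_exp_bound:
  fixes L :: "'a::real_normed_vector \<Rightarrow> 'b::real_normed_vector"
  assumes L: "bounded_linear L" and c: "c > 0"
  shows "\<exists>C\<ge>0. \<forall>x. norm (L x) \<le> C * exp (c * (norm x)\<^sup>2)"
proof -
  obtain K where K: "K > 0" "\<And>x. norm (L x) \<le> norm x * K"
    using bounded_linear.pos_bounded[OF L] by blast
  show ?thesis
  proof (intro exI[of _ "(1 + 1 / c) * K"] conjI allI)
    show "0 \<le> (1 + 1 / c) * K" using K c by simp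
    fix x :: 'a
    have "2 * norm x \<le> 1 + (norm x)\<^sup>2"
      using sum_squares_bound[of 1 "norm x"] by simp
    then have "norm x \<le> 1 + (norm x)\<^sup>2" using norm_ge_zero[of x] by linarith
    also have "\<dots> \<le> (1 + (norm x)\<^sup>2) + (1 / c + c * (norm x)\<^sup>2)"
      using c by simp
    also have "\<dots> = (1 + 1 / c) * (1 + c * (norm x)\<^sup>2)"
      using c by (simp add: distrib_right distrib_left)
    also have "\<dots> \<le> (1 + 1 / c) * exp (c * (norm x)\<^sup>2)"
      using c by (intro mult_left_mono exp_ge_add_one_self) auto
    finally have "norm x * K \<le> (1 + 1 / c) * exp (c * (norm x)\<^sup>2) * K"
      using K(1) by (intro mult_right_mono) auto
    then show "norm (L x) \<le> (1 + 1 / c) * K * exp (c * (norm x)\<^sup>2)"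
      using K(2)[of x] by (simp add: mult_ac)
  qed
qed

text \<open>Polynomial growth in the form of an arbitrarily slow Gaussian growth, which is stable under products
because \<open>c\<close> can be halved.\<close>

lemma poly_kernel_bound:
  "poly_kernel h \<Longrightarrow> \<forall>c>0. \<exists>C\<ge>0. \<forall>z w. norm (h z w) \<le> C * exp (c * (norm z)\<^sup>2 + c * (norm w)\<^sup>2)"
proof (induction rule: poly_kernel.induct)
  case (const a)
  show ?case
  proof (intro allI impI exI[of _ "norm a"] conjI)
    fix c :: real and z w :: 'a assume "c > 0"
    then have "1 \<le> exp (c * (norm z)\<^sup>2 + c * (norm w)\<^sup>2)" by simp
    then show "norm a \<le> norm a * exp (c * (norm z)\<^sup>2 + c * (norm w)\<^sup>2)"
      by (simp add: mult_le_cancel_left1)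
  qed simp
next
    case (fst L)
    show ?case
    proof (intro allI impI)
      fix c :: real assume c: "c > 0"
      obtain C where C: "C \<ge> 0" "\<And>x. norm (L x) \<le> C * exp (c * (norm x)\<^sup>2)"
        using bounded_linear_exp_bound[OF fst c] by blast
      have "C * exp (c * (norm z)\<^sup>2) \<le> C * exp (c * (norm z)\<^sup>2 + c * (norm w)\<^sup>2)" for z w :: 'a
        using C(1) c by (intro mult_left_mono) auto
      then show "\<exists>C\<ge>0. \<forall>z w. norm (L z) \<le> C * exp (c * (norm z)\<^sup>2 + c * (norm (w::'a))\<^sup>2)"
        using C by (meson order_trans)
    qed
  next
    case (snd L)
    show ?case
    proof (intro allI impI)
      fix c :: real assume c: "c > 0"
      obtain C where C: "C \<ge> 0" "\<And>x. norm (L x) \<le> C * exp (c * (norm x)\<^sup>2)"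
        using bounded_linear_exp_bound[OF snd c] by blast
      have "C * exp (c * (norm w)\<^sup>2) \<le> C * exp (c * (norm z)\<^sup>2 + c * (norm w)\<^sup>2)" for z w :: 'a
        using C(1) c by (intro mult_left_mono) auto
      then show "\<exists>C\<ge>0. \<forall>z w. norm (L w) \<le> C * exp (c * (norm (z::'a))\<^sup>2 + c * (norm w)\<^sup>2)"
        using C by (meson order_trans)
    qed
next
  case (add h k)
  show ?case
  proof (intro allI impI)
    fix c :: real assume c: "c > 0"
    obtain C D where "C \<ge> 0" "\<forall>z w. norm (h z w) \<le> C * exp (c * (norm z)\<^sup>2 + c * (norm w)\<^sup>2)"
      "D \<ge> 0" "\<forall>z w. norm (k z w) \<le> D * exp (c * (norm z)\<^sup>2 + c * (norm w)\<^sup>2)"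
      using add.IH c by meson
    then show "\<exists>C\<ge>0. \<forall>z w. norm (h z w + k z w) \<le> C * exp (c * (norm z)\<^sup>2 + c * (norm w)\<^sup>2)"
      by (intro exI[of _ "C + D"]) (auto simp: distrib_right intro!: order_trans[OF norm_triangle_ineq] add_mono)
  qed
next
  case (mult h k)
  show ?case
  proof (intro allI impI)
    fix c :: real assume "c > 0"
    then have c: "c / 2 > 0" by simp
    obtain C where C: "C \<ge> 0" "\<And>z w. norm (h z w) \<le> C * exp (c / 2 * (norm z)\<^sup>2 + c / 2 * (norm w)\<^sup>2)"
      using mult.IH(1) c by meson
    obtain D where D: "D \<ge> 0" "\<And>z w. norm (k z w) \<le> D * exp (c / 2 * (norm z)\<^sup>2 + c / 2 * (norm w)\<^sup>2)"
      using mult.IH(2) c by meson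
    show "\<exists>C\<ge>0. \<forall>z w. norm (h z w * k z w) \<le> C * exp (c * (norm z)\<^sup>2 + c * (norm w)\<^sup>2)"
    proof (intro exI[of _ "C * D"] conjI allI)
      fix z w
      have "norm (h z w * k z w) \<le> (C * exp (c / 2 * (norm z)\<^sup>2 + c / 2 * (norm w)\<^sup>2)) *
          (D * exp (c / 2 * (norm z)\<^sup>2 + c / 2 * (norm w)\<^sup>2))"
        unfolding norm_mult using C(1) by (intro mult_mono C(2) D(2)) auto
      also have "\<dots> = C * D * (exp (c / 2 * (norm z)\<^sup>2 + c / 2 * (norm w)\<^sup>2) * exp (c / 2 * (norm z)\<^sup>2 + c / 2 * (norm w)\<^sup>2))"
        by (simp only: mult_ac)
      also have "\<dots> = C * D * exp (c * (norm z)\<^sup>2 + c * (norm w)\<^sup>2)"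
        unfolding exp_add[symmetric] by (simp add: field_simps)
      finally show "norm (h z w * k z w) \<le> C * D * exp (c * (norm z)\<^sup>2 + c * (norm w)\<^sup>2)" .
    qed (use C D in simp)
  qed
qed

lemma poly_kernel_continuous_snd: "poly_kernel h \<Longrightarrow> continuous_on UNIV (\<lambda>w. h z w)"
  by (induction rule: poly_kernel.induct) (auto intro: continuous_intros linear_continuous_on)

lemma gauss_factor_continuous_snd: "continuous_on UNIV (\<lambda>w. gauss_factor \<nu> \<mu> z w)"
  unfolding gauss_factor_def by (intro continuous_intros continuous_j_factor_snd)

lemma norm_gauss_factor: "norm (gauss_factor \<nu> \<mu> z w) = exp (- (\<mu> / 2) * (norm (z - w))\<^sup>2)"
  by (simp add: gauss_factor_def norm_mult)

lemma bounded_linear_hermitian_fst: "bounded_linear (\<lambda>z. hermitian z w)"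
  unfolding hermitian_def
  by (intro bounded_linear_sum bounded_linear_compose[OF bounded_linear_mult_left] bounded_linear_vec_nth)

lemma bounded_linear_hermitian_snd: "bounded_linear (\<lambda>w. hermitian z w)"
  unfolding hermitian_def
  by (intro bounded_linear_sum bounded_linear_compose[OF bounded_linear_mult_right]
      bounded_linear_compose[OF bounded_linear_cnj] bounded_linear_vec_nth)

lemma gauss_factor_derivative:
  "\<exists>e. (\<forall>v. poly_kernel (e v)) \<and>
     (\<forall>z w :: complex ^ 'n. ((\<lambda>z. gauss_factor \<nu> \<mu> z w) has_derivative (\<lambda>v. e v z w * gauss_factor \<nu> \<mu> z w)) (at z))"
proof (intro exI conjI allI)
  let ?e = "\<lambda>v z w :: complex ^ 'n. - of_real \<mu> * (of_real (z \<bullet> v) + - 1 * of_real (w \<bullet> v)) + ((- (\<i> * of_real \<nu>)) * of_real (z \<bullet> v)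
     + of_real (\<mu> / 2) * (hermitian v w + - 1 * cnj (hermitian v w)))"
  show "poly_kernel (?e v)" for v
    by (intro poly_kernel.add poly_kernel_cmult poly_kernel.fst poly_kernel.snd bounded_linear_hermitian_snd
        bounded_linear_compose[OF bounded_linear_cnj] bounded_linear_compose[OF bounded_linear_of_real]
        bounded_linear_inner_left)
  show "((\<lambda>z. gauss_factor \<nu> \<mu> z w) has_derivative (\<lambda>v. ?e v z w * gauss_factor \<nu> \<mu> z w)) (at z)" for z w
  proof -
    have gf: "gauss_factor \<nu> \<mu> z w = exp ((- complex_of_real (\<mu> / 2)) * of_real ((norm (z - w))\<^sup>2)
       + ((- (\<i> * of_real \<nu> / 2)) * (of_real ((norm (z - 0))\<^sup>2) - of_real ((norm w)\<^sup>2))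
       + of_real (\<mu> / 2) * (hermitian z w - cnj (hermitian z w))))" for z w :: "complex ^ 'n"
      unfolding gauss_factor_def j_factor_def exp_of_real[symmetric] exp_add[symmetric]
      by simp
    have N: "((\<lambda>z. complex_of_real ((norm (z - w))\<^sup>2)) has_derivative (\<lambda>v. of_real (2 * ((z - w) \<bullet> v)))) (at z)"
      for z w :: "complex ^ 'n"
      using has_derivative_of_real[OF norm_diff_sq_has_derivative] .
    have H: "((\<lambda>z. hermitian z w) has_derivative (\<lambda>v. hermitian v w)) (at z)"
      by (rule bounded_linear_imp_has_derivative[OF bounded_linear_hermitian_fst])
    have "((\<lambda>z. (- complex_of_real (\<mu> / 2)) * of_real ((norm (z - w))\<^sup>2)
       + ((- (\<i> * of_real \<nu> / 2)) * (of_real ((norm (z - 0))\<^sup>2) - of_real ((norm w)\<^sup>2))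
       + of_real (\<mu> / 2) * (hermitian z w - cnj (hermitian z w)))) has_derivative
       (\<lambda>v. (- complex_of_real (\<mu> / 2)) * of_real (2 * ((z - w) \<bullet> v))
       + ((- (\<i> * of_real \<nu> / 2)) * (of_real (2 * ((z - 0) \<bullet> v)) - 0)
       + of_real (\<mu> / 2) * (hermitian v w - cnj (hermitian v w))))) (at z)"
      by (intro has_derivative_add has_derivative_diff has_derivative_mult_right has_derivative_cnj N H has_derivative_const)
    from exp_has_derivative[OF this] show ?thesis
      unfolding gf[symmetric] by (simp add: inner_diff_left algebra_simps)
  qed
qed

abbreviation gauss_integral ::
    "real \<Rightarrow> real \<Rightarrow> (complex ^ 'n \<Rightarrow> complex ^ 'n \<Rightarrow> complex) \<Rightarrow> (complex ^ 'n \<Rightarrow> complex) \<Rightarrow> complex ^ 'n \<Rightarrow> complex" where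
  "gauss_integral \<nu> \<mu> h f z \<equiv> (\<integral>w. h z w * gauss_factor \<nu> \<mu> z w * f w \<partial>lebesgue)"

lemma gauss_kernel_derivative:
  assumes "poly_kernel h"
  obtains h1 where "\<And>v. poly_kernel (h1 v)"
    "\<And>z w :: complex ^ 'n. ((\<lambda>z. h z w * gauss_factor \<nu> \<mu> z w) has_derivative (\<lambda>v. h1 v z w * gauss_factor \<nu> \<mu> z w)) (at z)"
proof -
  obtain h' where h': "\<And>v. poly_kernel (h' v)" "\<And>z w. ((\<lambda>z. h z w) has_derivative (\<lambda>v. h' v z w)) (at z)"
    using poly_kernel_derivative[OF assms] by blast
  obtain e where e: "\<And>v. poly_kernel (e v)"
    "\<And>z w :: complex ^ 'n. ((\<lambda>z. gauss_factor \<nu> \<mu> z w) has_derivative (\<lambda>v. e v z w * gauss_factor \<nu> \<mu> z w)) (at z)"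
    using gauss_factor_derivative[of \<nu> \<mu>] by blast
  show thesis
  proof (rule that[of "\<lambda>v z w. h z w * e v z w + h' v z w"])
    show "poly_kernel (\<lambda>z w. h z w * e v z w + h' v z w)" for v
      by (intro poly_kernel.add poly_kernel.mult assms e h')
    show "((\<lambda>z. h z w * gauss_factor \<nu> \<mu> z w) has_derivative
      (\<lambda>v. (h z w * e v z w + h' v z w) * gauss_factor \<nu> \<mu> z w)) (at z)" for z w
      using has_derivative_mult[OF h'(2)[of w z] e(2)[of w z]] by (simp add: algebra_simps)
  qed
qed

text \<open>For \<open>z\<close> within distance 1 of \<open>c\<close> the decay in \<open>|z - w|\<close> is a decay in \<open>|w - c|\<close> with half the rate, and
half of the latter absorbs the growth of the polynomial factor.\<close>

lemma gauss_kernel_local_bound: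
  fixes h :: "complex ^ 'n \<Rightarrow> complex ^ 'n \<Rightarrow> complex"
  assumes h: "poly_kernel h" and \<mu>: "\<mu> > 0"
  obtains C where "C \<ge> 0" "\<And>z w. z \<in> ball c 1 \<Longrightarrow>
    norm (h z w * gauss_factor \<nu> \<mu> z w) \<le> C * exp (- (\<mu> / 8) * (norm (w - c))\<^sup>2)"
proof -
  have "\<mu> / 16 > 0" using \<mu> by simp
  then obtain C where C: "C \<ge> 0" "\<And>z w. norm (h z w) \<le> C * exp (\<mu> / 16 * (norm z)\<^sup>2 + \<mu> / 16 * (norm w)\<^sup>2)"
    using poly_kernel_bound[OF h] by blast
  have sq: "(norm (x + y))\<^sup>2 \<le> 2 * (norm x)\<^sup>2 + 2 * (norm y)\<^sup>2" for x y :: "complex ^ 'n"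
  proof -
    have "(norm (x + y))\<^sup>2 \<le> (norm x + norm y)\<^sup>2" by (intro power_mono norm_triangle_ineq) auto
    also have "\<dots> \<le> 2 * (norm x)\<^sup>2 + 2 * (norm y)\<^sup>2"
      using sum_squares_bound[of "norm x" "norm y"] by (simp add: power2_sum)
    finally show ?thesis .
  qed
  define M where "M = \<mu> / 16 * (2 + 2 * (norm c)\<^sup>2) + \<mu> / 8 * (norm c)\<^sup>2 + \<mu> / 2"
  show thesis
  proof (rule that[of "C * exp M"])
    show "C * exp M \<ge> 0" using C by simp
    fix z w assume "z \<in> ball c 1"
    then have zc: "norm (z - c) < 1" by (simp add: dist_norm norm_minus_commute)
    then have zc2: "(norm (z - c))\<^sup>2 \<le> 1" by (simp add: power_le_one)
    have z2: "(norm z)\<^sup>2 \<le> 2 + 2 * (norm c)\<^sup>2" using sq[of "z - c" c] zc2 by simp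
    have w2: "(norm w)\<^sup>2 \<le> 2 * (norm (w - c))\<^sup>2 + 2 * (norm c)\<^sup>2" using sq[of "w - c" c] by simp
    have wc: "(norm (w - c))\<^sup>2 \<le> 2 * (norm (z - w))\<^sup>2 + 2"
      using sq[of "w - z" "z - c"] zc2 by (simp add: norm_minus_commute)
    have "\<mu> / 16 * (norm z)\<^sup>2 \<le> \<mu> / 16 * (2 + 2 * (norm c)\<^sup>2)"
      "\<mu> / 16 * (norm w)\<^sup>2 \<le> \<mu> / 16 * (2 * (norm (w - c))\<^sup>2 + 2 * (norm c)\<^sup>2)"
      "\<mu> / 4 * (norm (w - c))\<^sup>2 \<le> \<mu> / 4 * (2 * (norm (z - w))\<^sup>2 + 2)"
      using \<mu> z2 w2 wc by (auto intro!: mult_left_mono)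
    then have ex: "\<mu> / 16 * (norm z)\<^sup>2 + \<mu> / 16 * (norm w)\<^sup>2 + - (\<mu> / 2) * (norm (z - w))\<^sup>2 \<le> M + - (\<mu> / 8) * (norm (w - c))\<^sup>2"
      unfolding M_def by (simp add: algebra_simps)
    have "norm (h z w * gauss_factor \<nu> \<mu> z w) \<le>
       C * exp (\<mu> / 16 * (norm z)\<^sup>2 + \<mu> / 16 * (norm w)\<^sup>2) * exp (- (\<mu> / 2) * (norm (z - w))\<^sup>2)"
      unfolding norm_mult norm_gauss_factor by (intro mult_right_mono C(2)) simp
    also have "\<dots> = C * exp (\<mu> / 16 * (norm z)\<^sup>2 + \<mu> / 16 * (norm w)\<^sup>2 + - (\<mu> / 2) * (norm (z - w))\<^sup>2)"
      by (simp only: exp_add mult.assoc)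
    also have "\<dots> \<le> C * exp (M + - (\<mu> / 8) * (norm (w - c))\<^sup>2)"
      using C(1) ex by (intro mult_left_mono) auto
    finally show "norm (h z w * gauss_factor \<nu> \<mu> z w) \<le> C * exp M * exp (- (\<mu> / 8) * (norm (w - c))\<^sup>2)"
      by (simp only: exp_add mult.assoc)
  qed
qed

lemma gauss_kernel_integrable:
  fixes h :: "complex ^ 'n \<Rightarrow> complex ^ 'n \<Rightarrow> complex"
  assumes h: "poly_kernel h" and \<mu>: "\<mu> > 0" and f: "f \<in> L2"
  shows "integrable lebesgue (\<lambda>w. h z w * gauss_factor \<nu> \<mu> z w * f w)"
proof -
  obtain C where C: "C \<ge> 0" "\<And>x w. x \<in> ball z 1 \<Longrightarrow>
    norm (h x w * gauss_factor \<nu> \<mu> x w) \<le> C * exp (- (\<mu> / 8) * (norm (w - z))\<^sup>2)"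
    using gauss_kernel_local_bound[OF h \<mu>] by blast
  have "(\<lambda>w. h z w * gauss_factor \<nu> \<mu> z w) \<in> L2"
  proof (rule L2_mono[OF gaussian_L2[of "\<mu> / 8" C z]])
    show "(\<lambda>w. h z w * gauss_factor \<nu> \<mu> z w) \<in> borel_measurable lebesgue"
      by (intro continuous_imp_lebesgue_measurable continuous_intros poly_kernel_continuous_snd[OF h] gauss_factor_continuous_snd)
    show "norm (h z w * gauss_factor \<nu> \<mu> z w) \<le> norm (complex_of_real (C * exp (- (\<mu> / 8) * (norm (w - z))\<^sup>2)))" for w
      using C(1) C(2)[of z w] by (simp add: norm_mult)
  qed (use \<mu> in simp)
  from L2_mult_integrable[OF this f] show ?thesis .
qed

text \<open>The domination must be uniform in the direction \<open>v\<close>; expanding \<open>v\<close> in the standard basis reduces it to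
finitely many kernels.\<close>

lemma gauss_kernel_integral_derivative:
  fixes h :: "complex ^ 'n \<Rightarrow> complex ^ 'n \<Rightarrow> complex"
  assumes h: "poly_kernel h" and \<mu>: "\<mu> > 0" and f: "f \<in> L2"
    and h1: "\<And>v. poly_kernel (h1 v)"
    and d: "\<And>z w. ((\<lambda>z. h z w * gauss_factor \<nu> \<mu> z w) has_derivative (\<lambda>v. h1 v z w * gauss_factor \<nu> \<mu> z w)) (at z)"
  shows "((\<lambda>z. gauss_integral \<nu> \<mu> h f z) has_derivative
     (\<lambda>v. gauss_integral \<nu> \<mu> (h1 v) f z)) (at z)"
proof -
  have "\<exists>C. \<forall>b. C b \<ge> 0 \<and> (\<forall>x\<in>ball z 1. \<forall>w.
      norm (h1 b x w * gauss_factor \<nu> \<mu> x w) \<le> C b * exp (- (\<mu> / 8) * (norm (w - z))\<^sup>2))"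
    using gauss_kernel_local_bound[OF h1 \<mu>, where c = z and \<nu> = \<nu>] by (intro choice allI) metis
  then obtain C where C: "\<And>b. C b \<ge> 0" "\<And>b x w. x \<in> ball z 1 \<Longrightarrow>
      norm (h1 b x w * gauss_factor \<nu> \<mu> x w) \<le> C b * exp (- (\<mu> / 8) * (norm (w - z))\<^sup>2)" by blast
  define M where "M = (\<Sum>b\<in>(Basis :: (complex ^ 'n) set). C b)"
  show ?thesis
  proof (rule has_derivative_integral[where r = 1 and
        D = "\<lambda>z w v. h1 v z w * gauss_factor \<nu> \<mu> z w * f w" and
        B = "\<lambda>w. M * (exp (- (\<mu> / 8) * (norm (w - z))\<^sup>2) * norm (f w))"])
    show "integrable lebesgue (\<lambda>w. h x w * gauss_factor \<nu> \<mu> x w * f w)" for x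
      by (rule gauss_kernel_integrable[OF h \<mu> f])
    show "(\<lambda>w. h1 v z w * gauss_factor \<nu> \<mu> z w * f w) \<in> borel_measurable lebesgue" for v
      using gauss_kernel_integrable[OF h1 \<mu> f] by (rule borel_measurable_integrable)
    show "((\<lambda>z. h z w * gauss_factor \<nu> \<mu> z w * f w) has_derivative (\<lambda>v. h1 v x w * gauss_factor \<nu> \<mu> x w * f w)) (at x)" for x w
      by (rule has_derivative_mult_left[OF d])
    show "integrable lebesgue (\<lambda>w. M * (exp (- (\<mu> / 8) * (norm (w - z))\<^sup>2) * norm (f w)))"
      by (intro integrable_mult_right gaussian_mult_integrable[OF f]) (use \<mu> in simp)
    show "norm (h1 v x w * gauss_factor \<nu> \<mu> x w * f w) \<le> M * (exp (- (\<mu> / 8) * (norm (w - z))\<^sup>2) * norm (f w)) * norm v"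
      if x: "x \<in> ball z 1" for x w v
    proof -
      let ?E = "exp (- (\<mu> / 8) * (norm (w - z))\<^sup>2)"
      let ?L = "\<lambda>v. h1 v x w * gauss_factor \<nu> \<mu> x w"
      have lin: "linear ?L" using has_derivative_linear[OF d] .
      have "?L v = ?L (\<Sum>b\<in>Basis. (v \<bullet> b) *\<^sub>R b)" by (simp add: euclidean_representation)
      also have "\<dots> = (\<Sum>b\<in>Basis. (v \<bullet> b) *\<^sub>R ?L b)"
        by (simp only: linear_sum[OF lin] linear_scale[OF lin])
      finally have "norm (?L v) \<le> (\<Sum>b\<in>Basis. norm ((v \<bullet> b) *\<^sub>R ?L b))"
        by (simp only: norm_sum)
      also have "\<dots> \<le> (\<Sum>b\<in>Basis. norm v * (C b * ?E))"
        unfolding norm_scaleR by (intro sum_mono mult_mono C(2) x) (auto simp: Basis_le_norm)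
      also have "\<dots> = M * ?E * norm v"
        by (simp add: M_def sum_distrib_left sum_distrib_right mult_ac)
      finally have "norm (?L v) * norm (f w) \<le> M * ?E * norm v * norm (f w)"
        by (intro mult_right_mono) auto
      then show ?thesis unfolding norm_mult[of "?L v" "f w"] by (simp only: mult_ac)
    qed
  qed simp
qed

lemma gauss_kernel_integral_C_diff:
  fixes h :: "complex ^ 'n \<Rightarrow> complex ^ 'n \<Rightarrow> complex"
  assumes \<mu>: "\<mu> > 0" and f: "f \<in> L2"
  shows "poly_kernel h \<Longrightarrow> C_diff k (\<lambda>z. gauss_integral \<nu> \<mu> h f z)"
proof (induction k arbitrary: h)
  case (Suc k)
  obtain h1 where h1: "\<And>v. poly_kernel (h1 v)"
    "\<And>z w :: complex ^ 'n. ((\<lambda>z. h z w * gauss_factor \<nu> \<mu> z w) has_derivative (\<lambda>v. h1 v z w * gauss_factor \<nu> \<mu> z w)) (at z)"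
    using gauss_kernel_derivative[OF Suc.prems] by blast
  show ?case
    by (rule C_diff_SucI[OF gauss_kernel_integral_derivative[OF Suc.prems \<mu> f h1]]) (rule Suc.IH[OF h1(1)])
next
  case 0
  obtain h1 where h1: "\<And>v. poly_kernel (h1 v)"
    "\<And>z w :: complex ^ 'n. ((\<lambda>z. h z w * gauss_factor \<nu> \<mu> z w) has_derivative (\<lambda>v. h1 v z w * gauss_factor \<nu> \<mu> z w)) (at z)"
    using gauss_kernel_derivative[OF 0] by blast
  show ?case
    using has_derivative_continuous[OF gauss_kernel_integral_derivative[OF 0 \<mu> f h1]]
    by (simp add: continuous_at_imp_continuous_on)
qed

lemma gauss_kernel_wirtinger:
  fixes h :: "complex ^ 'n \<Rightarrow> complex ^ 'n \<Rightarrow> complex"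
  assumes h: "poly_kernel h" and \<mu>: "\<mu> > 0" and f: "f \<in> L2"
  obtains p q where "poly_kernel p" "poly_kernel q"
    "\<And>z w. has_wirtinger j (\<lambda>z. h z w * gauss_factor \<nu> \<mu> z w) (p z w * gauss_factor \<nu> \<mu> z w) (q z w * gauss_factor \<nu> \<mu> z w) z"
    "\<And>z. has_wirtinger j (\<lambda>z. gauss_integral \<nu> \<mu> h f z)
       (gauss_integral \<nu> \<mu> p f z) (gauss_integral \<nu> \<mu> q f z) z"
proof -
  obtain h1 where h1: "\<And>v. poly_kernel (h1 v)"
    "\<And>z w :: complex ^ 'n. ((\<lambda>z. h z w * gauss_factor \<nu> \<mu> z w) has_derivative (\<lambda>v. h1 v z w * gauss_factor \<nu> \<mu> z w)) (at z)"
    using gauss_kernel_derivative[OF h] by blast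
  let ?p = "\<lambda>s z w. (1 / 2) * h1 (axis j 1) z w + (s * \<i> / 2) * h1 (axis j \<i>) z w"
  note d = gauss_kernel_integral_derivative[OF h \<mu> f h1]
  have int: "(gauss_integral \<nu> \<mu> (?p s) f z) =
     ((gauss_integral \<nu> \<mu> (h1 (axis j 1)) f z)
      + s * (\<i> * (gauss_integral \<nu> \<mu> (h1 (axis j \<i>)) f z))) / 2" for s z
  proof -
    note I = gauss_kernel_integrable[OF h1(1) \<mu> f]
    have "(gauss_integral \<nu> \<mu> (?p s) f z) =
      (\<integral>w. (1 / 2) * (h1 (axis j 1) z w * gauss_factor \<nu> \<mu> z w * f w)
         + (s * \<i> / 2) * (h1 (axis j \<i>) z w * gauss_factor \<nu> \<mu> z w * f w) \<partial>lebesgue)"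
      by (simp only: distrib_right mult.assoc)
    also have "\<dots> = (1 / 2) * (gauss_integral \<nu> \<mu> (h1 (axis j 1)) f z)
        + (s * \<i> / 2) * (gauss_integral \<nu> \<mu> (h1 (axis j \<i>)) f z)"
      by (subst Bochner_Integration.integral_add[OF integrable_mult_right[OF I] integrable_mult_right[OF I]])
        (simp only: integral_mult_right_zero)
    finally show ?thesis by (simp add: field_simps)
  qed
  show thesis
  proof (rule that[of "?p (- 1)" "?p 1"])
    show "poly_kernel (?p (- 1))" "poly_kernel (?p 1)"
      by (intro poly_kernel.add poly_kernel_cmult h1)+
    show "has_wirtinger j (\<lambda>z. h z w * gauss_factor \<nu> \<mu> z w) (?p (- 1) z w * gauss_factor \<nu> \<mu> z w)
        (?p 1 z w * gauss_factor \<nu> \<mu> z w) z" for z w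
      unfolding has_wirtinger_def
      by (rule exI, intro conjI, rule h1(2)) (simp_all add: field_simps)
    show "has_wirtinger j (\<lambda>z. gauss_integral \<nu> \<mu> h f z)
       (gauss_integral \<nu> \<mu> (?p (- 1)) f z)
       (gauss_integral \<nu> \<mu> (?p 1) f z) z" for z
      unfolding has_wirtinger_def int
      by (rule exI, intro conjI, rule d) simp_all
  qed
qed

lemma Delta_coord_gauss_kernel_integral:
  fixes h :: "complex ^ 'n \<Rightarrow> complex ^ 'n \<Rightarrow> complex"
  assumes h: "poly_kernel h" and \<mu>: "\<mu> > 0" and f: "f \<in> L2"
  shows "integrable lebesgue (\<lambda>w. Delta_coord \<nu>' \<mu>' j (\<lambda>z. h z w * gauss_factor \<nu> \<mu> z w) z * f w)"
    and "Delta_coord \<nu>' \<mu>' j (\<lambda>z. gauss_integral \<nu> \<mu> h f z) z =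
     (\<integral>w. Delta_coord \<nu>' \<mu>' j (\<lambda>z. h z w * gauss_factor \<nu> \<mu> z w) z * f w \<partial>lebesgue)"
proof -
  obtain p q where pq: "poly_kernel p" "poly_kernel q" and
    w1: "\<And>z w. has_wirtinger j (\<lambda>z. h z w * gauss_factor \<nu> \<mu> z w) (p z w * gauss_factor \<nu> \<mu> z w) (q z w * gauss_factor \<nu> \<mu> z w) z"
    and W1: "\<And>z. has_wirtinger j (\<lambda>z. gauss_integral \<nu> \<mu> h f z)
       (gauss_integral \<nu> \<mu> p f z) (gauss_integral \<nu> \<mu> q f z) z"
    using gauss_kernel_wirtinger[OF h \<mu> f, where j = j and \<nu> = \<nu>] by blast
  obtain r s where rs: "poly_kernel r" "poly_kernel s" and
    w2: "\<And>z w. has_wirtinger j (\<lambda>z. q z w * gauss_factor \<nu> \<mu> z w) (r z w * gauss_factor \<nu> \<mu> z w) (s z w * gauss_factor \<nu> \<mu> z w) z"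
    and W2: "\<And>z. has_wirtinger j (\<lambda>z. gauss_integral \<nu> \<mu> q f z)
       (gauss_integral \<nu> \<mu> r f z) (gauss_integral \<nu> \<mu> s f z) z"
    using gauss_kernel_wirtinger[OF pq(2) \<mu> f, where j = j and \<nu> = \<nu>] by blast
  define a where "a = 2 * \<i> * complex_of_real \<nu>' + 2 * of_real \<mu>'"
  define b where "b = 2 * \<i> * complex_of_real \<nu>' - 2 * of_real \<mu>'"
  define c where "c = 2 * \<i> * complex_of_real \<nu>' - of_real (\<nu>'\<^sup>2 + \<mu>'\<^sup>2) * (z $ j * cnj (z $ j))"
  note I = gauss_kernel_integrable[OF _ \<mu> f]
  have D1: "d_zbar j (\<lambda>z. h z w * gauss_factor \<nu> \<mu> z w) = (\<lambda>z. q z w * gauss_factor \<nu> \<mu> z w)" for w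
    using has_wirtingerD(2)[OF w1] by blast
  have D2: "d_zbar j (\<lambda>z. gauss_integral \<nu> \<mu> h f z) = (\<lambda>z. gauss_integral \<nu> \<mu> q f z)"
    using has_wirtingerD(2)[OF W1] by blast
  have k: "Delta_coord \<nu>' \<mu>' j (\<lambda>z. h z w * gauss_factor \<nu> \<mu> z w) z * f w =
     4 * (r z w * gauss_factor \<nu> \<mu> z w * f w) + a * z $ j * (p z w * gauss_factor \<nu> \<mu> z w * f w)
     + b * cnj (z $ j) * (q z w * gauss_factor \<nu> \<mu> z w * f w) + c * (h z w * gauss_factor \<nu> \<mu> z w * f w)" for w
    unfolding Delta_coord_def D1 has_wirtingerD(1)[OF w1] has_wirtingerD(1)[OF w2] a_def b_def c_def
    by (simp add: algebra_simps)
  show "integrable lebesgue (\<lambda>w. Delta_coord \<nu>' \<mu>' j (\<lambda>z. h z w * gauss_factor \<nu> \<mu> z w) z * f w)"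
    unfolding k by (intro Bochner_Integration.integrable_add integrable_mult_right I pq rs(1) h)
  have "(\<integral>w. Delta_coord \<nu>' \<mu>' j (\<lambda>z. h z w * gauss_factor \<nu> \<mu> z w) z * f w \<partial>lebesgue) =
     4 * (gauss_integral \<nu> \<mu> r f z) + a * z $ j * (gauss_integral \<nu> \<mu> p f z)
     + b * cnj (z $ j) * (gauss_integral \<nu> \<mu> q f z) + c * (gauss_integral \<nu> \<mu> h f z)"
    unfolding k
    by (subst Bochner_Integration.integral_add, (intro Bochner_Integration.integrable_add integrable_mult_right I pq rs(1) h)+)+
      (simp only: integral_mult_right_zero)
  also have "\<dots> = Delta_coord \<nu>' \<mu>' j (\<lambda>z. gauss_integral \<nu> \<mu> h f z) z"
    unfolding Delta_coord_def D2 has_wirtingerD(1)[OF W1] has_wirtingerD(1)[OF W2] a_def b_def c_def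
    by (simp add: algebra_simps)
  finally show "Delta_coord \<nu>' \<mu>' j (\<lambda>z. gauss_integral \<nu> \<mu> h f z) z =
     (\<integral>w. Delta_coord \<nu>' \<mu>' j (\<lambda>z. h z w * gauss_factor \<nu> \<mu> z w) z * f w \<partial>lebesgue)" by simp
qed

lemma Delta_gauss_kernel_integral:
  fixes h :: "complex ^ 'n \<Rightarrow> complex ^ 'n \<Rightarrow> complex"
  assumes h: "poly_kernel h" and \<mu>: "\<mu> > 0" and f: "f \<in> L2"
  shows "Delta \<nu>' \<mu>' (\<lambda>z. gauss_integral \<nu> \<mu> h f z) z =
     (\<integral>w. Delta \<nu>' \<mu>' (\<lambda>z. h z w * gauss_factor \<nu> \<mu> z w) z * f w \<partial>lebesgue)"
  unfolding Delta_eq_sum sum_distrib_right Delta_coord_gauss_kernel_integral(2)[OF assms]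
  by (subst Bochner_Integration.integral_sum) (auto intro: Delta_coord_gauss_kernel_integral(1)[OF assms])

lemma poly_kernel_norm_sq: "poly_kernel (\<lambda>z w :: complex ^ 'n. complex_of_real ((norm (z - w))\<^sup>2))"
proof -
  have "complex_of_real ((norm (z - w))\<^sup>2) = (\<Sum>j\<in>UNIV. (z $ j + (- 1) * w $ j) * (cnj (z $ j) + (- 1) * cnj (w $ j)))"
    for z w :: "complex ^ 'n" by (simp add: norm_sq_eq_sum del: of_real_power)
  moreover have "poly_kernel (\<lambda>z w :: complex ^ 'n. (\<Sum>j\<in>UNIV. (z $ j + (- 1) * w $ j) * (cnj (z $ j) + (- 1) * cnj (w $ j))))"
    by (intro poly_kernel_sum poly_kernel.mult poly_kernel.add poly_kernel_cmult poly_kernel.fst poly_kernel.snd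
        bounded_linear_compose[OF bounded_linear_cnj] bounded_linear_vec_nth) auto
  ultimately show ?thesis by simp
qed

lemma poly_kernel_poly: "poly_kernel (\<lambda>z w :: complex ^ 'n. complex_of_real (poly p ((norm (z - w))\<^sup>2)))"
proof (induction p)
  case (pCons a p)
  have "poly_kernel (\<lambda>z w :: complex ^ 'n. complex_of_real a + complex_of_real ((norm (z - w))\<^sup>2) * complex_of_real (poly p ((norm (z - w))\<^sup>2)))"
    by (intro poly_kernel.add poly_kernel.mult poly_kernel.const poly_kernel_norm_sq pCons.IH)
  then show ?case by simp
qed (simp add: poly_kernel.const)

section \<open>The integral operator\<close>

lemma landau_kernel_eq_gauss_kernel:
  "landau_kernel \<nu> \<mu> l z (w :: complex ^ 'n) =
    complex_of_real (poly (landau_poly \<mu> CARD('n) l) ((norm (z - w))\<^sup>2)) * gauss_factor \<nu> \<mu> z w"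
  by (simp add: landau_kernel_def landau_profile_eq gauss_factor_def)

definition landau_projection :: "real \<Rightarrow> real \<Rightarrow> nat \<Rightarrow> (complex ^ 'n \<Rightarrow> complex) \<Rightarrow> complex ^ 'n \<Rightarrow> complex" where
  "landau_projection \<nu> \<mu> l f z = (\<integral>w. landau_kernel \<nu> \<mu> l z w * f w \<partial>lebesgue)"

lemma landau_projection_smooth:
  fixes f :: "complex ^ 'n \<Rightarrow> complex"
  assumes "\<mu> > 0" "f \<in> L2"
  shows "C_infinity (landau_projection \<nu> \<mu> l f)"
  unfolding C_infinity_def landau_projection_def[abs_def] landau_kernel_eq_gauss_kernel
  using gauss_kernel_integral_C_diff[OF assms poly_kernel_poly[of "landau_poly \<mu> CARD('n) l"]] by blast

lemma landau_kernel_integrable: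
  fixes f :: "complex ^ 'n \<Rightarrow> complex"
  assumes "\<mu> > 0" "f \<in> L2"
  shows "integrable lebesgue (\<lambda>w. landau_kernel \<nu> \<mu> l z w * f w)"
  unfolding landau_kernel_eq_gauss_kernel
  by (rule gauss_kernel_integrable[OF poly_kernel_poly[of "landau_poly \<mu> CARD('n) l"] assms])

lemma Delta_landau_projection:
  fixes f :: "complex ^ 'n \<Rightarrow> complex"
  assumes "\<mu> > 0" "f \<in> L2"
  shows "Delta \<nu> \<mu> (landau_projection \<nu> \<mu> l f) z =
     of_real (- 2 * \<mu> * (2 * real l + real CARD('n))) * landau_projection \<nu> \<mu> l f z"
proof -
  have "Delta \<nu> \<mu> (landau_projection \<nu> \<mu> l f) z = (\<integral>w. Delta \<nu> \<mu> (\<lambda>z. landau_kernel \<nu> \<mu> l z w) z * f w \<partial>lebesgue)"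
    using Delta_gauss_kernel_integral[OF poly_kernel_poly[of "landau_poly \<mu> CARD('n) l"] assms, of \<nu> \<mu> \<nu> z]
    unfolding landau_projection_def[abs_def] landau_kernel_eq_gauss_kernel .
  also have "\<dots> = (\<integral>w. of_real (- 2 * \<mu> * (2 * real l + real CARD('n))) * (landau_kernel \<nu> \<mu> l z w * f w) \<partial>lebesgue)"
    unfolding Delta_landau_kernel by (simp only: mult.assoc)
  also have "\<dots> = of_real (- 2 * \<mu> * (2 * real l + real CARD('n))) * landau_projection \<nu> \<mu> l f z"
    unfolding landau_projection_def by (rule integral_mult_right_zero)
  finally show ?thesis .
qed

section \<open>Boundedness and orthogonality\<close>

lemma pair_sigma_finite_lebesgue:
  "pair_sigma_finite (lebesgue :: 'a::euclidean_space measure) (lebesgue :: 'b::euclidean_space measure)"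
  by (intro pair_sigma_finite.intro sigma_finite_lebesgue)

text \<open>Continuity gives Borel measurability on the product space; the two projections are measurable from
the completed measures to the Borel sets.\<close>

lemma continuous_pair_lebesgue_measurable:
  fixes k :: "'a::euclidean_space \<Rightarrow> 'b::euclidean_space \<Rightarrow> 'c::topological_space"
  assumes "continuous_on UNIV (\<lambda>(z, w). k z w)"
  shows "(\<lambda>(z, w). k z w) \<in> borel_measurable (lebesgue \<Otimes>\<^sub>M lebesgue)"
proof -
  have fst: "fst \<in> borel_measurable ((lebesgue :: 'a measure) \<Otimes>\<^sub>M (lebesgue :: 'b measure))"
    using measurable_compose[OF measurable_fst id_borel_measurable_lebesgue] by simp
  have snd: "snd \<in> borel_measurable ((lebesgue :: 'a measure) \<Otimes>\<^sub>M (lebesgue :: 'b measure))"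
    using measurable_compose[OF measurable_snd id_borel_measurable_lebesgue] by simp
  have "(\<lambda>p. (fst p, snd p)) \<in> (lebesgue \<Otimes>\<^sub>M lebesgue) \<rightarrow>\<^sub>M (borel :: ('a \<times> 'b) measure)"
    using measurable_Pair[OF fst snd] by (simp add: borel_prod)
  from measurable_compose[OF this borel_measurable_continuous_onI[OF assms]] show ?thesis by simp
qed

lemma gaussian_convolution_integrable:
  fixes f :: "'a::euclidean_space \<Rightarrow> complex"
  assumes f: "f \<in> L2" and a: "a > 0"
  shows "integrable (lebesgue \<Otimes>\<^sub>M lebesgue) (\<lambda>(w, z). exp (- a * (norm (z - w))\<^sup>2) * (norm (f w))\<^sup>2)"
proof -
  interpret pair_sigma_finite "lebesgue :: 'a measure" "lebesgue :: 'a measure"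
    by (rule pair_sigma_finite_lebesgue)
  have gauss: "has_bochner_integral lebesgue (\<lambda>z. exp (- a * (norm (z - w))\<^sup>2)) (sqrt (pi / a) ^ DIM('a))" for w :: 'a
    by (rule gaussian_has_integral[OF a])
  have m1: "(\<lambda>(w, z). exp (- a * (norm (z - w))\<^sup>2)) \<in> borel_measurable ((lebesgue :: 'a measure) \<Otimes>\<^sub>M lebesgue)"
    by (rule continuous_pair_lebesgue_measurable) (auto simp: case_prod_unfold intro!: continuous_intros)
  have m2: "(\<lambda>p. (norm (f (fst p)))\<^sup>2) \<in> borel_measurable ((lebesgue :: 'a measure) \<Otimes>\<^sub>M lebesgue)"
    using measurable_compose[OF measurable_fst L2_D(1)[OF f]] by measurable
  have meas: "(\<lambda>p. exp (- a * (norm (snd p - fst p))\<^sup>2) * (norm (f (fst p)))\<^sup>2) \<in> borel_measurable ((lebesgue :: 'a measure) \<Otimes>\<^sub>M lebesgue)"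
    using borel_measurable_times[OF m1 m2] unfolding case_prod_unfold .
  have "integrable (lebesgue \<Otimes>\<^sub>M lebesgue) (\<lambda>p. exp (- a * (norm (snd p - fst p))\<^sup>2) * (norm (f (fst p)))\<^sup>2)"
  proof (rule Fubini_integrable[OF meas])
    have *: "(\<integral>z. norm (exp (- a * (norm (snd (w, z) - fst (w, z)))\<^sup>2) * (norm (f (fst (w, z))))\<^sup>2) \<partial>lebesgue)
        = sqrt (pi / a) ^ DIM('a) * (norm (f w))\<^sup>2" for w
      using gauss[of w] by (simp add: has_bochner_integral_iff)
    show "integrable lebesgue (\<lambda>w. \<integral>z. norm (exp (- a * (norm (snd (w, z) - fst (w, z)))\<^sup>2) * (norm (f (fst (w, z))))\<^sup>2) \<partial>lebesgue)"
      unfolding * by (intro integrable_mult_right L2_D(2)[OF f])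
    show "AE w in lebesgue. integrable lebesgue (\<lambda>z. exp (- a * (norm (snd (w, z) - fst (w, z)))\<^sup>2) * (norm (f (fst (w, z))))\<^sup>2)"
      using gauss by (intro AE_I2) (simp add: has_bochner_integral_iff)
  qed
  then show ?thesis by (simp add: case_prod_unfold)
qed

text \<open>Young's inequality for the convolution with an integrable Gaussian.\<close>

lemma landau_projection_L2:
  fixes f :: "complex ^ 'n \<Rightarrow> complex"
  assumes \<mu>: "\<mu> > 0" and f: "f \<in> L2"
  shows "landau_projection \<nu> \<mu> l f \<in> L2"
proof (rule L2_I)
  interpret pair_sigma_finite "lebesgue :: (complex ^ 'n) measure" "lebesgue :: (complex ^ 'n) measure"
    by (rule pair_sigma_finite_lebesgue)
  have "C_diff 0 (landau_projection \<nu> \<mu> l f)"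
    using landau_projection_smooth[OF \<mu> f] unfolding C_infinity_def by blast
  then show meas: "landau_projection \<nu> \<mu> l f \<in> borel_measurable lebesgue"
    by (simp add: continuous_imp_lebesgue_measurable)
  obtain C where C: "C \<ge> 0" "\<And>z w :: complex ^ 'n. norm (landau_kernel \<nu> \<mu> l z w) \<le> C * exp (- (\<mu> / 4) * (norm (z - w))\<^sup>2)"
    using landau_kernel_bound[OF \<mu>, of \<nu> l] by blast
  define E where "E z w = exp (- (\<mu> / 4) * (norm (z - w))\<^sup>2)" for z w :: "complex ^ 'n"
  define N where "N = sqrt (pi / (\<mu> / 4)) ^ DIM(complex ^ 'n)"
  have \<mu>4: "\<mu> / 4 > 0" using \<mu> by simp
  have N: "N > 0" using \<mu> by (simp add: N_def)
  have E_int: "has_bochner_integral lebesgue (E z) N" for z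
    using gaussian_has_integral[OF \<mu>4, of z] by (simp add: E_def[abs_def] N_def norm_minus_commute)
  have pair: "integrable (lebesgue \<Otimes>\<^sub>M lebesgue) (\<lambda>(w, z). E z w * (norm (f w))\<^sup>2)"
    unfolding E_def by (rule gaussian_convolution_integrable[OF f \<mu>4])
  have Ef: "integrable lebesgue (\<lambda>w. E z w * norm (f w))" for z
    using gaussian_mult_integrable[OF f \<mu>4, of z] by (simp add: E_def norm_minus_commute)
  have sq: "AE z in lebesgue. (norm (landau_projection \<nu> \<mu> l f z))\<^sup>2 \<le> C\<^sup>2 * N * (\<integral>w. E z w * (norm (f w))\<^sup>2 \<partial>lebesgue)"
    using AE_integrable_snd[OF pair]
  proof eventually_elim
    case (elim z)
    define X where "X = (\<integral>w. E z w * norm (f w) \<partial>lebesgue)"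
    define Y where "Y = (\<integral>w. E z w * (norm (f w))\<^sup>2 \<partial>lebesgue)"
    \<comment> \<open>Integrating \<open>2 s |f| \<le> s^2 + |f|^2\<close> against \<open>E\<close> gives \<open>2 s X \<le> s^2 N + Y\<close>; this \<open>s\<close> is optimal and yields
      the Cauchy-Schwarz inequality \<open>X^2 \<le> N Y\<close>.\<close>
    define s where "s = X / N"
    have "2 * s * X = (\<integral>w. 2 * s * (E z w * norm (f w)) \<partial>lebesgue)"
      unfolding X_def by simp
    also have "\<dots> \<le> (\<integral>w. s\<^sup>2 * E z w + E z w * (norm (f w))\<^sup>2 \<partial>lebesgue)"
    proof (rule integral_mono)
      fix w
      have "2 * s * norm (f w) \<le> s\<^sup>2 + (norm (f w))\<^sup>2" by (rule sum_squares_bound)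
      then have "E z w * (2 * s * norm (f w)) \<le> E z w * (s\<^sup>2 + (norm (f w))\<^sup>2)"
        by (rule mult_left_mono) (simp add: E_def)
      then show "2 * s * (E z w * norm (f w)) \<le> s\<^sup>2 * E z w + E z w * (norm (f w))\<^sup>2"
        by (simp add: algebra_simps)
    qed (use Ef E_int elim in \<open>auto simp: has_bochner_integral_iff\<close>)
    also have "\<dots> = s\<^sup>2 * N + Y"
      unfolding Y_def using E_int[of z] elim
      by (subst Bochner_Integration.integral_add) (auto simp: has_bochner_integral_iff)
    finally have "2 * s * X \<le> s\<^sup>2 * N + Y" .
    moreover have "s\<^sup>2 * N = s * X" using N by (simp add: s_def power2_eq_square)
    ultimately have "s * X \<le> Y" by linarith
    then have "X\<^sup>2 \<le> N * Y"
      using N by (simp add: s_def power2_eq_square field_simps)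
    moreover have "norm (landau_projection \<nu> \<mu> l f z) \<le> C * X"
    proof -
      have "norm (landau_projection \<nu> \<mu> l f z) \<le> (\<integral>w. norm (landau_kernel \<nu> \<mu> l z w * f w) \<partial>lebesgue)"
        unfolding landau_projection_def by (rule integral_norm_bound)
      also have "\<dots> \<le> (\<integral>w. C * (E z w * norm (f w)) \<partial>lebesgue)"
      proof (rule integral_mono)
        fix w
        have "norm (landau_kernel \<nu> \<mu> l z w) * norm (f w) \<le> C * E z w * norm (f w)"
          unfolding E_def by (intro mult_right_mono C(2)) simp
        then show "norm (landau_kernel \<nu> \<mu> l z w * f w) \<le> C * (E z w * norm (f w))"
          by (simp add: norm_mult mult.assoc)
      qed (use landau_kernel_integrable[OF \<mu> f] Ef in auto)
      finally show ?thesis by (simp add: X_def)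
    qed
    then have "(norm (landau_projection \<nu> \<mu> l f z))\<^sup>2 \<le> (C * X)\<^sup>2" by (rule power_mono) simp
    ultimately show ?case
      using mult_left_mono[of "X\<^sup>2" "N * Y" "C\<^sup>2"] unfolding Y_def power_mult_distrib by (simp add: mult.assoc)
  qed
  have "integrable lebesgue (\<lambda>z. C\<^sup>2 * N * (\<integral>w. E z w * (norm (f w))\<^sup>2 \<partial>lebesgue))"
    by (intro integrable_mult_right integrable_snd[OF pair])
  then show "integrable lebesgue (\<lambda>z. (norm (landau_projection \<nu> \<mu> l f z))\<^sup>2)"
  proof (rule Bochner_Integration.integrable_bound)
    show "(\<lambda>z. (norm (landau_projection \<nu> \<mu> l f z))\<^sup>2) \<in> borel_measurable lebesgue"
      using meas by measurable
    show "AE z in lebesgue. norm ((norm (landau_projection \<nu> \<mu> l f z))\<^sup>2) \<le> norm (C\<^sup>2 * N * (\<integral>w. E z w * (norm (f w))\<^sup>2 \<partial>lebesgue))"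
      using sq by eventually_elim simp
  qed
qed

lemma landau_projection_A2:
  fixes f :: "complex ^ 'n \<Rightarrow> complex"
  assumes "\<mu> > 0" "f \<in> L2"
  shows "landau_projection \<nu> \<mu> l f \<in> A2 \<nu> \<mu> l"
  using landau_projection_L2[OF assms] landau_projection_smooth[OF assms] Delta_landau_projection[OF assms]
  by (simp add: A2_def)

text \<open>The absolute integrability behind the exchange of the integrals follows from
\<open>|K z w| |f w| |g z| \<le> C E (|f w|^2 + |g z|^2)\<close>, where \<open>E\<close> is a Gaussian in \<open>z - w\<close>.\<close>

lemma landau_projection_orthogonal:
  fixes f g :: "complex ^ 'n \<Rightarrow> complex"
  assumes \<mu>: "\<mu> > 0" and f: "f \<in> L2" and g: "g \<in> A2 \<nu> \<mu> l"
  shows "L2_inner (landau_projection \<nu> \<mu> l f) g = L2_inner f g"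
proof -
  interpret pair_sigma_finite "lebesgue :: (complex ^ 'n) measure" "lebesgue :: (complex ^ 'n) measure"
    by (rule pair_sigma_finite_lebesgue)
  have gL2: "g \<in> L2" using A2_D(1)[OF g] .
  obtain C where C: "C \<ge> 0" "\<And>z w :: complex ^ 'n. norm (landau_kernel \<nu> \<mu> l z w) \<le> C * exp (- (\<mu> / 4) * (norm (z - w))\<^sup>2)"
    using landau_kernel_bound[OF \<mu>, of \<nu> l] by blast
  have \<mu>4: "\<mu> / 4 > 0" using \<mu> by simp
  let ?k = "\<lambda>z w. landau_kernel \<nu> \<mu> l z w * f w * cnj (g z)"
  have i1: "integrable (lebesgue \<Otimes>\<^sub>M lebesgue) (\<lambda>(z, w). exp (- (\<mu> / 4) * (norm (z - w))\<^sup>2) * (norm (f w))\<^sup>2)"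
    using integrable_product_swap[OF gaussian_convolution_integrable[OF f \<mu>4]] by simp
  have i2: "integrable (lebesgue \<Otimes>\<^sub>M lebesgue) (\<lambda>(z, w). exp (- (\<mu> / 4) * (norm (z - w))\<^sup>2) * (norm (g z))\<^sup>2)"
    using gaussian_convolution_integrable[OF gL2 \<mu>4] by (simp add: norm_minus_commute case_prod_unfold)
  have "integrable (lebesgue \<Otimes>\<^sub>M lebesgue) (\<lambda>(z, w). ?k z w)"
  proof (rule Bochner_Integration.integrable_bound)
    show "integrable (lebesgue \<Otimes>\<^sub>M lebesgue) (\<lambda>p. C * ((case p of (z, w) \<Rightarrow> exp (- (\<mu> / 4) * (norm (z - w))\<^sup>2) * (norm (f w))\<^sup>2)
        + (case p of (z, w) \<Rightarrow> exp (- (\<mu> / 4) * (norm (z - w))\<^sup>2) * (norm (g z))\<^sup>2)))"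
      by (intro integrable_mult_right Bochner_Integration.integrable_add i1 i2)
    have "(\<lambda>p. f (snd p)) \<in> borel_measurable ((lebesgue :: (complex ^ 'n) measure) \<Otimes>\<^sub>M lebesgue)"
      by (rule measurable_compose[OF measurable_snd L2_D(1)[OF f]])
    moreover have "(\<lambda>p. cnj (g (fst p))) \<in> borel_measurable (lebesgue \<Otimes>\<^sub>M (lebesgue :: (complex ^ 'n) measure))"
      by (rule measurable_compose[OF measurable_fst L2_D(1)[OF L2_cnj[OF gL2]]])
    ultimately have "(\<lambda>p. (case p of (z, w) \<Rightarrow> landau_kernel \<nu> \<mu> l z w) * f (snd p) * cnj (g (fst p))) \<in> borel_measurable (lebesgue \<Otimes>\<^sub>M lebesgue)"
      by (intro borel_measurable_times continuous_pair_lebesgue_measurable landau_kernel_continuous)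
    then show "(\<lambda>(z, w). ?k z w) \<in> borel_measurable (lebesgue \<Otimes>\<^sub>M lebesgue)"
      by (simp add: case_prod_unfold)
    show "AE p in lebesgue \<Otimes>\<^sub>M lebesgue. norm (case p of (z, w) \<Rightarrow> ?k z w) \<le> norm (C * ((case p of (z, w) \<Rightarrow> exp (- (\<mu> / 4) * (norm (z - w))\<^sup>2) * (norm (f w))\<^sup>2)
        + (case p of (z, w) \<Rightarrow> exp (- (\<mu> / 4) * (norm (z - w))\<^sup>2) * (norm (g z))\<^sup>2)))"
    proof (rule AE_I2)
      fix p :: "(complex ^ 'n) \<times> (complex ^ 'n)"
      obtain z w where p: "p = (z, w)" by (cases p)
      let ?E = "exp (- (\<mu> / 4) * (norm (z - w))\<^sup>2)"
      have "norm (f w) * norm (g z) \<le> 2 * norm (f w) * norm (g z)" by simp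
      also have "\<dots> \<le> (norm (f w))\<^sup>2 + (norm (g z))\<^sup>2" by (rule sum_squares_bound)
      finally have "norm (landau_kernel \<nu> \<mu> l z w) * (norm (f w) * norm (g z)) \<le> C * ?E * ((norm (f w))\<^sup>2 + (norm (g z))\<^sup>2)"
        using C(1) by (intro mult_mono C(2)) auto
      also have "\<dots> = C * (?E * (norm (f w))\<^sup>2 + ?E * (norm (g z))\<^sup>2)" by (simp add: algebra_simps)
      finally show "norm (case p of (z, w) \<Rightarrow> ?k z w) \<le> norm (C * ((case p of (z, w) \<Rightarrow> exp (- (\<mu> / 4) * (norm (z - w))\<^sup>2) * (norm (f w))\<^sup>2)
        + (case p of (z, w) \<Rightarrow> exp (- (\<mu> / 4) * (norm (z - w))\<^sup>2) * (norm (g z))\<^sup>2)))"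
        using C(1) by (simp add: p norm_mult mult.assoc)
    qed
  qed
  from Fubini_integral[OF this]
  have F: "(\<integral>z. (\<integral>w. ?k z w \<partial>lebesgue) \<partial>lebesgue) = (\<integral>w. (\<integral>z. ?k z w \<partial>lebesgue) \<partial>lebesgue)" by simp
  have L: "(\<integral>w. ?k z w \<partial>lebesgue) = landau_projection \<nu> \<mu> l f z * cnj (g z)" for z
    unfolding landau_projection_def by (rule integral_mult_left_zero)
  have R: "(\<integral>z. ?k z w \<partial>lebesgue) = f w * cnj (g w)" for w
  proof -
    have "?k z w = f w * cnj (landau_kernel \<nu> \<mu> l w z * g z)" for z
      by (simp add: landau_kernel_cnj mult_ac)
    then have "(\<integral>z. ?k z w \<partial>lebesgue) = f w * cnj (\<integral>z. landau_kernel \<nu> \<mu> l w z * g z \<partial>lebesgue)"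
      by (simp only: integral_mult_right_zero Bochner_Integration.integral_cnj)
    then show ?thesis by (simp only: landau_kernel_reproducing[OF g \<mu>])
  qed
  show ?thesis using F unfolding L R L2_inner_def .
qed

lemma L2_inner_diff:
  assumes "f \<in> L2" "g \<in> L2" "h \<in> L2"
  shows "L2_inner (\<lambda>x. f x - g x) h = L2_inner f h - L2_inner g h"
  unfolding L2_inner_def left_diff_distrib
  by (intro Bochner_Integration.integral_diff L2_mult_integrable L2_cnj assms)

lemma landau_projection_is_orthogonal_projection:
  assumes \<mu>: "\<mu> > 0"
  shows "orthogonal_projection_onto (A2 \<nu> \<mu> l :: (complex ^ 'n \<Rightarrow> complex) set) (landau_projection \<nu> \<mu> l)"
  unfolding orthogonal_projection_onto_def
proof (intro ballI conjI)
  fix f g :: "complex ^ 'n \<Rightarrow> complex" assume f: "f \<in> L2"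
  show "landau_projection \<nu> \<mu> l f \<in> A2 \<nu> \<mu> l" by (rule landau_projection_A2[OF \<mu> f])
  assume g: "g \<in> A2 \<nu> \<mu> l"
  show "L2_inner (\<lambda>x. f x - landau_projection \<nu> \<mu> l f x) g = 0"
    using landau_projection_orthogonal[OF \<mu> f g] L2_inner_diff[OF f landau_projection_L2[OF \<mu> f] A2_D(1)[OF g]] by simp
qed

section \<open>Uniqueness of the projection and of its kernel\<close>

lemma L2_inner_self_eq_0_continuous:
  fixes D :: "'a::euclidean_space \<Rightarrow> complex"
  assumes D: "D \<in> L2" and cont: "continuous_on UNIV D" and zero: "L2_inner D D = 0"
  shows "D x = 0"
proof -
  have "complex_of_real (\<integral>x. (norm (D x))\<^sup>2 \<partial>lebesgue) = L2_inner D D"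
    unfolding L2_inner_def complex_norm_square[symmetric] by (rule integral_of_real[symmetric, OF L2_D(2)[OF D]])
  then have "(\<integral>x. (norm (D x))\<^sup>2 \<partial>lebesgue) = 0" using zero by simp
  then have "AE x in lebesgue. (norm (D x))\<^sup>2 = 0"
    using integral_nonneg_eq_0_iff_AE[OF L2_D(2)[OF D]] by simp
  then have "AE x in lebesgue. x \<in> D -` {0}" by eventually_elim simp
  moreover have "closed (D -` {0})" by (rule closed_vimage[OF closed_singleton cont])
  ultimately show ?thesis using mem_closed_if_AE_lebesgue by blast
qed

text \<open>The difference of the two projections of \<open>f\<close> is orthogonal to both of them, hence to itself.\<close>

lemma orthogonal_projection_unique:
  fixes A :: "('a::euclidean_space \<Rightarrow> complex) set"
  assumes P: "orthogonal_projection_onto A P" and Q: "orthogonal_projection_onto A Q"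
    and A: "A \<subseteq> L2" "\<And>F. F \<in> A \<Longrightarrow> continuous_on UNIV F" and f: "f \<in> L2"
  shows "P f x = Q f x"
proof -
  have mem: "P f \<in> A" "Q f \<in> A" using P Q f by (auto simp: orthogonal_projection_onto_def)
  then have L2: "P f \<in> L2" "Q f \<in> L2" using A by auto
  have orth: "L2_inner (P f) g = L2_inner (Q f) g" if "g \<in> A" for g
  proof -
    have "L2_inner (\<lambda>x. f x - P f x) g = 0" "L2_inner (\<lambda>x. f x - Q f x) g = 0"
      using P Q f that by (auto simp: orthogonal_projection_onto_def)
    moreover have "g \<in> L2" using that A by auto
    ultimately show ?thesis using L2_inner_diff f L2 by fastforce
  qed
  define D where "D x = P f x - Q f x" for x
  have D: "D \<in> L2" unfolding D_def by (rule L2_diff[OF L2])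
  have "L2_inner D (P f) = 0" "L2_inner D (Q f) = 0"
    unfolding D_def[abs_def] using L2_inner_diff[OF L2] L2 orth mem by auto
  moreover have "L2_inner D D = L2_inner D (P f) - L2_inner D (Q f)"
    unfolding L2_inner_def
    by (subst Bochner_Integration.integral_diff[symmetric])
      (auto simp: D_def right_diff_distrib intro!: L2_mult_integrable[OF D[unfolded D_def[abs_def]]] L2_cnj L2)
  ultimately have "L2_inner D D = 0" by simp
  moreover have "continuous_on UNIV D"
    unfolding D_def by (intro continuous_intros A(2) mem)
  ultimately have "D x = 0" using L2_inner_self_eq_0_continuous[OF D] by blast
  then show ?thesis by (simp add: D_def)
qed

text \<open>The difference \<open>D\<close> of the kernels at a fixed \<open>z\<close> annihilates all of \<open>L2\<close>. It need not be in \<open>L2\<close> itself,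
so it is tested against its conjugate, damped to be bounded by a Gaussian.\<close>

lemma schwartz_kernel_unique:
  fixes K K' :: "'a::euclidean_space \<Rightarrow> 'a \<Rightarrow> complex"
  assumes K: "schwartz_kernel P K" and K': "schwartz_kernel P K'"
  shows "AE w in lebesgue. K' z w = K z w"
proof -
  define G where "G w = complex_of_real (1 * exp (- 1 * (norm (w - 0))\<^sup>2))" for w :: 'a
  have G: "G \<in> L2" unfolding G_def by (rule gaussian_L2) simp
  have G0: "G w \<noteq> 0" for w by (simp add: G_def)
  have meas: "k z \<in> borel_measurable lebesgue" if "schwartz_kernel P k" for k
  proof -
    have "integrable lebesgue (\<lambda>w. k z w * G w)" using that G by (auto simp: schwartz_kernel_def)
    then have "(\<lambda>w. k z w * G w / G w) \<in> borel_measurable lebesgue"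
      using L2_D(1)[OF G] by (intro borel_measurable_divide) auto
    then show ?thesis using G0 by simp
  qed
  define D where "D w = K' z w - K z w" for w
  have D[measurable]: "D \<in> borel_measurable lebesgue"
    unfolding D_def[abs_def] using meas[OF K] meas[OF K'] by (rule borel_measurable_diff[rotated])
  \<comment> \<open>The quotient \<open>|D| / (1 + |D|^2)\<close> is at most 1, and \<open>D * f\<close> is nonnegative with the zeros of \<open>D\<close>.\<close>
  define f where "f w = cnj (D w) / of_real (1 + (norm (D w))\<^sup>2) * G w" for w
  have cnjD: "(\<lambda>w. cnj (D w)) \<in> borel_measurable lebesgue"
    using measurable_compose[OF D borel_measurable_continuous_onI[of cnj]] by (auto intro: continuous_intros)
  have f: "f \<in> L2"
  proof (rule L2_mono[OF G])
    show "f \<in> borel_measurable lebesgue"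
      unfolding f_def[abs_def] using cnjD D L2_D(1)[OF G]
      by (intro borel_measurable_times borel_measurable_divide borel_measurable_of_real) auto
    fix w
    have "2 * norm (D w) \<le> 1 + (norm (D w))\<^sup>2" using sum_squares_bound[of 1 "norm (D w)"] by simp
    then have "norm (D w) \<le> 1 + (norm (D w))\<^sup>2" using norm_ge_zero[of "D w"] by linarith
    then have "norm (D w) / (1 + (norm (D w))\<^sup>2) \<le> 1" by (simp add: add_pos_nonneg)
    moreover have "norm (f w) = norm (D w) / (1 + (norm (D w))\<^sup>2) * norm (G w)"
      by (simp add: f_def norm_mult norm_divide del: of_real_add)
    ultimately show "norm (f w) \<le> norm (G w)"
      by (metis mult_left_le_one_le mult.commute norm_ge_zero divide_nonneg_nonneg add_nonneg_nonneg zero_le_one zero_le_power2)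
  qed
  define u where "u w = (norm (D w))\<^sup>2 / (1 + (norm (D w))\<^sup>2) * exp (- (norm w)\<^sup>2)" for w
  have Df: "D w * f w = of_real (u w)" for w
  proof -
    have "D w * f w = (D w * cnj (D w)) / of_real (1 + (norm (D w))\<^sup>2) * G w" by (simp add: f_def)
    then show ?thesis unfolding complex_norm_square[symmetric] u_def G_def by simp
  qed
  have intK: "integrable lebesgue (\<lambda>w. K z w * f w)" "integrable lebesgue (\<lambda>w. K' z w * f w)"
    "(\<integral>w. K z w * f w \<partial>lebesgue) = (\<integral>w. K' z w * f w \<partial>lebesgue)"
    using K K' f by (auto simp: schwartz_kernel_def)
  then have "integrable lebesgue (\<lambda>w. D w * f w)" "(\<integral>w. D w * f w \<partial>lebesgue) = 0"
    unfolding D_def left_diff_distrib by auto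
  then have int: "integrable lebesgue (\<lambda>w. complex_of_real (u w))" "(\<integral>w. complex_of_real (u w) \<partial>lebesgue) = 0"
    unfolding Df by auto
  then have u: "integrable lebesgue u" "(\<integral>w. u w \<partial>lebesgue) = 0"
    by (simp_all add: integral_of_real of_real_eq_0_iff complex_of_real_integrable_eq)
  have "AE w in lebesgue. u w = 0"
    using integral_nonneg_eq_0_iff_AE[OF u(1)] u(2) by (auto simp: u_def)
  then show ?thesis
  proof eventually_elim
    case (elim w)
    have "1 + (norm (D w))\<^sup>2 \<noteq> 0" by (metis add_pos_nonneg less_irrefl zero_le_power2 zero_less_one)
    then have "D w = 0" using elim by (simp add: u_def)
    then show ?case by (simp add: D_def)
  qed
qed

theorem proposition5p7:
  fixes \<nu> \<mu> :: real and l :: nat and K :: "complex ^ 'n \<Rightarrow> complex ^ 'n \<Rightarrow> complex"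
  assumes "\<mu> > 0"
    and K: "\<And>z w. K z w =
      of_real ((\<mu> / pi) ^ CARD('n) * (fact (CARD('n) - 1 + l) / (fact (CARD('n) - 1) * fact l)))
      * j_factor \<nu> \<mu> z w
      * of_real (exp (- (\<mu> / 2) * (norm (z - w))\<^sup>2))
      * of_real (hyp_1F1 (- real l) (real CARD('n)) (\<mu> * (norm (z - w))\<^sup>2))"
  shows "(\<exists>P. orthogonal_projection_onto (A2 \<nu> \<mu> l :: (complex ^ 'n \<Rightarrow> complex) set) P) \<and>
    (\<forall>P. orthogonal_projection_onto (A2 \<nu> \<mu> l) P \<longrightarrow>
       schwartz_kernel P K \<and>
       (\<forall>K'. schwartz_kernel P K' \<longrightarrow> (\<forall>z. AE w in lebesgue. K' z w = K z w)))"
proof (intro conjI allI impI)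
  note proj = landau_projection_is_orthogonal_projection[OF \<open>\<mu> > 0\<close>, of \<nu> l]
  show "\<exists>P. orthogonal_projection_onto (A2 \<nu> \<mu> l :: (complex ^ 'n \<Rightarrow> complex) set) P"
    using proj by blast
  have K_eq: "K = landau_kernel \<nu> \<mu> l"
    by (intro ext) (simp add: K landau_kernel_def landau_profile_def mult_ac)
  fix P assume P: "orthogonal_projection_onto (A2 \<nu> \<mu> l :: (complex ^ 'n \<Rightarrow> complex) set) P"
  have A: "A2 \<nu> \<mu> l \<subseteq> L2" "\<And>F. F \<in> A2 \<nu> \<mu> l \<Longrightarrow> continuous_on UNIV (F :: complex ^ 'n \<Rightarrow> complex)"
    using A2_D(1,3) by blast+
  show ker: "schwartz_kernel P K"
    unfolding schwartz_kernel_def K_eq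
  proof (intro ballI allI conjI)
    fix f :: "complex ^ 'n \<Rightarrow> complex" and z assume f: "f \<in> L2"
    show "integrable lebesgue (\<lambda>w. landau_kernel \<nu> \<mu> l z w * f w)"
      by (rule landau_kernel_integrable[OF \<open>\<mu> > 0\<close> f])
    show "P f z = (\<integral>w. landau_kernel \<nu> \<mu> l z w * f w \<partial>lebesgue)"
      using orthogonal_projection_unique[OF P proj A f] by (simp add: landau_projection_def)
  qed
  fix K' z assume "schwartz_kernel P K'"
  with ker show "AE w in lebesgue. K' z w = K z w" by (rule schwartz_kernel_unique)
qed

end
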